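(* Let $\Omega=\{(x_1,x_2,x_3)\in\mathbb R^3: x_1>0,\ x_2>0,\ 10>x_3>2(x_1+x_2)\}$ and $$\varphi=\frac{|x|^2}{2}+\lambda_0\,\chi\,x_1x_2,$$ where $\lambda_0>0$ is a small constant and $\chi$ is a smooth cut-off function with $\chi=1$ in $B_{1/2}((0,0,10))$ and $\chi\equiv0$ outside $B_1((0,0,10))$. Then there exists $f\in C^{0,1}(\overline\Omega)$ satisfying $\det D^2\varphi>f$ on $\Gamma_1(\Omega)\setminus\Gamma_0(\Omega)$ such that the Dirichlet problem $$\det D^2u=f\ \text{ in }\Omega,\qquad u=\varphi\ \text{ on }\partial\Omega$$ admits a convex solution $u\in C^2(\overline\Omega)$ with $u\notin C^{2,\alpha}(\overline\Omega)$ for every $\alpha\in(0,1)$.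
   Context: $\Gamma_1(\Omega)$ is the union of the edges and vertices of the polytope $\Omega$, and $\Gamma_0(\Omega)$ is the set of its vertices. $B_r(p)$ is the ball of radius $r$ centred at $p$. *)

theory Defs
  imports "HOL-Analysis.Analysis"
begin

definition partial_D :: "'n::finite \<Rightarrow> (real^'n \<Rightarrow> real) \<Rightarrow> real^'n \<Rightarrow> real" where
  "partial_D i f x = frechet_derivative f (at x) (axis i 1)"

primrec iter_D :: "'n::finite list \<Rightarrow> (real^'n \<Rightarrow> real) \<Rightarrow> real^'n \<Rightarrow> real" where
  "iter_D [] f = f"
| "iter_D (i # is) f = partial_D i (iter_D is f)"

definition hessian :: "(real^'n::finite \<Rightarrow> real) \<Rightarrow> real^'n \<Rightarrow> real^'n^'n" where
  "hessian u x = (\<chi> i j. iter_D [i, j] u x)"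

definition smooth :: "(real^'n::finite \<Rightarrow> real) \<Rightarrow> bool" where
  "smooth f \<longleftrightarrow> (\<forall>is x. iter_D is f differentiable (at x))"

text \<open>
  For \<open>S\<close> open, \<open>Ck_closure k S\<close> is the space $C^k(\overline S)$: the partial derivatives
  of order at most \<open>k\<close> exist in \<open>S\<close> and extend continuously to \<open>closure S\<close>. The function
  itself is given on \<open>closure S\<close> and is its own extension; the values of a function
  outside \<open>closure S\<close> are irrelevant.
\<close>

definition Ck_closure :: "nat \<Rightarrow> (real^'n::finite) set \<Rightarrow> (real^'n \<Rightarrow> real) set" where
  "Ck_closure k S = {u.
     continuous_on (closure S) u \<and>
     (\<forall>is. length is < k \<longrightarrow> (\<forall>x\<in>S. iter_D is u differentiable (at x))) \<and>
     (\<forall>is. length is \<le> k \<longrightarrow>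
        (\<exists>g. continuous_on (closure S) g \<and> (\<forall>x\<in>S. g x = iter_D is u x)))}"

definition hoelder_on :: "real \<Rightarrow> (real^'n::finite) set \<Rightarrow> (real^'n \<Rightarrow> real) \<Rightarrow> bool" where
  "hoelder_on \<alpha> S g \<longleftrightarrow> (\<exists>C. \<forall>x\<in>S. \<forall>y\<in>S. \<bar>g x - g y\<bar> \<le> C * dist x y powr \<alpha>)"

text \<open>
  $C^{k,\alpha}(\overline S)$. A uniform Hoelder estimate on \<open>S\<close> is the same as one on
  \<open>closure S\<close> for the continuous extension.
\<close>

definition Ck_alpha_closure ::
    "nat \<Rightarrow> real \<Rightarrow> (real^'n::finite) set \<Rightarrow> (real^'n \<Rightarrow> real) set" where
  "Ck_alpha_closure k \<alpha> S =
     {u \<in> Ck_closure k S. \<forall>is. length is = k \<longrightarrow> hoelder_on \<alpha> S (iter_D is u)}"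

text \<open>
  The domain \<open>S\<close> is the open polytope; its vertices and (closed) edges are faces of
  \<open>closure S\<close>.
\<close>

definition Gamma0 :: "(real^'n::finite) set \<Rightarrow> (real^'n) set" where
  "Gamma0 S = {v. v extreme_point_of closure S}"

definition Gamma1 :: "(real^'n::finite) set \<Rightarrow> (real^'n) set" where
  "Gamma1 S = \<Union>{e. e edge_of closure S} \<union> Gamma0 S"

definition Omega :: "(real^3) set" where
  "Omega = {x. x$1 > 0 \<and> x$2 > 0 \<and> 10 > x$3 \<and> x$3 > 2 * (x$1 + x$2)}"

definition apex :: "real^3" where
  "apex = vector [0, 0, 10]"

definition phi :: "real \<Rightarrow> (real^3 \<Rightarrow> real) \<Rightarrow> real^3 \<Rightarrow> real" where
  "phi lam0 cutoff x = (norm x)\<^sup>2 / 2 + lam0 * cutoff x * x$1 * x$2"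

end

theory Submission
  imports Defs
begin

text \<open>
  Put \<open>u = \<phi> + \<epsilon> Vb + \<Sum>k. V k\<close>. The function \<open>Vb\<close> vanishes on the boundary, and on the
  edge cut out by two faces with inward normals \<open>a, b\<close> it adds \<open>s (a \<otimes> b + b \<otimes> a)\<close> with \<open>s > 0\<close> to the Hessian,
  which lowers the determinant because no dihedral angle exceeds a right angle. On the vertical edge
  the mixed derivative \<open>c\<close> of the base function is positive, tends to 0 at the origin, and is locally
  constant on a sequence of intervals. There the linearised operator lives in a wedge of angle
  \<open>\<theta> = arccos c\<close> and has the homogeneous solution \<open>r^(2+\<gamma>) sin ((2+\<gamma>) \<phi>)\<close> with \<open>\<gamma> = \<pi>/\<theta> - 2 > 0\<close>, whose
  second derivatives are no better than \<open>C^\<gamma>\<close>. Since \<open>\<gamma> \<rightarrow> 0\<close> along the intervals, superposing small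
  localised copies rules out every Hoelder exponent.

  The determinant stays Lipschitz because the homogeneous solution is completed by finitely many
  terms \<open>r^(2+j\<gamma>) h j\<close>, \<open>j \<le> N\<close>, which cancel all powers \<open>r^(j\<gamma>)\<close> with \<open>j\<gamma> < 1\<close> in the two-dimensional
  determinant; the multiplier of the terms may depend on the point, as its derivatives only enter with
  higher powers of \<open>r\<close>.
\<close>

text \<open>At a point of an open edge the boundary data fix every entry of the Hessian of a C^2
  solution except the one that mixes the two faces. On the vertical edge below the cut-off this
  leaves the determinant 1 - c^2, so the strict inequality forces c to be nonzero. With c > 0 the
  wedge is acute and its first exponent pi / theta lies between 2 and 3: a singularity compatible
  with C^2 but with no Hoelder exponent above gamma. At the vertex a third face fixes the missing
  entry too, which forces c to tend to 0; this is what sends gamma to 0. The coefficient is frozen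
  on intervals because only there are the exponents constant, so that homogeneous functions can be
  used.

  The order of the constants matters. The factor epsilon of \<open>Vb\<close> is limited by
  convexity alone. The threshold for the factor of the cut-off is chosen after it, so that
  \<open>Vb\<close> wins where sign and slope of the cut-off are uncontrolled. The amplitudes of the
  singular pieces come last, one for each interval.\<close>

section \<open>Partial derivatives\<close>

lemma partial_D_eq:
  assumes "(f has_derivative D) (at x)"
  shows "partial_D i f x = D (axis i 1)"
  using frechet_derivative_at[OF assms] by (simp add: partial_D_def)

text \<open>Both functions have the same derivatives at \<open>x\<close>, so the choice operator in
  \<open>frechet_derivative\<close> picks the same value even where neither is
  differentiable.\<close>

lemma partial_D_cong:
  assumes "open S" "x \<in> S" "\<And>y. y \<in> S \<Longrightarrow> f y = g y"
  shows "partial_D i f x = partial_D i g x"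
proof -
  have "(f has_derivative D) (at x) \<longleftrightarrow> (g has_derivative D) (at x)" for D
    using has_derivative_transform_within_open[OF _ assms(1,2)] assms(3) by metis
  thus ?thesis by (simp add: partial_D_def frechet_derivative_def)
qed

lemma iter_D_cong:
  assumes "open S" "\<And>y. y \<in> S \<Longrightarrow> f y = g y" "x \<in> S"
  shows "iter_D is f x = iter_D is g x"
  using assms(3)
proof (induction "is" arbitrary: x)
  case Nil
  thus ?case using assms by simp
next
  case (Cons i "is")
  have "partial_D i (iter_D is f) x = partial_D i (iter_D is g) x"
    by (rule partial_D_cong[OF assms(1) Cons.prems Cons.IH])
  thus ?case by simp
qed

lemma differentiable_cong_open:
  assumes "open S" "x \<in> S" "\<And>y. y \<in> S \<Longrightarrow> f y = g y" "f differentiable at x"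
  shows "g differentiable at x"
  using assms by (metis has_derivative_transform_within_open differentiable_def)

lemma partial_D_const [simp]: "partial_D i (\<lambda>_. c) x = 0"
  using partial_D_eq[OF has_derivative_const[of c "at x"]] by simp

lemma partial_D_component [simp]: "partial_D i (\<lambda>x. x $ j) x = (if i = j then 1 else 0)"
proof -
  have "((\<lambda>x. x $ j) has_derivative (\<lambda>x. x $ j)) (at x)"
    by (rule bounded_linear_imp_has_derivative) (rule bounded_linear_vec_nth)
  from partial_D_eq[OF this] show ?thesis by (simp add: axis_def)
qed

lemma partial_D_add:
  assumes "f differentiable at x" "g differentiable at x"
  shows "partial_D i (\<lambda>x. f x + g x) x = partial_D i f x + partial_D i g x"
  using partial_D_eq[OF has_derivative_add[OF assms[unfolded frechet_derivative_works]]]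
  by (simp add: partial_D_def)

lemma partial_D_mult:
  fixes f g :: "real^'n::finite \<Rightarrow> real"
  assumes "f differentiable at x" "g differentiable at x"
  shows "partial_D i (\<lambda>x. f x * g x) x = f x * partial_D i g x + partial_D i f x * g x"
  using partial_D_eq[OF has_derivative_mult[OF assms[unfolded frechet_derivative_works]]]
  by (simp add: partial_D_def)

lemma partial_D_chain:
  fixes g :: "real^'n::finite \<Rightarrow> real"
  assumes "(h has_real_derivative h') (at (g x))" "g differentiable at x"
  shows "partial_D i (\<lambda>x. h (g x)) x = h' * partial_D i g x"
    and "(\<lambda>x. h (g x)) differentiable at x"
proof -
  have d: "((\<lambda>x. h (g x)) has_derivative (\<lambda>v. h' * frechet_derivative g (at x) v)) (at x)"
    using has_derivative_compose[OF assms(2)[unfolded frechet_derivative_works]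
        assms(1)[unfolded has_field_derivative_def]] by simp
  show "partial_D i (\<lambda>x. h (g x)) x = h' * partial_D i g x"
    using partial_D_eq[OF d] by (simp add: partial_D_def)
  show "(\<lambda>x. h (g x)) differentiable at x" using d by (auto simp: differentiable_def)
qed

lemma has_derivative_partial_D:
  fixes g :: "real^'n::finite \<Rightarrow> real"
  assumes "g differentiable at x"
  shows "(g has_derivative (\<lambda>v. \<Sum>i\<in>UNIV. v $ i * partial_D i g x)) (at x)"
proof -
  let ?D = "frechet_derivative g (at x)"
  have lin: "linear ?D" using assms linear_frechet_derivative by blast
  have "?D v = (\<Sum>i\<in>UNIV. v $ i * partial_D i g x)" for v
  proof -
    have "?D v = ?D (\<Sum>i\<in>UNIV. v $ i *\<^sub>R axis i 1)"
      by (simp add: basis_expansion scalar_mult_eq_scaleR[symmetric])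
    also have "\<dots> = (\<Sum>i\<in>UNIV. v $ i * ?D (axis i 1))"
      by (simp add: linear_sum[OF lin] linear_scale[OF lin])
    finally show ?thesis by (simp add: partial_D_def)
  qed
  hence "?D = (\<lambda>v. \<Sum>i\<in>UNIV. v $ i * partial_D i g x)" by blast
  thus ?thesis using assms frechet_derivative_works by metis
qed

lemma abs_sum_partial_le:
  fixes v :: "real^'n::finite"
  assumes "\<And>i. \<bar>a i\<bar> \<le> L"
  shows "\<bar>\<Sum>i\<in>UNIV. v $ i * a i\<bar> \<le> (real CARD('n) * L) * norm v"
proof -
  have "\<bar>\<Sum>i\<in>UNIV. v $ i * a i\<bar> \<le> (\<Sum>i\<in>(UNIV::'n set). norm v * L)"
    by (rule order_trans[OF sum_abs sum_mono]) (auto simp: abs_mult intro!: mult_mono component_le_norm_cart assms)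
  thus ?thesis by (simp add: mult_ac)
qed

lemma bounded_partials_imp_lipschitz:
  fixes g :: "real^'n::finite \<Rightarrow> real"
  assumes "convex S" "\<And>x. x \<in> S \<Longrightarrow> g differentiable at x"
    and "\<And>x i. x \<in> S \<Longrightarrow> \<bar>partial_D i g x\<bar> \<le> L" "x \<in> S" "y \<in> S"
  shows "\<bar>g x - g y\<bar> \<le> real CARD('n) * L * norm (x - y)"
proof -
  have "norm (g x - g y) \<le> (real CARD('n) * L) * norm (x - y)"
  proof (rule differentiable_bound[OF assms(1) _ _ assms(4,5)])
    fix z assume z: "z \<in> S"
    show "(g has_derivative (\<lambda>v. \<Sum>i\<in>UNIV. v $ i * partial_D i g z)) (at z within S)"
      using has_derivative_partial_D[OF assms(2)[OF z]] has_derivative_at_withinI by blast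
    show "onorm (\<lambda>v. \<Sum>i\<in>UNIV. v $ i * partial_D i g z) \<le> real CARD('n) * L"
    proof (rule onorm_le)
      fix v :: "real^'n"
      show "norm (\<Sum>i\<in>UNIV. v $ i * partial_D i g z) \<le> real CARD('n) * L * norm v"
        using abs_sum_partial_le[of "\<lambda>i. partial_D i g z" L v] assms(3)[OF z] by simp
    qed
  qed
  thus ?thesis by simp
qed

section \<open>Weighted symbol classes\<close>

text \<open>The parameter \<open>k\<close> is an amplitude; \<open>e\<close> records the gain in amplitude and \<open>d\<close> the gain in
  the weight. Every derivative costs one power of the weight.\<close>

definition wbound :: "(real^3) set \<Rightarrow> (real^3 \<Rightarrow> real) \<Rightarrow> nat \<Rightarrow> real \<Rightarrow> (real \<Rightarrow> real^3 \<Rightarrow> real) \<Rightarrow> bool" where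
  "wbound S \<rho> e d g \<longleftrightarrow> (\<exists>C. \<forall>k\<in>{0<..1}. \<forall>x\<in>S. \<bar>g k x\<bar> \<le> C * k ^ e * \<rho> x powr d)"

primrec sy :: "nat \<Rightarrow> (real^3) set \<Rightarrow> (real^3 \<Rightarrow> real) \<Rightarrow> nat \<Rightarrow> real \<Rightarrow> (real \<Rightarrow> real^3 \<Rightarrow> real) \<Rightarrow> bool" where
  "sy 0 = (\<lambda>S \<rho> e d g. wbound S \<rho> e d g)"
| "sy (Suc n) = (\<lambda>S \<rho> e d g. wbound S \<rho> e d g \<and> (\<forall>k\<in>{0<..1}. \<forall>x\<in>S. g k differentiable at x) \<and>
     (\<forall>i. sy n S \<rho> e (d - 1) (\<lambda>k. partial_D i (g k))))"

lemma wboundE: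
  assumes "wbound S \<rho> e d g"
  obtains C where "C > 0" "\<And>k x. 0 < k \<Longrightarrow> k \<le> 1 \<Longrightarrow> x \<in> S \<Longrightarrow> \<bar>g k x\<bar> \<le> C * k ^ e * \<rho> x powr d"
proof -
  obtain C where C: "\<forall>k\<in>{0<..1}. \<forall>x\<in>S. \<bar>g k x\<bar> \<le> C * k ^ e * \<rho> x powr d"
    using assms by (auto simp: wbound_def)
  have "\<bar>g k x\<bar> \<le> (\<bar>C\<bar> + 1) * k ^ e * \<rho> x powr d" if "0 < k" "k \<le> 1" "x \<in> S" for k x
  proof -
    have "\<bar>g k x\<bar> \<le> C * k ^ e * \<rho> x powr d" using C that by auto
    also have "\<dots> \<le> (\<bar>C\<bar> + 1) * k ^ e * \<rho> x powr d"
      using that by (intro mult_right_mono) auto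
    finally show ?thesis .
  qed
  thus ?thesis using that[of "\<bar>C\<bar> + 1"] by force
qed

lemma wboundI:
  assumes "\<And>k x. 0 < k \<Longrightarrow> k \<le> 1 \<Longrightarrow> x \<in> S \<Longrightarrow> \<bar>g k x\<bar> \<le> C * k ^ e * \<rho> x powr d"
  shows "wbound S \<rho> e d g"
  using assms unfolding wbound_def by (intro exI[of _ C]) auto

lemma sy_wbound: "sy n S \<rho> e d g \<Longrightarrow> wbound S \<rho> e d g"
  by (cases n) auto

lemma sy_SucD: "sy (Suc n) S \<rho> e d g \<Longrightarrow> sy n S \<rho> e d g"
proof (induction n arbitrary: d g)
  case (Suc n)
  thus ?case by (metis sy.simps(2))
qed simp

lemma sy_le: assumes "m \<le> n" "sy n S \<rho> e d g" shows "sy m S \<rho> e d g"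
  using assms by (induction n rule: dec_induct) (auto dest: sy_SucD simp del: sy.simps)

lemma sy_partial: "sy (Suc n) S \<rho> e d g \<Longrightarrow> sy n S \<rho> e (d - 1) (\<lambda>k. partial_D i (g k))"
  by simp

lemma sy_differentiable: "sy (Suc n) S \<rho> e d g \<Longrightarrow> 0 < k \<Longrightarrow> k \<le> 1 \<Longrightarrow> x \<in> S \<Longrightarrow> g k differentiable at x"
  by simp

lemma sy_iter:
  "sy n S \<rho> e d g \<Longrightarrow> length is \<le> n \<Longrightarrow> sy (n - length is) S \<rho> e (d - real (length is)) (\<lambda>k. iter_D is (g k))"
proof (induction "is")
  case (Cons i "is")
  then have "sy (Suc (n - Suc (length is))) S \<rho> e (d - real (length is)) (\<lambda>k. iter_D is (g k))"
    by (simp add: Suc_diff_Suc)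
  from sy_partial[OF this, of i] show ?case by (simp add: algebra_simps)
qed simp

text \<open>The upper bound \<open>M\<close> allows a higher power of the weight to be traded for a
  lower one, as in \<open>sy_mono\<close>.\<close>

locale weighted =
  fixes S :: "(real^3) set" and \<rho> :: "real^3 \<Rightarrow> real" and M :: real
  assumes open_S: "open S" and weight_pos: "x \<in> S \<Longrightarrow> 0 < \<rho> x" and weight_le: "x \<in> S \<Longrightarrow> \<rho> x \<le> M"
begin

abbreviation "symb n \<equiv> sy n S \<rho>"

lemma weight_nz: "x \<in> S \<Longrightarrow> \<rho> x \<noteq> 0"
  using weight_pos[of x] by simp

lemma weight_powr_0: "x \<in> S \<Longrightarrow> \<rho> x powr 0 = 1"
  using weight_pos[of x] by simp

lemma wbound_cong:
  assumes "\<And>k x. 0 < k \<Longrightarrow> k \<le> 1 \<Longrightarrow> x \<in> S \<Longrightarrow> g k x = h k x"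
  shows "wbound S \<rho> e d g \<longleftrightarrow> wbound S \<rho> e d h"
  using assms by (simp add: wbound_def)

lemma sy_cong:
  assumes "\<And>k x. 0 < k \<Longrightarrow> k \<le> 1 \<Longrightarrow> x \<in> S \<Longrightarrow> g k x = h k x"
  shows "symb n e d g \<longleftrightarrow> symb n e d h"
  using assms
proof (induction n arbitrary: d g h)
  case 0
  show ?case using wbound_cong[OF 0] by simp
next
  case (Suc n)
  have "symb n e (d - 1) (\<lambda>k. partial_D i (g k)) = symb n e (d - 1) (\<lambda>k. partial_D i (h k))" for i
    by (rule Suc.IH) (rule partial_D_cong[OF open_S], auto simp: Suc.prems)
  moreover have "(g k differentiable at x) = (h k differentiable at x)" if "0 < k" "k \<le> 1" "x \<in> S" for k x
    using differentiable_cong_open[OF open_S \<open>x \<in> S\<close>, of "g k" "h k"]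
      differentiable_cong_open[OF open_S \<open>x \<in> S\<close>, of "h k" "g k"] Suc.prems that by auto
  moreover have "wbound S \<rho> e d g \<longleftrightarrow> wbound S \<rho> e d h" using Suc.prems by (rule wbound_cong)
  ultimately show ?case by simp
qed

lemma wbound_mono:
  assumes "e' \<le> e" "d' \<le> d" "wbound S \<rho> e d g"
  shows "wbound S \<rho> e' d' g"
proof -
  obtain C where C: "C > 0" "\<And>k x. 0 < k \<Longrightarrow> k \<le> 1 \<Longrightarrow> x \<in> S \<Longrightarrow> \<bar>g k x\<bar> \<le> C * k ^ e * \<rho> x powr d"
    using wboundE[OF assms(3)] by blast
  show ?thesis
  proof (rule wboundI)
    fix k :: real and x assume k: "0 < k" "k \<le> 1" "x \<in> S"
    have 1: "k ^ e \<le> k ^ e'" using k assms(1) by (intro power_decreasing) auto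
    have 2: "\<rho> x powr d \<le> M powr (d - d') * \<rho> x powr d'"
    proof -
      have "\<rho> x powr d = \<rho> x powr (d - d') * \<rho> x powr d'" by (simp add: powr_add[symmetric])
      also have "\<dots> \<le> M powr (d - d') * \<rho> x powr d'"
        using weight_pos[OF k(3)] weight_le[OF k(3)] assms(2) by (intro mult_right_mono powr_mono2) auto
      finally show ?thesis .
    qed
    have "\<bar>g k x\<bar> \<le> C * k ^ e * \<rho> x powr d" using C k by auto
    also have "\<dots> \<le> C * k ^ e' * (M powr (d - d') * \<rho> x powr d')"
      using 1 2 C k by (intro mult_mono) auto
    finally show "\<bar>g k x\<bar> \<le> C * M powr (d - d') * k ^ e' * \<rho> x powr d'" by (simp add: mult_ac)
  qed
qed

lemma sy_mono:
  assumes "symb n e d g" "e' \<le> e" "d' \<le> d"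
  shows "symb n e' d' g"
  using assms
proof (induction n arbitrary: d d' g)
  case 0
  thus ?case using wbound_mono by simp
next
  case (Suc n)
  have "symb n e' (d' - 1) (\<lambda>k. partial_D i (g k))" for i
    by (rule Suc.IH[of "d - 1"]) (use Suc.prems in auto)
  thus ?case using Suc.prems wbound_mono by auto
qed

lemma wbound_add:
  assumes "wbound S \<rho> e d g" "wbound S \<rho> e d h"
  shows "wbound S \<rho> e d (\<lambda>k x. g k x + h k x)"
proof -
  obtain C where C: "C > 0" "\<And>k x. 0 < k \<Longrightarrow> k \<le> 1 \<Longrightarrow> x \<in> S \<Longrightarrow> \<bar>g k x\<bar> \<le> C * k ^ e * \<rho> x powr d"
    using wboundE[OF assms(1)] by blast
  obtain D where D: "D > 0" "\<And>k x. 0 < k \<Longrightarrow> k \<le> 1 \<Longrightarrow> x \<in> S \<Longrightarrow> \<bar>h k x\<bar> \<le> D * k ^ e * \<rho> x powr d"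
    using wboundE[OF assms(2)] by blast
  show ?thesis
  proof (rule wboundI)
    fix k :: real and x assume k: "0 < k" "k \<le> 1" "x \<in> S"
    have "\<bar>g k x + h k x\<bar> \<le> C * k ^ e * \<rho> x powr d + D * k ^ e * \<rho> x powr d"
      using C(2)[OF k] D(2)[OF k] by linarith
    thus "\<bar>g k x + h k x\<bar> \<le> (C + D) * k ^ e * \<rho> x powr d" by (simp add: algebra_simps)
  qed
qed

lemma sy_add:
  assumes "symb n e d g" "symb n e d h"
  shows "symb n e d (\<lambda>k x. g k x + h k x)"
  using assms
proof (induction n arbitrary: d g h)
  case 0
  thus ?case using wbound_add by simp
next
  case (Suc n)
  have "symb n e (d - 1) (\<lambda>k. partial_D i (\<lambda>x. g k x + h k x))" for i
  proof -
    have "symb n e (d - 1) (\<lambda>k x. partial_D i (g k) x + partial_D i (h k) x)"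
      using Suc by auto
    thus ?thesis
      by (rule sy_cong[THEN iffD1, rotated]) (use Suc.prems in \<open>auto simp: partial_D_add\<close>)
  qed
  thus ?case using Suc.prems wbound_add by auto
qed

lemma wbound_mult:
  assumes "wbound S \<rho> e d g" "wbound S \<rho> e' d' h"
  shows "wbound S \<rho> (e + e') (d + d') (\<lambda>k x. g k x * h k x)"
proof -
  obtain C where C: "C > 0" "\<And>k x. 0 < k \<Longrightarrow> k \<le> 1 \<Longrightarrow> x \<in> S \<Longrightarrow> \<bar>g k x\<bar> \<le> C * k ^ e * \<rho> x powr d"
    using wboundE[OF assms(1)] by blast
  obtain D where D: "D > 0" "\<And>k x. 0 < k \<Longrightarrow> k \<le> 1 \<Longrightarrow> x \<in> S \<Longrightarrow> \<bar>h k x\<bar> \<le> D * k ^ e' * \<rho> x powr d'"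
    using wboundE[OF assms(2)] by blast
  show ?thesis
  proof (rule wboundI)
    fix k :: real and x assume k: "0 < k" "k \<le> 1" "x \<in> S"
    have "\<bar>g k x * h k x\<bar> \<le> (C * k ^ e * \<rho> x powr d) * (D * k ^ e' * \<rho> x powr d')"
      unfolding abs_mult using C D k by (intro mult_mono) auto
    thus "\<bar>g k x * h k x\<bar> \<le> (C * D) * k ^ (e + e') * \<rho> x powr (d + d')"
      by (simp add: power_add powr_add mult_ac)
  qed
qed

lemma sy_mult:
  assumes "symb n e d g" "symb n e' d' h"
  shows "symb n (e + e') (d + d') (\<lambda>k x. g k x * h k x)"
  using assms
proof (induction n arbitrary: d d' g h)
  case 0
  thus ?case using wbound_mult by simp
next
  case (Suc n)
  have "symb n (e + e') (d + d' - 1) (\<lambda>k. partial_D i (\<lambda>x. g k x * h k x))" for i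
  proof -
    have "symb n (e + e') (d + (d' - 1)) (\<lambda>k x. g k x * partial_D i (h k) x)"
      by (rule Suc.IH[OF sy_SucD[OF Suc.prems(1)] sy_partial[OF Suc.prems(2)]])
    moreover have "symb n (e + e') ((d - 1) + d') (\<lambda>k x. partial_D i (g k) x * h k x)"
      by (rule Suc.IH[OF sy_partial[OF Suc.prems(1)] sy_SucD[OF Suc.prems(2)]])
    ultimately have "symb n (e + e') (d + d' - 1) (\<lambda>k x. g k x * partial_D i (h k) x + partial_D i (g k) x * h k x)"
      by (intro sy_add) (auto simp: algebra_simps)
    thus ?thesis
      by (rule sy_cong[THEN iffD1, rotated]) (use Suc.prems in \<open>auto simp: partial_D_mult\<close>)
  qed
  thus ?case using Suc.prems wbound_mult by auto
qed

lemma sy_zero: "symb n e d (\<lambda>_ _. 0)"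
proof (induction n arbitrary: d)
  case 0
  show ?case by (auto intro!: wboundI[where C = 0])
next
  case (Suc n)
  thus ?case by (auto intro!: wboundI[where C = 0] simp: sy_cong[of "\<lambda>k. partial_D _ (\<lambda>_. 0)" "\<lambda>_ _. 0"])
qed

lemma sy_const: assumes "d \<le> 0" shows "symb n 0 d (\<lambda>_ _. c)"
proof -
  have "symb n 0 0 (\<lambda>_ _. c)"
  proof -
    have w: "wbound S \<rho> 0 0 (\<lambda>_ _. c)"
      by (rule wboundI[where C = "\<bar>c\<bar>"]) (use weight_pos in force)
    show ?thesis
    proof (cases n)
      case 0
      thus ?thesis using w by simp
    next
      case (Suc m)
      have "symb m 0 (-1) (\<lambda>k. partial_D i (\<lambda>_. c))" for i
        using sy_zero by (rule sy_cong[THEN iffD1, rotated]) simp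
      thus ?thesis using w Suc by simp
    qed
  qed
  thus ?thesis using sy_mono assms by blast
qed

lemma sy_cmult: "symb n e d g \<Longrightarrow> symb n e d (\<lambda>k x. c * g k x)"
  using sy_mult[OF sy_const[of 0 n c]] by simp

lemma sy_uminus: "symb n e d g \<Longrightarrow> symb n e d (\<lambda>k x. - g k x)"
  using sy_cmult[of n e d g "-1"] by simp

lemma sy_diff: "symb n e d g \<Longrightarrow> symb n e d h \<Longrightarrow> symb n e d (\<lambda>k x. g k x - h k x)"
  using sy_add[of n e d g "\<lambda>k x. - h k x"] sy_uminus by simp

lemma sy_sum:
  "(\<And>i. i \<in> I \<Longrightarrow> symb n e d (g i)) \<Longrightarrow> symb n e d (\<lambda>k x. \<Sum>i\<in>I. g i k x)"
  by (induction I rule: infinite_finite_induct) (auto intro!: sy_add sy_zero)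

lemma sy_amplitude: "symb n 1 0 (\<lambda>k _. k)"
proof -
  have w: "wbound S \<rho> 1 0 (\<lambda>k _. k)"
    by (rule wboundI[where C = 1]) (use weight_pos in force)
  show ?thesis
  proof (cases n)
    case 0
    thus ?thesis using w by simp
  next
    case (Suc m)
    have "symb m 1 (-1) (\<lambda>k. partial_D i (\<lambda>_. k))" for i
      using sy_zero by (rule sy_cong[THEN iffD1, rotated]) simp
    thus ?thesis using w Suc by simp
  qed
qed

lemma sy_power: "symb n e 0 g \<Longrightarrow> symb n (j * e) 0 (\<lambda>k x. g k x ^ j)"
  using sy_const[of 0 n 1] sy_mult[of n e 0 g _ 0] by (induction j) auto

text \<open>The first derivatives are constants and must have weight \<open>d - 1\<close>, which is
  possible for \<open>d - 1 \<le> 0\<close>.\<close>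

lemma sy_component:
  assumes "wbound S \<rho> 0 d (\<lambda>_ x. x $ j)" "d \<le> 1"
  shows "symb n 0 d (\<lambda>_ x. x $ j)"
proof (cases n)
  case 0
  thus ?thesis using assms by simp
next
  case (Suc m)
  have "symb m 0 (d - 1) (\<lambda>k. partial_D i (\<lambda>x. x $ j))" for i
    using sy_const[of "d - 1" m "if i = j then 1 else 0"] assms(2)
    by (auto intro: sy_cong[THEN iffD1, rotated])
  moreover have "(\<lambda>x. x $ j) differentiable at x" for x :: "real^3"
    using bounded_linear_imp_differentiable bounded_linear_vec_nth by blast
  ultimately show ?thesis using assms Suc by simp
qed

text \<open>Each derivative lowers the power of the positive part by one. With \<open>n < m\<close>
  a positive power remains after \<open>n\<close> steps, so the kink at 0 is never seen.\<close>

lemma sy_max_power: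
  assumes "symb n 0 0 g" "n < m"
  shows "symb n 0 0 (\<lambda>k x. max 0 (g k x) ^ m)"
  using assms
proof (induction n arbitrary: m)
  case 0
  obtain C where C: "C > 0" "\<And>k x. 0 < k \<Longrightarrow> k \<le> 1 \<Longrightarrow> x \<in> S \<Longrightarrow> \<bar>g k x\<bar> \<le> C * k ^ 0 * \<rho> x powr 0"
    using wboundE[OF 0(1)[simplified]] by blast
  have "max 0 (g k x) ^ m \<le> C ^ m" if "0 < k" "k \<le> 1" "x \<in> S" for k x
    using C(2)[OF that] weight_powr_0[OF that(3)] C(1) by (intro power_mono) auto
  hence "wbound S \<rho> 0 0 (\<lambda>k x. max 0 (g k x) ^ m)"
    by (intro wboundI[where C = "C ^ m"]) (simp add: weight_nz)
  thus ?case by simp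
next
  case (Suc n)
  have "m = Suc (Suc (m - 2))" using Suc.prems(2) by simp
  then obtain p where p: "m = Suc (Suc p)" by blast
  have dpos: "((\<lambda>s. max 0 s ^ m) has_real_derivative (real m * max 0 t ^ (m - 1))) (at t)" for t :: real
  proof (cases t "0::real" rule: linorder_cases)
    case greater
    have "((\<lambda>s. s ^ m) has_real_derivative (real m * t ^ (m - 1))) (at t)"
      by (auto intro!: derivative_eq_intros)
    hence "((\<lambda>s. max 0 s ^ m) has_real_derivative (real m * t ^ (m - 1))) (at t)"
      by (rule has_field_derivative_transform_within_open[where S = "{0<..}"]) (use greater in auto)
    thus ?thesis using greater by simp
  next
    case less
    have "((\<lambda>s. 0) has_real_derivative 0) (at t)" by simp
    hence "((\<lambda>s. max 0 s ^ m) has_real_derivative 0) (at t)"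
      by (rule has_field_derivative_transform_within_open[where S = "{..<0}"]) (use less p in auto)
    thus ?thesis using less p by simp
  next
    case equal
    have "((\<lambda>h. (max 0 (t + h) ^ m - max 0 t ^ m) / h) \<longlongrightarrow> 0) (at 0)"
    proof (rule Lim_null_comparison[where g = "\<lambda>h. \<bar>h\<bar> ^ Suc p"])
      have "norm ((max 0 (t + h) ^ m - max 0 t ^ m) / h) \<le> \<bar>h\<bar> ^ Suc p" if "h \<noteq> 0" for h
        using that equal p by (cases "h > 0") (auto simp: abs_mult max_def intro!: mult_nonpos_nonneg)
      thus "\<forall>\<^sub>F h in at 0. norm ((max 0 (t + h) ^ m - max 0 t ^ m) / h) \<le> \<bar>h\<bar> ^ Suc p"
        by (simp add: eventually_at_filter)
      show "((\<lambda>h. \<bar>h\<bar> ^ Suc p) \<longlongrightarrow> (0::real)) (at 0)"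
        by (rule tendsto_eq_intros | simp)+
    qed
    hence "((\<lambda>s. max 0 s ^ m) has_real_derivative 0) (at t)"
      by (simp only: DERIV_def)
    thus ?thesis using equal p by simp
  qed
  have "symb n 0 (- 1) (\<lambda>k. partial_D i (\<lambda>x. max 0 (g k x) ^ m))" for i
  proof -
    have "symb n 0 0 (\<lambda>k x. max 0 (g k x) ^ (m - 1))"
      by (rule Suc.IH[OF sy_SucD[OF Suc.prems(1)]]) (use Suc.prems in simp)
    moreover have "symb n 0 (-1) (\<lambda>k. partial_D i (g k))"
      using sy_partial[OF Suc.prems(1)] by simp
    ultimately have "symb n 0 (-1) (\<lambda>k x. real m * (max 0 (g k x) ^ (m - 1) * partial_D i (g k) x))"
      using sy_cmult[OF sy_mult, of n 0 0 _ 0 "-1"] by simp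
    thus ?thesis
      by (rule sy_cong[THEN iffD1, rotated])
        (simp add: partial_D_chain(1)[OF dpos sy_differentiable[OF Suc.prems(1)]])
  qed
  moreover have "(\<lambda>x. max 0 (g k x) ^ m) differentiable at x" if "0 < k" "k \<le> 1" "x \<in> S" for k x
    by (rule partial_D_chain(2)[OF dpos sy_differentiable[OF Suc.prems(1) that]])
  moreover have "wbound S \<rho> 0 0 (\<lambda>k x. max 0 (g k x) ^ m)"
    using sy_wbound[OF Suc.IH[OF sy_SucD[OF Suc.prems(1)] Suc_lessD[OF Suc.prems(2)]]] .
  ultimately show ?case by auto
qed

text \<open>The derivative of 1/g is -g'/g^2, of weight -d - d + (d - 1) = -d - 1, so the induction
  hypothesis, used twice, closes the step.\<close>

lemma sy_inverse:
  assumes "symb n 0 d g" "c > 0" "\<And>k x. 0 < k \<Longrightarrow> k \<le> 1 \<Longrightarrow> x \<in> S \<Longrightarrow> c * \<rho> x powr d \<le> \<bar>g k x\<bar>"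
  shows "symb n 0 (- d) (\<lambda>k x. inverse (g k x))"
  using assms(1)
proof (induction n)
  case 0
  have "wbound S \<rho> 0 (-d) (\<lambda>k x. inverse (g k x))"
  proof (rule wboundI[where C = "inverse c"])
    fix k :: real and x assume k: "0 < k" "k \<le> 1" "x \<in> S"
    have "inverse \<bar>g k x\<bar> \<le> inverse (c * \<rho> x powr d)"
      using assms(3)[OF k] assms(2) weight_nz[OF k(3)] by (intro le_imp_inverse_le) auto
    hence "\<bar>inverse (g k x)\<bar> \<le> inverse (c * \<rho> x powr d)" by simp
    thus "\<bar>inverse (g k x)\<bar> \<le> inverse c * k ^ 0 * \<rho> x powr - d"
      by (simp add: powr_minus inverse_eq_divide divide_simps mult_ac)
  qed
  thus ?case by simp
next
  case (Suc n)
  have nz: "g k x \<noteq> 0" if "0 < k" "k \<le> 1" "x \<in> S" for k x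
    using assms(3)[OF that] assms(2) weight_pos[OF that(3)]
    by (metis abs_zero mult_pos_pos not_le powr_gt_zero less_irrefl)
  have dinv: "(inverse has_real_derivative (- (inverse (g k x) * inverse (g k x)))) (at (g k x))"
    if "0 < k" "k \<le> 1" "x \<in> S" for k x
    using DERIV_inverse[OF nz[OF that]] by (simp add: power2_eq_square)
  have IH: "symb n 0 (-d) (\<lambda>k x. inverse (g k x))" by (rule Suc.IH[OF sy_SucD[OF Suc.prems]])
  have "symb n 0 (- d - 1) (\<lambda>k. partial_D i (\<lambda>x. inverse (g k x)))" for i
  proof -
    have "symb n 0 (d - 1) (\<lambda>k. partial_D i (g k))" using Suc.prems by simp
    from sy_uminus[OF sy_mult[OF sy_mult[OF IH IH] this]]
    have "symb n 0 (- d - 1) (\<lambda>k x. - (inverse (g k x) * inverse (g k x) * partial_D i (g k) x))"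
      by (rule sy_mono) auto
    thus ?thesis
      by (rule sy_cong[THEN iffD1, rotated]) (simp add: partial_D_chain(1)[OF dinv sy_differentiable[OF Suc.prems]])
  qed
  moreover have "(\<lambda>x. inverse (g k x)) differentiable at x" if "0 < k" "k \<le> 1" "x \<in> S" for k x
    by (rule partial_D_chain(2)[OF dinv[OF that] sy_differentiable[OF Suc.prems that]])
  ultimately show ?case using IH sy_wbound by auto
qed

text \<open>A symbol of weight 0 may have a j-th derivative as large as the weight to the power -j.
  The weight is bounded above, so bounded derivatives satisfy this for every weight.\<close>

lemma bounded_sy:
  assumes "sy n S (\<lambda>_. 1) e 0 g"
  shows "symb n e 0 g"
proof -
  have w: "wbound S \<rho> e d g" if "wbound S (\<lambda>_. 1) e d' g" "d \<le> 0" for d d' g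
  proof -
    have "wbound S \<rho> e 0 g" using that(1) by (auto simp: wbound_def weight_nz)
    thus ?thesis using wbound_mono that(2) by blast
  qed
  have "symb n e d g" if "sy n S (\<lambda>_. 1) e d' g" "d \<le> 0" for d d'
    using that
  proof (induction n arbitrary: d d' g)
    case 0
    thus ?case using w by auto
  next
    case (Suc n)
    have "symb n e (d - 1) (\<lambda>k. partial_D i (g k))" for i
      by (rule Suc.IH[where d' = "d' - 1"]) (use Suc.prems in auto)
    thus ?case using w Suc.prems by auto
  qed
  thus ?thesis using assms by blast
qed

text \<open>Conversely, \<open>d \<ge> n\<close> powers of the weight pay for \<open>n\<close>
  derivatives.\<close>

lemma sy_bounded:
  assumes "symb n e d g" "real n \<le> d"
  shows "sy n S (\<lambda>_. 1) e d' g"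
proof -
  have w: "wbound S (\<lambda>_. 1) e d' g" if "wbound S \<rho> e d g" "0 \<le> d" for d d' g
  proof -
    have "wbound S \<rho> e 0 g" using that wbound_mono by blast
    thus ?thesis by (auto simp: wbound_def weight_nz)
  qed
  show ?thesis using assms
  proof (induction n arbitrary: d d' g)
    case 0
    thus ?case using w by auto
  next
    case (Suc n)
    have "sy n S (\<lambda>_. 1) e (d' - 1) (\<lambda>k. partial_D i (g k))" for i
      by (rule Suc.IH[where d = "d - 1"]) (use Suc.prems in auto)
    thus ?case using w Suc.prems by auto
  qed
qed

end

section \<open>Homogeneous functions in a wedge\<close>

text \<open>The interval contains all wedge angles, which lie in \<open>[0, pi/2]\<close>, in its interior, so the one-sided
  derivatives at its end points never matter.\<close>

primrec cn :: "nat \<Rightarrow> (real \<Rightarrow> real) \<Rightarrow> bool" where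
  "cn 0 h \<longleftrightarrow> continuous_on {-1..2} h"
| "cn (Suc n) h \<longleftrightarrow> (\<exists>h'. (\<forall>x\<in>{-1..2}. (h has_real_derivative h' x) (at x within {-1..2})) \<and> cn n h')"

lemma cn_continuous: "cn n h \<Longrightarrow> continuous_on {-1..2} h"
proof (cases n)
  case (Suc m)
  assume "cn n h"
  then obtain h' where "\<And>x. x \<in> {-1..2} \<Longrightarrow> (h has_real_derivative h' x) (at x within {-1..2})"
    unfolding Suc cn.simps by blast
  thus ?thesis by (rule DERIV_continuous_on)
qed simp

lemma cn_SucI:
  "(\<And>x. x \<in> {-1..2} \<Longrightarrow> (h has_real_derivative h' x) (at x within {-1..2})) \<Longrightarrow> cn n h' \<Longrightarrow> cn (Suc n) h"
  unfolding cn.simps by blast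

lemma cn_SucD: "cn (Suc n) h \<Longrightarrow> cn n h"
proof (induction n arbitrary: h)
  case 0
  thus ?case using cn_continuous by (metis cn.simps(1))
next
  case (Suc n)
  then obtain h' where "\<forall>x\<in>{-1..2}. (h has_real_derivative h' x) (at x within {-1..2})" "cn (Suc n) h'"
    by (metis cn.simps(2))
  thus ?case using Suc.IH by auto
qed

lemma cn_add: "cn n f \<Longrightarrow> cn n g \<Longrightarrow> cn n (\<lambda>x. f x + g x)"
proof (induction n arbitrary: f g)
  case 0
  thus ?case by (auto intro: continuous_on_add)
next
  case (Suc n)
  obtain f' where f: "\<forall>x\<in>{-1..2}. (f has_real_derivative f' x) (at x within {-1..2})" "cn n f'"
    using Suc.prems(1) by auto
  obtain g' where g: "\<forall>x\<in>{-1..2}. (g has_real_derivative g' x) (at x within {-1..2})" "cn n g'"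
    using Suc.prems(2) by auto
  show ?case
    by (rule cn_SucI[where h' = "\<lambda>x. f' x + g' x"], rule DERIV_add) (use f g in \<open>auto intro: Suc.IH\<close>)
qed

lemma cn_mult: "cn n f \<Longrightarrow> cn n g \<Longrightarrow> cn n (\<lambda>x. f x * g x)"
proof (induction n arbitrary: f g)
  case 0
  thus ?case by (auto intro: continuous_on_mult)
next
  case (Suc n)
  obtain f' where f: "\<forall>x\<in>{-1..2}. (f has_real_derivative f' x) (at x within {-1..2})" "cn n f'"
    using Suc.prems(1) by auto
  obtain g' where g: "\<forall>x\<in>{-1..2}. (g has_real_derivative g' x) (at x within {-1..2})" "cn n g'"
    using Suc.prems(2) by auto
  have "cn n (\<lambda>x. f' x * g x + g' x * f x)"
    by (intro cn_add Suc.IH f(2) g(2) cn_SucD[OF Suc.prems(1)] cn_SucD[OF Suc.prems(2)])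
  thus ?case
    by (rule cn_SucI[OF DERIV_mult, rotated 2]) (use f(1) g(1) in auto)
qed

lemma cn_const: "cn n (\<lambda>_. a)"
proof (induction n arbitrary: a)
  case (Suc n)
  show ?case by (rule cn_SucI[where h' = "\<lambda>_. 0"]) (use Suc in auto)
qed auto

lemma cn_sin_cos: "cn n (\<lambda>x. sin (a * x)) \<and> cn n (\<lambda>x. cos (a * x))"
proof (induction n)
  case 0
  show ?case by (auto intro!: continuous_intros)
next
  case (Suc n)
  have 1: "cn n (\<lambda>x. a * cos (a * x))" "cn n (\<lambda>x. (- a) * sin (a * x))"
    using cn_mult[OF cn_const] Suc by blast+
  show ?case
    by (intro conjI cn_SucI[OF _ 1(1)] cn_SucI[OF _ 1(2)]) (auto intro!: derivative_eq_intros)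
qed

lemma cn_sin: "cn n (\<lambda>x. sin (a * x))" and cn_cos: "cn n (\<lambda>x. cos (a * x))"
  using cn_sin_cos by auto

lemma cn_uminus: "cn n f \<Longrightarrow> cn n (\<lambda>x. - f x)"
  using cn_mult[OF cn_const[of n "-1"]] by simp

lemma cn_diff: "cn n f \<Longrightarrow> cn n g \<Longrightarrow> cn n (\<lambda>x. f x - g x)"
  using cn_add[of n f "\<lambda>x. - g x"] cn_uminus by simp

lemma cn_sum: "(\<And>i. i \<in> I \<Longrightarrow> cn n (f i)) \<Longrightarrow> cn n (\<lambda>x. \<Sum>i\<in>I. f i x)"
  by (induction I rule: infinite_finite_induct) (auto intro!: cn_add cn_const)

lemma cn_power: "cn n f \<Longrightarrow> cn n (\<lambda>x. f x ^ j)"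
  by (induction j) (auto intro!: cn_mult cn_const)

lemmas cn_sin1 = cn_sin[of _ 1, simplified] and cn_cos1 = cn_cos[of _ 1, simplified]

lemmas cn_intros = cn_add cn_mult cn_const cn_sin cn_cos cn_sin1 cn_cos1 cn_uminus cn_diff cn_sum cn_power

text \<open>Coordinates in which \<open>x1\<^sup>2 + x2\<^sup>2 + 2 cos \<theta> x1 x2\<close> becomes the square of the radius; the
  quadrant becomes a wedge of angle \<open>\<theta>\<close>.\<close>

definition PX :: "real \<Rightarrow> real^3 \<Rightarrow> real" where "PX \<theta> x = x $ 1 + cos \<theta> * x $ 2"
definition PY :: "real \<Rightarrow> real^3 \<Rightarrow> real" where "PY \<theta> x = sin \<theta> * x $ 2"
definition rad :: "real \<Rightarrow> real^3 \<Rightarrow> real" where "rad \<theta> x = sqrt ((PX \<theta> x)\<^sup>2 + (PY \<theta> x)\<^sup>2)"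
definition ang :: "real \<Rightarrow> real^3 \<Rightarrow> real" where "ang \<theta> x = arctan (PY \<theta> x / PX \<theta> x)"
definition pol :: "real \<Rightarrow> real \<Rightarrow> (real \<Rightarrow> real) \<Rightarrow> real^3 \<Rightarrow> real" where
  "pol \<theta> d h x = rad \<theta> x powr d * h (ang \<theta> x)"

lemma PX_derivative: "(PX \<theta> has_derivative PX \<theta>) (at x)"
  unfolding PX_def[abs_def]
  by (intro bounded_linear_imp_has_derivative bounded_linear_add bounded_linear_const_mult bounded_linear_vec_nth)

lemma PY_derivative: "(PY \<theta> has_derivative PY \<theta>) (at x)"
  unfolding PY_def[abs_def]
  by (intro bounded_linear_imp_has_derivative bounded_linear_add bounded_linear_const_mult bounded_linear_vec_nth)

lemma rad_pos: "PX \<theta> x > 0 \<Longrightarrow> rad \<theta> x > 0"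
  by (simp add: rad_def add_pos_nonneg)

lemma polar_coords:
  assumes "PX \<theta> x > 0"
  shows "PX \<theta> x = rad \<theta> x * cos (ang \<theta> x)" "PY \<theta> x = rad \<theta> x * sin (ang \<theta> x)"
proof -
  let ?X = "PX \<theta> x" and ?Y = "PY \<theta> x"
  have "1 + (?Y / ?X)\<^sup>2 = (rad \<theta> x / ?X)\<^sup>2"
    using assms by (simp add: rad_def power_divide field_simps)
  hence s: "sqrt (1 + (?Y / ?X)\<^sup>2) = rad \<theta> x / ?X"
    using assms rad_pos[OF assms] by (simp add: real_sqrt_unique)
  show "?X = rad \<theta> x * cos (ang \<theta> x)" "?Y = rad \<theta> x * sin (ang \<theta> x)"
    using assms rad_pos[OF assms] by (auto simp: ang_def cos_arctan sin_arctan s)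
qed

lemma rad_derivative:
  assumes "PX \<theta> x > 0"
  shows "(rad \<theta> has_derivative (\<lambda>v. cos (ang \<theta> x) * PX \<theta> v + sin (ang \<theta> x) * PY \<theta> v)) (at x)"
proof -
  let ?X = "PX \<theta> x" and ?Y = "PY \<theta> x"
  have 1: "((\<lambda>x. (PX \<theta> x)\<^sup>2 + (PY \<theta> x)\<^sup>2) has_derivative (\<lambda>v. 2 * (?X * PX \<theta> v + ?Y * PY \<theta> v))) (at x)"
    by (rule derivative_eq_intros PX_derivative PY_derivative refl | simp add: algebra_simps)+
  have 2: "(sqrt has_real_derivative inverse (rad \<theta> x) / 2) (at (?X\<^sup>2 + ?Y\<^sup>2))"
    unfolding rad_def by (rule DERIV_real_sqrt) (use assms in \<open>simp add: add_pos_nonneg\<close>)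
  have "((\<lambda>x. sqrt ((PX \<theta> x)\<^sup>2 + (PY \<theta> x)\<^sup>2)) has_derivative
      (\<lambda>v. inverse (rad \<theta> x) / 2 * (2 * (?X * PX \<theta> v + ?Y * PY \<theta> v)))) (at x)"
    using has_derivative_compose[OF 1 2[unfolded has_field_derivative_def]] by simp
  moreover have "inverse (rad \<theta> x) / 2 * (2 * (?X * PX \<theta> v + ?Y * PY \<theta> v)) =
      cos (ang \<theta> x) * PX \<theta> v + sin (ang \<theta> x) * PY \<theta> v" for v
    using rad_pos[OF assms] by (simp add: polar_coords[OF assms] field_simps)
  ultimately have "((\<lambda>x. sqrt ((PX \<theta> x)\<^sup>2 + (PY \<theta> x)\<^sup>2)) has_derivative
      (\<lambda>v. cos (ang \<theta> x) * PX \<theta> v + sin (ang \<theta> x) * PY \<theta> v)) (at x)" by (simp only:)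
  thus ?thesis by (simp only: rad_def[abs_def])
qed

lemma ang_derivative:
  assumes "PX \<theta> x > 0"
  shows "(ang \<theta> has_derivative (\<lambda>v. (cos (ang \<theta> x) * PY \<theta> v - sin (ang \<theta> x) * PX \<theta> v) / rad \<theta> x)) (at x)"
proof -
  let ?X = "PX \<theta> x" and ?Y = "PY \<theta> x"
  have 1: "((\<lambda>x. PY \<theta> x / PX \<theta> x) has_derivative (\<lambda>v. (PY \<theta> v * ?X - ?Y * PX \<theta> v) / (?X * ?X))) (at x)"
    by (rule has_derivative_divide'[OF PY_derivative PX_derivative]) (use assms in simp)
  have 2: "(arctan has_real_derivative inverse (1 + (?Y / ?X)\<^sup>2)) (at (?Y / ?X))"
    by (rule DERIV_arctan)
  have "((\<lambda>x. arctan (PY \<theta> x / PX \<theta> x)) has_derivative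
      (\<lambda>v. inverse (1 + (?Y / ?X)\<^sup>2) * ((PY \<theta> v * ?X - ?Y * PX \<theta> v) / (?X * ?X)))) (at x)"
    using has_derivative_compose[OF 1 2[unfolded has_field_derivative_def]] by simp
  moreover have "inverse (1 + (?Y / ?X)\<^sup>2) * ((PY \<theta> v * ?X - ?Y * PX \<theta> v) / (?X * ?X)) =
      (cos (ang \<theta> x) * PY \<theta> v - sin (ang \<theta> x) * PX \<theta> v) / rad \<theta> x" for v
  proof -
    have "inverse (1 + (?Y / ?X)\<^sup>2) / (?X * ?X) = 1 / (?X\<^sup>2 + ?Y\<^sup>2)"
    proof -
      have "inverse (1 + (?Y / ?X)\<^sup>2) / (?X * ?X) = 1 / ((1 + (?Y / ?X)\<^sup>2) * ?X\<^sup>2)"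
        by (simp add: inverse_eq_divide power2_eq_square)
      also have "(1 + (?Y / ?X)\<^sup>2) * ?X\<^sup>2 = ?X\<^sup>2 + ?Y\<^sup>2"
        using assms by (simp add: distrib_right power_divide)
      finally show ?thesis .
    qed
    also have "?X\<^sup>2 + ?Y\<^sup>2 = (rad \<theta> x)\<^sup>2" by (simp add: rad_def)
    finally have "inverse (1 + (?Y / ?X)\<^sup>2) * ((PY \<theta> v * ?X - ?Y * PX \<theta> v) / (?X * ?X)) =
      (PY \<theta> v * ?X - ?Y * PX \<theta> v) / (rad \<theta> x)\<^sup>2" by (metis (no_types, lifting) mult.commute times_divide_eq_left times_divide_eq_right mult.left_neutral)
    also have "\<dots> = (cos (ang \<theta> x) * PY \<theta> v - sin (ang \<theta> x) * PX \<theta> v) / rad \<theta> x"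
      using rad_pos[OF assms] by (subst polar_coords(1)[OF assms], subst polar_coords(2)[OF assms])
        (simp add: field_simps power2_eq_square)
    finally show ?thesis .
  qed
  ultimately show ?thesis by (simp add: ang_def[abs_def])
qed

lemma pol_derivative:
  assumes "PX \<theta> x > 0" and h: "(h has_real_derivative h') (at (ang \<theta> x))"
  shows "(pol \<theta> d h has_derivative (\<lambda>v. rad \<theta> x powr (d - 1) *
      ((d * cos (ang \<theta> x) * h (ang \<theta> x) - sin (ang \<theta> x) * h') * PX \<theta> v +
       (d * sin (ang \<theta> x) * h (ang \<theta> x) + cos (ang \<theta> x) * h') * PY \<theta> v))) (at x)"
proof -
  let ?r = "rad \<theta> x" and ?a = "ang \<theta> x"
  have 1: "((\<lambda>x. rad \<theta> x powr d) has_derivative (\<lambda>v. (d * ?r powr (d - 1)) * (cos ?a * PX \<theta> v + sin ?a * PY \<theta> v))) (at x)"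
    using has_derivative_compose[OF rad_derivative[OF assms(1)]
        has_real_derivative_powr[OF rad_pos[OF assms(1)], unfolded has_field_derivative_def]] by simp
  have 2: "((\<lambda>x. h (ang \<theta> x)) has_derivative (\<lambda>v. h' * ((cos ?a * PY \<theta> v - sin ?a * PX \<theta> v) / ?r))) (at x)"
    using has_derivative_compose[OF ang_derivative[OF assms(1)] h[unfolded has_field_derivative_def]] by simp
  have "?r powr d = ?r powr (d - 1) * ?r"
    using rad_pos[OF assms(1)] by (simp add: powr_diff)
  hence e: "?r powr d / ?r = ?r powr (d - 1)" using rad_pos[OF assms(1)] by simp
  have "?r powr d * (h' * ((cos ?a * PY \<theta> v - sin ?a * PX \<theta> v) / ?r)) +
      (d * ?r powr (d - 1)) * (cos ?a * PX \<theta> v + sin ?a * PY \<theta> v) * h ?a =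
      ?r powr (d - 1) * ((d * cos ?a * h ?a - sin ?a * h') * PX \<theta> v + (d * sin ?a * h ?a + cos ?a * h') * PY \<theta> v)" for v
  proof -
    have "?r powr d * (h' * ((cos ?a * PY \<theta> v - sin ?a * PX \<theta> v) / ?r)) =
       (?r powr d / ?r) * (h' * (cos ?a * PY \<theta> v - sin ?a * PX \<theta> v))" by simp
    thus ?thesis unfolding e by (simp add: algebra_simps)
  qed
  thus ?thesis using has_derivative_mult[OF 1 2] by (simp add: pol_def[abs_def])
qed

text \<open>Angular profiles of the derivatives of a homogeneous function along the two orthonormal
  wedge coordinates. The degree drops by one, so homogeneous functions are closed under
  differentiation.\<close>

definition polX :: "real \<Rightarrow> (real \<Rightarrow> real) \<Rightarrow> (real \<Rightarrow> real) \<Rightarrow> real \<Rightarrow> real" where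
  "polX d h h' = (\<lambda>a. d * cos a * h a - sin a * h' a)"
definition polY :: "real \<Rightarrow> (real \<Rightarrow> real) \<Rightarrow> (real \<Rightarrow> real) \<Rightarrow> real \<Rightarrow> real" where
  "polY d h h' = (\<lambda>a. d * sin a * h a + cos a * h' a)"

lemma pol_partial:
  assumes "PX \<theta> x > 0" and h: "(h has_real_derivative h' (ang \<theta> x)) (at (ang \<theta> x))"
  shows "partial_D 1 (pol \<theta> d h) x = pol \<theta> (d - 1) (polX d h h') x"
    and "partial_D 2 (pol \<theta> d h) x = cos \<theta> * pol \<theta> (d - 1) (polX d h h') x + sin \<theta> * pol \<theta> (d - 1) (polY d h h') x"
    and "partial_D 3 (pol \<theta> d h) x = 0"
    and "pol \<theta> d h differentiable at x"
proof -
  note D = pol_derivative[OF assms, of d] and P = partial_D_eq[OF pol_derivative[OF assms]]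
  show "partial_D 1 (pol \<theta> d h) x = pol \<theta> (d - 1) (polX d h h') x"
    by (simp add: P PX_def PY_def axis_def pol_def polX_def)
  show "partial_D 2 (pol \<theta> d h) x = cos \<theta> * pol \<theta> (d - 1) (polX d h h') x + sin \<theta> * pol \<theta> (d - 1) (polY d h h') x"
    by (simp add: P PX_def PY_def axis_def pol_def polX_def polY_def algebra_simps)
  show "partial_D 3 (pol \<theta> d h) x = 0"
    by (simp add: P PX_def PY_def axis_def)
  show "pol \<theta> d h differentiable at x" using D by (auto simp: differentiable_def)
qed

locale wedge =
  fixes \<theta> :: real
  assumes theta: "0 < \<theta>" "\<theta> < pi / 2"
begin

lemma cos_sin_pos: "0 < cos \<theta>" "0 < sin \<theta>"
  using theta by (auto intro!: cos_gt_zero_pi sin_gt_zero)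

lemma PX_pos: "x $ 1 \<ge> 0 \<Longrightarrow> x $ 2 \<ge> 0 \<Longrightarrow> 0 < x $ 1 + x $ 2 \<Longrightarrow> PX \<theta> x > 0"
  using cos_sin_pos by (cases "x $ 2 = 0") (auto simp: PX_def add_nonneg_pos)

lemma ang_bounds:
  assumes "x $ 1 \<ge> 0" "x $ 2 \<ge> 0" "0 < x $ 1 + x $ 2"
  shows "0 \<le> ang \<theta> x" "ang \<theta> x \<le> \<theta>"
proof -
  have X: "PX \<theta> x > 0" using PX_pos assms by blast
  have Y: "PY \<theta> x \<ge> 0" using cos_sin_pos assms by (simp add: PY_def)
  show "0 \<le> ang \<theta> x" using X Y by (simp add: ang_def zero_le_arctan_iff)
  have "PY \<theta> x / PX \<theta> x \<le> tan \<theta>"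
    using X cos_sin_pos assms by (simp add: tan_def field_simps PX_def PY_def)
  hence "ang \<theta> x \<le> arctan (tan \<theta>)" by (simp add: ang_def arctan_le_iff)
  thus "ang \<theta> x \<le> \<theta>" using theta by (simp add: arctan_tan)
qed

lemma ang_range: "x $ 1 \<ge> 0 \<Longrightarrow> x $ 2 \<ge> 0 \<Longrightarrow> 0 < x $ 1 + x $ 2 \<Longrightarrow> ang \<theta> x \<in> {-1<..<2}"
  using ang_bounds[of x] theta pi_less_4 by auto

text \<open>The squared radius is x1^2 + 2 cos(theta) x1 x2 + x2^2 with cos(theta) in (0, 1). This
  lets the weight x1 + x2, which does not depend on the angle, replace the radius in all
  estimates.\<close>

lemma rad_bounds:
  assumes "x $ 1 \<ge> 0" "x $ 2 \<ge> 0"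
  shows "rad \<theta> x \<le> x $ 1 + x $ 2" "(x $ 1 + x $ 2) / 2 \<le> rad \<theta> x"
proof -
  have e: "(PX \<theta> x)\<^sup>2 + (PY \<theta> x)\<^sup>2 = (x $ 1)\<^sup>2 + 2 * cos \<theta> * x $ 1 * x $ 2 + (x $ 2)\<^sup>2"
  proof -
    have "(PX \<theta> x)\<^sup>2 + (PY \<theta> x)\<^sup>2 = (x $ 1)\<^sup>2 + 2 * cos \<theta> * x $ 1 * x $ 2 + ((cos \<theta>)\<^sup>2 + (sin \<theta>)\<^sup>2) * (x $ 2)\<^sup>2"
      unfolding PX_def PY_def by algebra
    thus ?thesis by simp
  qed
  have p: "0 \<le> x $ 1 * x $ 2" using assms by simp
  have c: "cos \<theta> * (x $ 1 * x $ 2) \<le> x $ 1 * x $ 2"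
    using mult_right_mono[OF cos_le_one[of \<theta>] p] by simp
  have c0: "0 \<le> cos \<theta> * (x $ 1 * x $ 2)" using p cos_sin_pos by simp
  have "(PX \<theta> x)\<^sup>2 + (PY \<theta> x)\<^sup>2 \<le> (x $ 1 + x $ 2)\<^sup>2"
    unfolding e using c by (simp add: power2_eq_square algebra_simps)
  thus "rad \<theta> x \<le> x $ 1 + x $ 2" unfolding rad_def using assms
    by (intro real_le_lsqrt) auto
  have "((x $ 1 + x $ 2) / 2)\<^sup>2 \<le> (PX \<theta> x)\<^sup>2 + (PY \<theta> x)\<^sup>2"
  proof -
    have "0 \<le> (x $ 1 - x $ 2)\<^sup>2" by simp
    hence 1: "2 * (x $ 1 * x $ 2) \<le> (x $ 1)\<^sup>2 + (x $ 2)\<^sup>2" by (simp add: power2_diff mult_ac)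
    have 2: "((x $ 1 + x $ 2) / 2)\<^sup>2 = ((x $ 1)\<^sup>2 + (x $ 2)\<^sup>2 + 2 * (x $ 1 * x $ 2)) / 4"
      by (simp add: power_divide power2_sum mult_ac)
    have 3: "2 * cos \<theta> * x $ 1 * x $ 2 = 2 * (cos \<theta> * (x $ 1 * x $ 2))" by simp
    show ?thesis unfolding e 2 3 using 1 c0 p by simp
  qed
  thus "(x $ 1 + x $ 2) / 2 \<le> rad \<theta> x" unfolding rad_def by (rule real_le_rsqrt)
qed

lemma rad_powr_bound:
  "\<exists>C>0. \<forall>x. x $ 1 \<ge> 0 \<longrightarrow> x $ 2 \<ge> 0 \<longrightarrow> 0 < x $ 1 + x $ 2 \<longrightarrow> rad \<theta> x powr d \<le> C * (x $ 1 + x $ 2) powr d"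
proof (cases "d \<ge> 0")
  case True
  have "rad \<theta> x powr d \<le> 1 * (x $ 1 + x $ 2) powr d" if "x $ 1 \<ge> 0" "x $ 2 \<ge> 0" "0 < x $ 1 + x $ 2" for x
    using rad_bounds[OF that(1,2)] rad_pos[OF PX_pos[OF that]] True by (auto intro: powr_mono2)
  thus ?thesis by (metis zero_less_one)
next
  case False
  have "rad \<theta> x powr d \<le> (1/2) powr d * (x $ 1 + x $ 2) powr d"
    if "x $ 1 \<ge> 0" "x $ 2 \<ge> 0" "0 < x $ 1 + x $ 2" for x
  proof -
    have "rad \<theta> x powr d \<le> ((x $ 1 + x $ 2) / 2) powr d"
      using rad_bounds[OF that(1,2)] that False by (intro powr_mono2') auto
    also have "\<dots> = (1/2 * (x $ 1 + x $ 2)) powr d" by simp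
    also have "\<dots> = (1/2) powr d * (x $ 1 + x $ 2) powr d"
      using that by (subst powr_mult) auto
    finally show ?thesis .
  qed
  thus ?thesis by (intro exI[of _ "(1/2) powr d"]) auto
qed

lemma cn_bounded: "cn n h \<Longrightarrow> \<exists>B>0. \<forall>a\<in>{-1..2}. \<bar>h a\<bar> \<le> B"
proof -
  assume "cn n h"
  hence "compact (h ` {-1..2})" using cn_continuous compact_continuous_image compact_Icc by blast
  then obtain B where "\<forall>y\<in>h ` {-1..2}. norm y \<le> B" using compact_imp_bounded bounded_iff by blast
  thus ?thesis by (intro exI[of _ "\<bar>B\<bar> + 1"]) force
qed

lemma pol_bound:
  assumes "cn n h"
  shows "\<exists>C>0. \<forall>x. x $ 1 \<ge> 0 \<longrightarrow> x $ 2 \<ge> 0 \<longrightarrow> 0 < x $ 1 + x $ 2 \<longrightarrow> \<bar>pol \<theta> d h x\<bar> \<le> C * (x $ 1 + x $ 2) powr d"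
proof -
  obtain B where B: "B > 0" "\<forall>a\<in>{-1..2}. \<bar>h a\<bar> \<le> B" using cn_bounded[OF assms] by blast
  obtain C where C: "C > 0" "\<And>x. x $ 1 \<ge> 0 \<Longrightarrow> x $ 2 \<ge> 0 \<Longrightarrow> 0 < x $ 1 + x $ 2 \<Longrightarrow> rad \<theta> x powr d \<le> C * (x $ 1 + x $ 2) powr d"
    using rad_powr_bound[of d] by blast
  have "\<bar>pol \<theta> d h x\<bar> \<le> (C * B) * (x $ 1 + x $ 2) powr d"
    if "x $ 1 \<ge> 0" "x $ 2 \<ge> 0" "0 < x $ 1 + x $ 2" for x
  proof -
    have "\<bar>h (ang \<theta> x)\<bar> \<le> B" using B(2) ang_range[OF that] by auto
    hence "\<bar>pol \<theta> d h x\<bar> \<le> (C * (x $ 1 + x $ 2) powr d) * B"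
      unfolding pol_def abs_mult using C(1) C(2)[OF that] B(1) by (intro mult_mono) auto
    thus ?thesis by (simp add: mult_ac)
  qed
  thus ?thesis using B(1) C(1) by (intro exI[of _ "C * B"]) auto
qed

end

locale wedge_domain = wedge \<theta> + weighted S "\<lambda>x. x $ 1 + x $ 2" M for \<theta> S M +
  assumes quadrant: "x \<in> S \<Longrightarrow> 0 < x $ 1 \<and> 0 < x $ 2"
begin

lemma pol_sum: "\<alpha> * pol \<theta> d f x + \<beta> * pol \<theta> d g x = pol \<theta> d (\<lambda>a. \<alpha> * f a + \<beta> * g a) x"
  by (simp add: pol_def algebra_simps)

lemma pol_sy: "cn n h \<Longrightarrow> symb n 0 d (\<lambda>_. pol \<theta> d h)"
proof (induction n arbitrary: d h)
  case 0
  obtain C where "\<forall>x. x $ 1 \<ge> 0 \<longrightarrow> x $ 2 \<ge> 0 \<longrightarrow> 0 < x $ 1 + x $ 2 \<longrightarrow> \<bar>pol \<theta> d h x\<bar> \<le> C * (x $ 1 + x $ 2) powr d"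
    using pol_bound[OF 0] by blast
  thus ?case using quadrant weight_pos by (auto intro!: wboundI[where C = C] simp: less_imp_le)
next
  case (Suc n)
  obtain h' where h: "\<forall>x\<in>{-1..2}. (h has_real_derivative h' x) (at x within {-1..2})" "cn n h'"
    using Suc.prems by auto
  have h': "(h has_real_derivative h' (ang \<theta> x)) (at (ang \<theta> x))" if "x \<in> S" for x
  proof -
    have a: "ang \<theta> x \<in> {-1<..<2}" using ang_range quadrant[OF that] weight_pos[OF that] by auto
    hence "(h has_real_derivative h' (ang \<theta> x)) (at (ang \<theta> x) within {-1..2})" using h by auto
    thus ?thesis using a at_within_Icc_at[of "-1" "ang \<theta> x" 2] by simp
  qed
  have X: "PX \<theta> x > 0" if "x \<in> S" for x
    using PX_pos quadrant[OF that] weight_pos[OF that] by auto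
  note P = pol_partial[where h = h and h' = h' and \<theta> = \<theta>, OF X h']
  have cX: "cn n (polX d h h')" and cY: "cn n (polY d h h')"
    unfolding polX_def polY_def by (intro cn_intros h(2) cn_SucD[OF Suc.prems])+
  have "symb n 0 (d - 1) (\<lambda>k. partial_D i (pol \<theta> d h))" for i
  proof -
    consider "i = 1" | "i = 2" | "i = 3" using exhaust_3 by blast
    thus ?thesis
    proof cases
      case 1
      show ?thesis
        by (rule sy_cong[THEN iffD1, OF _ Suc.IH[OF cX]]) (simp add: P 1)
    next
      case 2
      have "cn n (\<lambda>a. cos \<theta> * polX d h h' a + sin \<theta> * polY d h h' a)" by (intro cn_intros cX cY)
      from Suc.IH[OF this] show ?thesis
        by (rule sy_cong[THEN iffD1, rotated]) (simp add: P 2 pol_sum)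
    next
      case 3
      show ?thesis
        by (rule sy_cong[THEN iffD1, OF _ sy_zero]) (simp add: P 3)
    qed
  qed
  moreover have "wbound S (\<lambda>x. x $ 1 + x $ 2) 0 d (\<lambda>_. pol \<theta> d h)"
  proof -
    obtain C where "\<forall>x. x $ 1 \<ge> 0 \<longrightarrow> x $ 2 \<ge> 0 \<longrightarrow> 0 < x $ 1 + x $ 2 \<longrightarrow> \<bar>pol \<theta> d h x\<bar> \<le> C * (x $ 1 + x $ 2) powr d"
      using pol_bound[OF Suc.prems] by blast
    thus ?thesis using quadrant weight_pos by (auto intro!: wboundI[where C = C] simp: less_imp_le)
  qed
  ultimately show ?case using P(4) by simp
qed

end

section \<open>Angular profiles\<close>

text \<open>Variation of constants for h'' + d^2 h = g. The condition on
  \<open>sin (d * \<theta>)\<close> is non-resonance: it lets the second end value be reached with a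
  multiple of the homogeneous solution sin(d x).\<close>

lemma dirichlet_problem:
  fixes g :: "real \<Rightarrow> real"
  assumes "continuous_on {-1..2} g" "d \<noteq> 0" "sin (d * \<theta>) \<noteq> 0"
  shows "\<exists>h h'. (\<forall>x\<in>{-1..2}. (h has_real_derivative h' x) (at x within {-1..2})) \<and>
     (\<forall>x\<in>{-1..2}. (h' has_real_derivative (g x - d\<^sup>2 * h x)) (at x within {-1..2})) \<and> h 0 = 0 \<and> h \<theta> = 0"
proof -
  have anti: "\<exists>I. \<forall>x\<in>{-1..2}. (I has_real_derivative f x) (at x within {-1..2})"
    if "continuous_on {-1..2} f" for f :: "real \<Rightarrow> real"
    using antiderivative_continuous[OF that] unfolding has_real_derivative_iff_has_vector_derivative by metis
  have "continuous_on {-1..2} (\<lambda>x. cos (d * x) * g x)" "continuous_on {-1..2} (\<lambda>x. sin (d * x) * g x)"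
    by (intro continuous_intros assms)+
  from anti[OF this(1)] anti[OF this(2)] obtain I J where
    I: "\<And>x. x \<in> {-1..2} \<Longrightarrow> (I has_real_derivative cos (d * x) * g x) (at x within {-1..2})" and
    J: "\<And>x. x \<in> {-1..2} \<Longrightarrow> (J has_real_derivative sin (d * x) * g x) (at x within {-1..2})"
    by blast
  \<comment> \<open>\<open>A\<close> normalises the solution at 0; \<open>B\<close> is then the root
    of the linear equation that the value at \<open>\<theta>\<close> imposes.\<close>
  define A where "A = J 0"
  define B where "B = (cos (d * \<theta>) * (J \<theta> - A) - sin (d * \<theta>) * I \<theta>) / sin (d * \<theta>)"
  define h where "h x = (sin (d * x) * (I x + B) - cos (d * x) * (J x - A)) / d" for x
  define h' where "h' x = cos (d * x) * (I x + B) + sin (d * x) * (J x - A)" for x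
  have "(h has_real_derivative h' x) (at x within {-1..2})" if "x \<in> {-1..2}" for x
    unfolding h_def[abs_def] h'_def
    by (rule derivative_eq_intros I J refl that | simp add: assms field_simps)+
  moreover have "(h' has_real_derivative (g x - d\<^sup>2 * h x)) (at x within {-1..2})" if "x \<in> {-1..2}" for x
  proof -
    have s: "cos (d * x) * (cos (d * x) * g x) + sin (d * x) * (sin (d * x) * g x) = g x"
      using sin_cos_squared_add[of "d * x"] by (metis (no_types, opaque_lifting) add.commute distrib_right mult.assoc mult.left_neutral power2_eq_square)
    have e: "g x - d\<^sup>2 * h x = (- sin (d * x) * d) * (I x + B) + cos (d * x) * (cos (d * x) * g x) +
        ((cos (d * x) * d) * (J x - A) + sin (d * x) * (sin (d * x) * g x))"
    proof -
      have "d\<^sup>2 * h x = d * (sin (d * x) * (I x + B) - cos (d * x) * (J x - A))"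
        using assms(2) by (simp add: h_def power2_eq_square)
      thus ?thesis using s by (simp add: algebra_simps)
    qed
    show ?thesis unfolding e h'_def[abs_def]
      by (rule derivative_eq_intros I J refl that | simp add: algebra_simps)+
  qed
  moreover have "h 0 = 0" by (simp add: h_def A_def)
  moreover have "h \<theta> = 0" using assms(3) by (simp add: h_def B_def field_simps)
  ultimately show ?thesis by blast
qed

text \<open>The profiles are chosen so that all terms of order at most \<open>N\<close> cancel in the two-dimensional
  Monge-Ampere operator of \<open>\<Sum>j. y^j r\<^sup>2 h j\<close>, written in the polar frame.\<close>

definition mixed :: "(nat \<Rightarrow> real) \<Rightarrow> (nat \<Rightarrow> real \<Rightarrow> real) \<Rightarrow> (nat \<Rightarrow> real \<Rightarrow> real) \<Rightarrow>
    (nat \<Rightarrow> real \<Rightarrow> real) \<Rightarrow> nat \<Rightarrow> real \<Rightarrow> real" where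
  "mixed d h h1 h2 j a = (\<Sum>i\<in>{1..<j}. d i * (d i - 1) * h i a * (h2 (j - i) a + d (j - i) * h (j - i) a)
      - (d i - 1) * h1 i a * ((d (j - i) - 1) * h1 (j - i) a))"

text \<open>The left side h'' + d^2 h is the trace of the polar Hessian of r^d h, that is, the
  linear part of the determinant. For \<open>j = 1\<close> there is no source and the profile is the
  resonant sine. Regularity \<open>cn 1\<close> of \<open>h2\<close> is what one derivative of the
  Hessian requires.\<close>

definition profiles :: "real \<Rightarrow> (nat \<Rightarrow> real) \<Rightarrow> nat \<Rightarrow> (nat \<Rightarrow> real \<Rightarrow> real) \<Rightarrow>
    (nat \<Rightarrow> real \<Rightarrow> real) \<Rightarrow> (nat \<Rightarrow> real \<Rightarrow> real) \<Rightarrow> bool" where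
  "profiles \<theta> d N h h1 h2 \<longleftrightarrow> (\<forall>j\<in>{1..N}.
     (\<forall>x\<in>{-1..2}. (h j has_real_derivative h1 j x) (at x within {-1..2})) \<and>
     (\<forall>x\<in>{-1..2}. (h1 j has_real_derivative h2 j x) (at x within {-1..2})) \<and> cn 1 (h2 j) \<and>
     h j 0 = 0 \<and> h j \<theta> = 0 \<and> (\<forall>x\<in>{-1..2}. h2 j x + (d j)\<^sup>2 * h j x = - mixed d h h1 h2 j x)) \<and>
     (1 \<le> N \<longrightarrow> h 1 = (\<lambda>a. sin (d 1 * a)) \<and> h1 1 = (\<lambda>a. d 1 * cos (d 1 * a)) \<and>
        h2 1 = (\<lambda>a. - (d 1)\<^sup>2 * sin (d 1 * a)))"

lemma profiles_cn:
  assumes "profiles \<theta> d N h h1 h2" "j \<in> {1..N}"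
  shows "cn 1 (h2 j)" "cn 2 (h1 j)" "cn 3 (h j)"
proof -
  show 1: "cn 1 (h2 j)" using assms by (auto simp: profiles_def)
  show 2: "cn 2 (h1 j)" unfolding numeral_2_eq_2
    by (rule cn_SucI[OF _ 1[unfolded One_nat_def]]) (use assms in \<open>auto simp: profiles_def\<close>)
  show "cn 3 (h j)" unfolding numeral_3_eq_3
    by (rule cn_SucI[OF _ 2[unfolded numeral_2_eq_2]]) (use assms in \<open>auto simp: profiles_def\<close>)
qed

text \<open>The source of order \<open>j\<close> sees only indices below \<open>j\<close>, so the
  equations can be solved one after the other.\<close>

lemma mixed_cong:
  assumes "\<And>i. i \<in> {1..<j} \<Longrightarrow> h i = g i" "\<And>i. i \<in> {1..<j} \<Longrightarrow> h1 i = g1 i" "\<And>i. i \<in> {1..<j} \<Longrightarrow> h2 i = g2 i"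
  shows "mixed d h h1 h2 j = mixed d g g1 g2 j"
proof -
  have "h i = g i \<and> h (j - i) = g (j - i) \<and> h1 i = g1 i \<and> h1 (j - i) = g1 (j - i) \<and> h2 (j - i) = g2 (j - i)"
    if "i \<in> {1..<j}" for i
    using that assms[of i] assms[of "j - i"] by auto
  thus ?thesis unfolding mixed_def by (intro ext sum.cong refl) simp
qed

lemma mixed_cn:
  assumes "profiles \<theta> d N h h1 h2" "j \<le> Suc N"
  shows "cn 1 (mixed d h h1 h2 j)"
proof -
  note c = profiles_cn[OF assms(1)]
  have "cn 1 (h i)" "cn 1 (h1 i)" "cn 1 (h2 i)" if "i \<in> {1..N}" for i
    using cn_SucD[OF cn_SucD[OF c(3)[OF that, unfolded numeral_3_eq_3]]]
      cn_SucD[OF c(2)[OF that, unfolded numeral_2_eq_2]] c(1)[OF that] unfolding One_nat_def .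
  moreover have "i \<in> {1..N}" "j - i \<in> {1..N}" if "i \<in> {1..<j}" for i
    using that assms(2) by auto
  ultimately show ?thesis unfolding mixed_def[abs_def]
    by (intro cn_intros) blast+
qed

text \<open>Resonance at index 1 supplies a nonzero solution with zero end values; non-resonance at
  all later indices makes their sources solvable.\<close>

lemma profiles_exist:
  assumes "d 1 \<noteq> 0" "sin (d 1 * \<theta>) = 0" "\<And>j. j \<in> {2..N} \<Longrightarrow> d j \<noteq> 0 \<and> sin (d j * \<theta>) \<noteq> 0"
  shows "\<exists>h h1 h2. profiles \<theta> d N h h1 h2"
  using assms(3)
proof (induction N)
  case 0
  show ?case by (simp add: profiles_def)
next
  case (Suc N)
  then obtain h h1 h2 where P: "profiles \<theta> d N h h1 h2" by fastforce
  have "\<exists>f f1 f2. (\<forall>x\<in>{-1..2}. (f has_real_derivative f1 x) (at x within {-1..2})) \<and>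
     (\<forall>x\<in>{-1..2}. (f1 has_real_derivative f2 x) (at x within {-1..2})) \<and> cn 1 f2 \<and>
     f 0 = 0 \<and> f \<theta> = 0 \<and> (\<forall>x\<in>{-1..2}. f2 x + (d (Suc N))\<^sup>2 * f x = - mixed d h h1 h2 (Suc N) x) \<and>
     (N = 0 \<longrightarrow> f = (\<lambda>a. sin (d 1 * a)) \<and> f1 = (\<lambda>a. d 1 * cos (d 1 * a)) \<and> f2 = (\<lambda>a. - (d 1)\<^sup>2 * sin (d 1 * a)))"
  proof (cases "N = 0")
    case True
    show ?thesis
      by (rule exI[of _ "\<lambda>a. sin (d 1 * a)"], rule exI[of _ "\<lambda>a. d 1 * cos (d 1 * a)"],
          rule exI[of _ "\<lambda>a. - (d 1)\<^sup>2 * sin (d 1 * a)"])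
        (use True assms in \<open>auto simp: mixed_def power2_eq_square simp del: cn.simps
            intro!: derivative_eq_intros cn_intros\<close>)
  next
    case False
    hence nz: "d (Suc N) \<noteq> 0" "sin (d (Suc N) * \<theta>) \<noteq> 0" using Suc.prems by auto
    define g where "g x = - mixed d h h1 h2 (Suc N) x" for x
    have g: "cn 1 g" unfolding g_def using mixed_cn[OF P] by (intro cn_intros) auto
    obtain f f1 where f: "\<forall>x\<in>{-1..2}. (f has_real_derivative f1 x) (at x within {-1..2})"
      "\<forall>x\<in>{-1..2}. (f1 has_real_derivative (g x - (d (Suc N))\<^sup>2 * f x)) (at x within {-1..2})" "f 0 = 0" "f \<theta> = 0"
      using dirichlet_problem[OF cn_continuous[OF g] nz] by blast
    \<comment> \<open>Bootstrap: \<open>f\<close> is continuously differentiable, hence so is its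
      second derivative, which the equation expresses through \<open>g\<close> and
      \<open>f\<close>.\<close>
    have "cn 0 f1" using f(2) by (auto intro: DERIV_continuous_on)
    hence "cn 1 f" unfolding One_nat_def by (rule cn_SucI[rotated]) (use f(1) in auto)
    hence "cn 1 (\<lambda>x. g x - (d (Suc N))\<^sup>2 * f x)" using g by (intro cn_intros)
    thus ?thesis using f False
      by (intro exI[of _ f] exI[of _ f1] exI[of _ "\<lambda>x. g x - (d (Suc N))\<^sup>2 * f x"]) (auto simp: g_def)
  qed
  then obtain f f1 f2 where f: "\<forall>x\<in>{-1..2}. (f has_real_derivative f1 x) (at x within {-1..2})"
     "\<forall>x\<in>{-1..2}. (f1 has_real_derivative f2 x) (at x within {-1..2})" "cn 1 f2"
     "f 0 = 0" "f \<theta> = 0" "\<forall>x\<in>{-1..2}. f2 x + (d (Suc N))\<^sup>2 * f x = - mixed d h h1 h2 (Suc N) x"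
     "N = 0 \<longrightarrow> f = (\<lambda>a. sin (d 1 * a)) \<and> f1 = (\<lambda>a. d 1 * cos (d 1 * a)) \<and> f2 = (\<lambda>a. - (d 1)\<^sup>2 * sin (d 1 * a))"
    by (elim exE conjE) (rule that)
  have m: "mixed d (h(Suc N := f)) (h1(Suc N := f1)) (h2(Suc N := f2)) j = mixed d h h1 h2 j" if "j \<le> Suc N" for j
    using that by (intro mixed_cong) auto
  have "profiles \<theta> d (Suc N) (h(Suc N := f)) (h1(Suc N := f1)) (h2(Suc N := f2))"
    unfolding profiles_def
  proof (intro conjI ballI)
    fix j assume j: "j \<in> {1..Suc N}"
    show "cn 1 ((h2(Suc N := f2)) j)" using P f(3) j by (cases "j = Suc N") (auto simp: profiles_def)
  next
    show "1 \<le> Suc N \<longrightarrow> (h(Suc N := f)) 1 = (\<lambda>a. sin (d 1 * a)) \<and> (h1(Suc N := f1)) 1 = (\<lambda>a. d 1 * cos (d 1 * a)) \<and>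
        (h2(Suc N := f2)) 1 = (\<lambda>a. - (d 1)\<^sup>2 * sin (d 1 * a))"
      using P f(7) by (cases "N = 0") (auto simp: profiles_def)
  next
    fix j x assume j: "j \<in> {1..Suc N}" "x \<in> {- 1..2::real}"
    show "(h2(Suc N := f2)) j x + (d j)\<^sup>2 * (h(Suc N := f)) j x =
       - mixed d (h(Suc N := f)) (h1(Suc N := f1)) (h2(Suc N := f2)) j x"
      using P f(6) j m[of j] by (cases "j = Suc N") (auto simp: profiles_def)
    show "((h(Suc N := f)) j has_real_derivative (h1(Suc N := f1)) j x) (at x within {- 1..2})"
      using P f(1) j by (cases "j = Suc N") (auto simp: profiles_def)
    show "((h1(Suc N := f1)) j has_real_derivative (h2(Suc N := f2)) j x) (at x within {- 1..2})"
      using P f(2) j by (cases "j = Suc N") (auto simp: profiles_def)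
  next
    fix j assume j: "j \<in> {1..Suc N}"
    show "(h(Suc N := f)) j 0 = 0" "(h(Suc N := f)) j \<theta> = 0"
      using P f(4,5) j by (auto simp: profiles_def)
  qed
  thus ?case by blast
qed

section \<open>The singular perturbation at an edge point\<close>

text \<open>Second derivatives in the wedge coordinates. They arise by rotating the polar Hessian,
  whose radial, angular and mixed entries are \<open>d * (d - 1) * h\<close>,
  \<open>h2 + d * h\<close> and \<open>(d - 1) * h1\<close>.\<close>

definition pXX :: "real \<Rightarrow> (real \<Rightarrow> real) \<Rightarrow> (real \<Rightarrow> real) \<Rightarrow> (real \<Rightarrow> real) \<Rightarrow> real \<Rightarrow> real" where
  "pXX d h h1 h2 = (\<lambda>a. (cos a)\<^sup>2 * (d * (d - 1) * h a) + (sin a)\<^sup>2 * (h2 a + d * h a) - 2 * sin a * cos a * ((d - 1) * h1 a))"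
definition pXY :: "real \<Rightarrow> (real \<Rightarrow> real) \<Rightarrow> (real \<Rightarrow> real) \<Rightarrow> (real \<Rightarrow> real) \<Rightarrow> real \<Rightarrow> real" where
  "pXY d h h1 h2 = (\<lambda>a. sin a * cos a * (d * (d - 1) * h a - (h2 a + d * h a)) + ((cos a)\<^sup>2 - (sin a)\<^sup>2) * ((d - 1) * h1 a))"
definition pYY :: "real \<Rightarrow> (real \<Rightarrow> real) \<Rightarrow> (real \<Rightarrow> real) \<Rightarrow> (real \<Rightarrow> real) \<Rightarrow> real \<Rightarrow> real" where
  "pYY d h h1 h2 = (\<lambda>a. (sin a)\<^sup>2 * (d * (d - 1) * h a) + (cos a)\<^sup>2 * (h2 a + d * h a) + 2 * sin a * cos a * ((d - 1) * h1 a))"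

text \<open>Conjugation by the rotation with sine \<open>s\<close> and cosine \<open>c\<close>
  preserves trace and determinant, hence also det(I + H).\<close>

lemma polar_hessian_det:
  fixes A B C P Q R :: real
  assumes "s\<^sup>2 + c\<^sup>2 = (1::real)"
    and "A = c\<^sup>2 * P + s\<^sup>2 * Q - 2 * s * c * R" "B = s * c * (P - Q) + (c\<^sup>2 - s\<^sup>2) * R"
    and "C = s\<^sup>2 * P + c\<^sup>2 * Q + 2 * s * c * R"
  shows "(1 + A) * (1 + C) - B\<^sup>2 = (1 + P) * (1 + Q) - R\<^sup>2"
proof -
  have e: "A * C - B\<^sup>2 = (P * Q - R\<^sup>2) * (s\<^sup>2 + c\<^sup>2)\<^sup>2"
    unfolding assms(2-4) by algebra
  have "A + C = (P + Q) * (s\<^sup>2 + c\<^sup>2)" unfolding assms(2-4) by algebra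
  with e assms(1) have "A * C - B\<^sup>2 = P * Q - R\<^sup>2" "A + C = P + Q" by simp_all
  thus ?thesis by (simp add: algebra_simps)
qed

text \<open>The matrix on the left is T (I + H) T^t, where T has rows (1, 0) and (c, s) and passes
  to wedge coordinates. T T^t carries \<open>c\<close> off the diagonal, and det T = s.\<close>

lemma linear_change_det:
  fixes s c A B C :: real
  assumes "s\<^sup>2 + c\<^sup>2 = 1"
  shows "(1 + A) * (1 + (c\<^sup>2 * A + 2 * c * s * B + s\<^sup>2 * C)) - (c + (c * A + s * B)) * (c + (c * A + s * B))
     = s\<^sup>2 * ((1 + A) * (1 + C) - B\<^sup>2)"
proof -
  have "(1 + A) * ((s\<^sup>2 + c\<^sup>2) + (c\<^sup>2 * A + 2 * c * s * B + s\<^sup>2 * C)) - (c + (c * A + s * B)) * (c + (c * A + s * B))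
     = s\<^sup>2 * ((1 + A) * (1 + C) - B\<^sup>2)" by algebra
  thus ?thesis using assms by simp
qed

lemma iter_D2_mult:
  fixes f g :: "real^'n::finite \<Rightarrow> real"
  assumes "open S" "x \<in> S"
    and f: "\<And>y. y \<in> S \<Longrightarrow> f differentiable at y" "\<And>y j. y \<in> S \<Longrightarrow> partial_D j f differentiable at y"
    and g: "\<And>y. y \<in> S \<Longrightarrow> g differentiable at y" "\<And>y j. y \<in> S \<Longrightarrow> partial_D j g differentiable at y"
  shows "iter_D [i, j] (\<lambda>x. f x * g x) x = f x * iter_D [i, j] g x +
    (partial_D i f x * partial_D j g x + partial_D j f x * partial_D i g x + iter_D [i, j] f x * g x)"
proof -
  have "partial_D i (partial_D j (\<lambda>x. f x * g x)) x =
      partial_D i (\<lambda>x. f x * partial_D j g x + partial_D j f x * g x) x"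
    by (rule partial_D_cong[OF assms(1,2)]) (simp add: partial_D_mult f g)
  also have "\<dots> = f x * partial_D i (partial_D j g) x + partial_D i f x * partial_D j g x +
      (partial_D j f x * partial_D i g x + partial_D i (partial_D j f) x * g x)"
    using assms(2) by (subst partial_D_add) (auto simp: partial_D_mult f g)
  finally show ?thesis by simp
qed

lemma partial_D_sum:
  fixes g :: "'a \<Rightarrow> real^'n::finite \<Rightarrow> real"
  assumes "\<And>a. a \<in> A \<Longrightarrow> g a differentiable at x"
  shows "partial_D i (\<lambda>x. \<Sum>a\<in>A. g a x) x = (\<Sum>a\<in>A. partial_D i (g a) x)"
proof -
  have "((\<lambda>x. \<Sum>a\<in>A. g a x) has_derivative (\<lambda>v. \<Sum>a\<in>A. frechet_derivative (g a) (at x) v)) (at x)"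
    by (rule has_derivative_sum) (use assms frechet_derivative_works in blast)
  from partial_D_eq[OF this] show ?thesis by (simp add: partial_D_def)
qed

lemma iter_D2_sum:
  fixes g :: "'a \<Rightarrow> real^'n::finite \<Rightarrow> real"
  assumes "open S" "x \<in> S"
    and g: "\<And>a y. a \<in> A \<Longrightarrow> y \<in> S \<Longrightarrow> g a differentiable at y"
      "\<And>a y j. a \<in> A \<Longrightarrow> y \<in> S \<Longrightarrow> partial_D j (g a) differentiable at y"
  shows "iter_D [i, j] (\<lambda>x. \<Sum>a\<in>A. g a x) x = (\<Sum>a\<in>A. iter_D [i, j] (g a) x)"
proof -
  have "partial_D i (partial_D j (\<lambda>x. \<Sum>a\<in>A. g a x)) x = partial_D i (\<lambda>x. \<Sum>a\<in>A. partial_D j (g a) x) x"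
    by (rule partial_D_cong[OF assms(1,2)]) (simp add: partial_D_sum g)
  also have "\<dots> = (\<Sum>a\<in>A. partial_D i (partial_D j (g a)) x)"
    using assms(2) by (subst partial_D_sum) (auto simp: g)
  finally show ?thesis by simp
qed

context wedge_domain begin

lemma profile_deriv_at:
  assumes "x \<in> S" "\<forall>x\<in>{-1..2}. (h has_real_derivative h' x) (at x within {-1..2})"
  shows "(h has_real_derivative h' (ang \<theta> x)) (at (ang \<theta> x))"
proof -
  have a: "ang \<theta> x \<in> {-1<..<2}" using ang_range quadrant[OF assms(1)] weight_pos[OF assms(1)] by auto
  hence "(h has_real_derivative h' (ang \<theta> x)) (at (ang \<theta> x) within {-1..2})" using assms(2) by auto
  thus ?thesis using a at_within_Icc_at[of "-1" "ang \<theta> x" 2] by simp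
qed

lemma PX_pos_S: "x \<in> S \<Longrightarrow> PX \<theta> x > 0"
  using PX_pos quadrant weight_pos by (simp add: less_imp_le)

lemma pol_hessian:
  assumes x: "x \<in> S" and h: "\<forall>x\<in>{-1..2}. (h has_real_derivative h1 x) (at x within {-1..2})"
    and h1: "\<forall>x\<in>{-1..2}. (h1 has_real_derivative h2 x) (at x within {-1..2})"
  shows "iter_D [1, 1] (pol \<theta> d h) x = pol \<theta> (d - 2) (pXX d h h1 h2) x" (is ?th1)
    and "iter_D [1, 2] (pol \<theta> d h) x = cos \<theta> * pol \<theta> (d - 2) (pXX d h h1 h2) x + sin \<theta> * pol \<theta> (d - 2) (pXY d h h1 h2) x" (is ?th2)
    and "iter_D [2, 1] (pol \<theta> d h) x = cos \<theta> * pol \<theta> (d - 2) (pXX d h h1 h2) x + sin \<theta> * pol \<theta> (d - 2) (pXY d h h1 h2) x" (is ?th3)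
    and "iter_D [2, 2] (pol \<theta> d h) x = (cos \<theta>)\<^sup>2 * pol \<theta> (d - 2) (pXX d h h1 h2) x +
       2 * cos \<theta> * sin \<theta> * pol \<theta> (d - 2) (pXY d h h1 h2) x + (sin \<theta>)\<^sup>2 * pol \<theta> (d - 2) (pYY d h h1 h2) x" (is ?th4)
    and "iter_D [3, i] (pol \<theta> d h) x = 0" (is ?th5)
    and "iter_D [i, 3] (pol \<theta> d h) x = 0" (is ?th6)
proof -
  have D: "d - 1 - 1 = d - 2" by simp
  \<comment> \<open>The derivative along x2 mixes the derivatives along both wedge coordinates, so
    one family of linear combinations serves all first partial derivatives.\<close>
  define f where "f \<alpha> \<beta> = (\<lambda>a. \<alpha> * polX d h h1 a + \<beta> * polY d h h1 a)" for \<alpha> \<beta>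
  define f' where "f' \<alpha> \<beta> = (\<lambda>a. \<alpha> * (d * cos a * h1 a - d * sin a * h a - cos a * h1 a - sin a * h2 a) +
      \<beta> * (d * sin a * h1 a + d * cos a * h a - sin a * h1 a + cos a * h2 a))" for \<alpha> \<beta>
  have fd: "(f \<alpha> \<beta> has_real_derivative f' \<alpha> \<beta> (ang \<theta> y)) (at (ang \<theta> y))" if "y \<in> S" for \<alpha> \<beta> y
    unfolding f_def f'_def polX_def polY_def
    by (rule derivative_eq_intros profile_deriv_at[OF that h] profile_deriv_at[OF that h1] refl | simp add: algebra_simps)+
  have P1: "partial_D i (partial_D 1 (pol \<theta> d h)) x = partial_D i (pol \<theta> (d - 1) (f 1 0)) x" for i
    by (rule partial_D_cong[OF open_S x]) (simp add: pol_partial[where h' = h1, OF PX_pos_S profile_deriv_at[OF _ h]] f_def)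
  have P2: "partial_D i (partial_D 2 (pol \<theta> d h)) x = partial_D i (pol \<theta> (d - 1) (f (cos \<theta>) (sin \<theta>))) x" for i
    by (rule partial_D_cong[OF open_S x]) (simp add: pol_partial[where h' = h1, OF PX_pos_S profile_deriv_at[OF _ h]] f_def pol_sum)
  have P3: "partial_D i (partial_D 3 (pol \<theta> d h)) x = 0" for i
  proof -
    have "partial_D i (partial_D 3 (pol \<theta> d h)) x = partial_D i (\<lambda>_. 0) x"
      by (rule partial_D_cong[OF open_S x]) (simp add: pol_partial[where h' = h1, OF PX_pos_S profile_deriv_at[OF _ h]])
    thus ?thesis by simp
  qed
  note Q = pol_partial[where h = "f \<alpha> \<beta>" and h' = "f' \<alpha> \<beta>" for \<alpha> \<beta>, OF PX_pos_S[OF x] fd[OF x]]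
  have sc: "(sin a)\<^sup>2 + (cos a)\<^sup>2 = (1::real)" for a by simp
  have X: "polX (d - 1) (f 1 0) (f' 1 0) = pXX d h h1 h2"
    unfolding f_def f'_def polX_def polY_def pXX_def by (intro ext) algebra
  have Y: "polY (d - 1) (f 1 0) (f' 1 0) = pXY d h h1 h2"
    unfolding f_def f'_def polX_def polY_def pXY_def by (intro ext) algebra
  have X2: "polX (d - 1) (f \<alpha> \<beta>) (f' \<alpha> \<beta>) = (\<lambda>a. \<alpha> * pXX d h h1 h2 a + \<beta> * pXY d h h1 h2 a)" for \<alpha> \<beta>
    unfolding f_def f'_def polX_def polY_def pXX_def pXY_def by (intro ext) algebra
  have Y2: "polY (d - 1) (f \<alpha> \<beta>) (f' \<alpha> \<beta>) = (\<lambda>a. \<alpha> * pXY d h h1 h2 a + \<beta> * pYY d h h1 h2 a)" for \<alpha> \<beta>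
    unfolding f_def f'_def polX_def polY_def pYY_def pXY_def by (intro ext) algebra
  show ?th1 by (simp add: P1 Q X D)
  show ?th2 by (simp add: P2 Q X2 D pol_sum[symmetric])
  show ?th3 by (simp add: P1 Q X Y D)
  show ?th4 by (simp add: P2 Q X2 Y2 D pol_sum[symmetric] power2_eq_square algebra_simps)
  show ?th6 by (simp add: P3)
  consider "i = 1" | "i = 2" | "i = 3" using exhaust_3 by blast
  thus ?th5 by cases (simp_all add: P1 P2 P3 Q)
qed

end

text \<open>A polynomial cut-off; the fourth power of the positive part gives the three derivatives
  that are used.\<close>

definition bump :: "real \<Rightarrow> real \<Rightarrow> real^3 \<Rightarrow> real" where
  "bump t0 \<delta> x = max 0 (\<delta>\<^sup>2 - (x $ 1 * x $ 1 + x $ 2 * x $ 2 + (x $ 3 - t0) * (x $ 3 - t0))) ^ 4"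

text \<open>The multiplier enters the j-th term to the power \<open>j\<close>. The sum is then r^2
  times a polynomial in the single quantity k * bump * r^gamma, with coefficients that depend on the
  angle.\<close>

definition pert :: "real \<Rightarrow> real \<Rightarrow> real \<Rightarrow> real \<Rightarrow> nat \<Rightarrow> (nat \<Rightarrow> real \<Rightarrow> real) \<Rightarrow> real \<Rightarrow> real^3 \<Rightarrow> real" where
  "pert \<theta> \<gamma> t0 \<delta> N h k x = (\<Sum>j\<in>{1..N}. (k * bump t0 \<delta> x) ^ j * pol \<theta> (2 + real j * \<gamma>) (h j) x)"

text \<open>\<open>b3\<close> is what the base function contains beyond its quadratic part; it
  vanishes to third order at the edge. The second condition on \<open>N\<close> says that the first
  power left uncancelled is Lipschitz.\<close>

locale edge_model = wedge_domain \<theta> S M for \<theta> S M +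
  fixes t0 \<delta> \<gamma> R :: real and N :: nat and h h1 h2 :: "nat \<Rightarrow> real \<Rightarrow> real" and b3 :: "real^3 \<Rightarrow> real"
  assumes bounded_S: "\<And>x i. x \<in> S \<Longrightarrow> \<bar>x $ i\<bar> \<le> R"
    and gamma: "0 < \<gamma>" "\<gamma> < 1" and N: "1 \<le> N" "1 \<le> (real N + 1) * \<gamma>"
    and prof: "profiles \<theta> (\<lambda>j. 2 + real j * \<gamma>) N h h1 h2"
    and b3: "symb 3 0 3 (\<lambda>_. b3)"
begin

abbreviation "d j \<equiv> 2 + real j * \<gamma>"
abbreviation "V \<equiv> pert \<theta> \<gamma> t0 \<delta> N h"
abbreviation "K k x \<equiv> k * bump t0 \<delta> x"
abbreviation "W j \<equiv> pol \<theta> (d j) (h j)"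

lemma weighted_1: "weighted S (\<lambda>_. 1) 1"
  by unfold_locales (auto simp: open_S)

lemma bump_sy: "sy 3 S (\<lambda>_. 1) 0 0 (\<lambda>_. bump t0 \<delta>)"
proof -
  interpret bd: weighted S "\<lambda>_. 1" 1 by (rule weighted_1)
  have c: "bd.symb n 0 0 (\<lambda>_ x. x $ i)" for n i
    by (rule bd.sy_component) (auto intro!: wboundI[where C = R] simp: bounded_S)
  have k: "bd.symb n 0 0 (\<lambda>_ _. a)" for n a by (rule bd.sy_const) simp
  have m: "bd.symb n 0 0 (\<lambda>k x. f k x * g k x)" if "bd.symb n 0 0 f" "bd.symb n 0 0 g" for n f g
    using bd.sy_mult[OF that] by simp
  show ?thesis unfolding bump_def[abs_def]
    by (rule bd.sy_max_power) (intro bd.sy_diff bd.sy_add m c k | simp)+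
qed

lemma K_power_bounded: "1 \<le> j \<Longrightarrow> sy 3 S (\<lambda>_. 1) 1 0 (\<lambda>k x. K k x ^ j)"
proof -
  interpret bd: weighted S "\<lambda>_. 1" 1 by (rule weighted_1)
  have "bd.symb 3 1 0 K" using bd.sy_mult[OF bd.sy_amplitude bump_sy] by simp
  from bd.sy_power[OF this, of j] show "1 \<le> j \<Longrightarrow> ?thesis" by (rule bd.sy_mono) auto
qed

lemma K_power: "1 \<le> j \<Longrightarrow> symb 3 1 0 (\<lambda>k x. K k x ^ j)"
  using bounded_sy K_power_bounded by blast

text \<open>The multiplier is regular across the edge, so differentiating it costs no
  weight.\<close>

lemma K_power_D:
  assumes "1 \<le> j"
  shows "symb 2 1 0 (\<lambda>k. partial_D i (\<lambda>x. K k x ^ j))" and "symb 1 1 0 (\<lambda>k. iter_D [i, i'] (\<lambda>x. K k x ^ j))"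
proof -
  interpret bd: weighted S "\<lambda>_. 1" 1 by (rule weighted_1)
  \<comment> \<open>For the constant weight 1 all exponents mean the same, so the loss recorded by a
    derivative can be undone.\<close>
  have eq: "sy n S (\<lambda>_. 1) 1 a f" if "sy n S (\<lambda>_. 1) 1 b f" for n a b f
    using that
  proof (induction n arbitrary: a b f)
    case 0
    thus ?case by (simp add: wbound_def)
  next
    case (Suc n)
    have "sy n S (\<lambda>_. 1) 1 (a - 1) (\<lambda>k. partial_D i (f k))" for i
      by (rule Suc.IH[of "b - 1"]) (use Suc.prems in auto)
    thus ?case using Suc.prems by (auto simp: wbound_def)
  qed
  have "sy 2 S (\<lambda>_. 1) 1 (0 - 1) (\<lambda>k. partial_D i (\<lambda>x. K k x ^ j))" for i
    using sy_partial[OF K_power_bounded[OF assms, unfolded numeral_3_eq_3]] by (simp only: numeral_2_eq_2)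
  hence 2: "sy 2 S (\<lambda>_. 1) 1 0 (\<lambda>k. partial_D i (\<lambda>x. K k x ^ j))" for i by (rule eq)
  thus "symb 2 1 0 (\<lambda>k. partial_D i (\<lambda>x. K k x ^ j))" by (rule bounded_sy)
  have "sy 1 S (\<lambda>_. 1) 1 (0 - 1) (\<lambda>k. partial_D i (partial_D i' (\<lambda>x. K k x ^ j)))"
    using sy_partial[OF 2[unfolded numeral_2_eq_2]] by (simp only: One_nat_def)
  hence "sy 1 S (\<lambda>_. 1) 1 0 (\<lambda>k. iter_D [i, i'] (\<lambda>x. K k x ^ j))" unfolding iter_D.simps by (rule eq)
  thus "symb 1 1 0 (\<lambda>k. iter_D [i, i'] (\<lambda>x. K k x ^ j))" by (rule bounded_sy)
qed

lemma W_sy: "j \<in> {1..N} \<Longrightarrow> symb 3 0 (d j) (\<lambda>_. W j)"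
  using pol_sy profiles_cn(3)[OF prof] by blast

lemma W_D:
  assumes "j \<in> {1..N}"
  shows "symb 2 0 (d j - 1) (\<lambda>_. partial_D i (W j))" "symb 1 0 (d j - 2) (\<lambda>_. iter_D [i, i'] (W j))"
proof -
  have 1: "symb 2 0 (d j - 1) (\<lambda>_. partial_D i (W j))" for i
    using sy_partial[OF W_sy[OF assms, unfolded numeral_3_eq_3]] by (simp only: numeral_2_eq_2)
  thus "symb 2 0 (d j - 1) (\<lambda>_. partial_D i (W j))" .
  have "symb 1 0 (d j - 1 - 1) (\<lambda>_. partial_D i (partial_D i' (W j)))"
    using sy_partial[OF 1[unfolded numeral_2_eq_2]] by (simp only: One_nat_def)
  thus "symb 1 0 (d j - 2) (\<lambda>_. iter_D [i, i'] (W j))" by simp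
qed

lemma V_sy: "symb 3 1 (2 + \<gamma>) V"
  unfolding pert_def[abs_def]
proof (rule sy_sum)
  fix j assume j: "j \<in> {1..N}"
  have "symb 3 (1 + 0) (0 + d j) (\<lambda>k x. K k x ^ j * W j x)"
    using sy_mult[OF K_power W_sy[OF j]] j by auto
  thus "symb 3 1 (2 + \<gamma>) (\<lambda>k x. K k x ^ j * W j x)"
    by (rule sy_mono) (use j gamma in auto)
qed

text \<open>\<open>A\<close> is the Hessian with the multiplier treated as a constant.
  \<open>B\<close> collects the terms in which the multiplier is differentiated; there
  \<open>W j\<close> carries at most one derivative, so \<open>B\<close> is better by one power of
  the weight.\<close>

definition A :: "3 \<Rightarrow> 3 \<Rightarrow> real \<Rightarrow> real^3 \<Rightarrow> real" where
  "A i i' k x = (\<Sum>j\<in>{1..N}. K k x ^ j * iter_D [i, i'] (W j) x)"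
definition B :: "3 \<Rightarrow> 3 \<Rightarrow> real \<Rightarrow> real^3 \<Rightarrow> real" where
  "B i i' k x = (\<Sum>j\<in>{1..N}. partial_D i (\<lambda>x. K k x ^ j) x * partial_D i' (W j) x +
     partial_D i' (\<lambda>x. K k x ^ j) x * partial_D i (W j) x + iter_D [i, i'] (\<lambda>x. K k x ^ j) x * W j x)"

lemma V_hessian:
  assumes "0 < k" "k \<le> 1" "x \<in> S"
  shows "iter_D [i, i'] (V k) x = A i i' k x + B i i' k x"
proof -
  have K: "(\<lambda>x. K k x ^ j) differentiable at y" "partial_D i (\<lambda>x. K k x ^ j) differentiable at y"
    if "j \<in> {1..N}" "y \<in> S" for j y i
    using sy_differentiable[OF K_power[of j, unfolded numeral_3_eq_3] assms(1,2) that(2)]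
      sy_differentiable[OF K_power_D(1)[where j = j, unfolded numeral_2_eq_2] assms(1,2) that(2)] that by auto
  have W: "W j differentiable at y" "partial_D i (W j) differentiable at y"
    if "j \<in> {1..N}" "y \<in> S" for j y i
    using sy_differentiable[OF W_sy[OF that(1), unfolded numeral_3_eq_3] assms(1,2) that(2)]
      sy_differentiable[OF W_D(1)[OF that(1), unfolded numeral_2_eq_2] assms(1,2) that(2)] by auto
  have KW: "partial_D i (\<lambda>x. K k x ^ j * W j x) differentiable at y" if "j \<in> {1..N}" "y \<in> S" for j y i
  proof -
    have "(\<lambda>x. K k x ^ j * partial_D i (W j) x + partial_D i (\<lambda>x. K k x ^ j) x * W j x) differentiable at y"
      using K[OF that] W[OF that] by auto
    thus ?thesis
      by (rule differentiable_cong_open[OF open_S that(2), rotated])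
        (simp add: partial_D_mult K[OF that(1)] W[OF that(1)])
  qed
  have "iter_D [i, i'] (V k) x = (\<Sum>j\<in>{1..N}. iter_D [i, i'] (\<lambda>x. K k x ^ j * W j x) x)"
    unfolding pert_def[abs_def]
    by (rule iter_D2_sum[OF open_S assms(3)]) (auto intro!: K W KW differentiable_mult)
  also have "\<dots> = (\<Sum>j\<in>{1..N}. K k x ^ j * iter_D [i, i'] (W j) x +
     (partial_D i (\<lambda>x. K k x ^ j) x * partial_D i' (W j) x +
     partial_D i' (\<lambda>x. K k x ^ j) x * partial_D i (W j) x + iter_D [i, i'] (\<lambda>x. K k x ^ j) x * W j x))"
    by (rule sum.cong[OF refl], rule iter_D2_mult[OF open_S assms(3)]) (auto intro: K W)
  finally show ?thesis by (simp only: A_def B_def sum.distrib)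
qed

lemma A_sy: "symb 1 1 0 (A i i')"
  unfolding A_def[abs_def]
proof (rule sy_sum)
  fix j assume j: "j \<in> {1..N}"
  have "symb 1 (1 + 0) (0 + (d j - 2)) (\<lambda>k x. K k x ^ j * iter_D [i, i'] (W j) x)"
    using sy_mult[OF sy_le[OF _ K_power] W_D(2)[OF j]] j by auto
  thus "symb 1 1 0 (\<lambda>k x. K k x ^ j * iter_D [i, i'] (W j) x)"
    by (rule sy_mono) (use j gamma in auto)
qed

lemma B_sy: "symb 1 1 1 (B i i')"
  unfolding B_def[abs_def]
proof (rule sy_sum)
  fix j assume j: "j \<in> {1..N}"
  hence j1: "1 \<le> j" by simp
  have KD: "symb 1 1 0 (\<lambda>k. partial_D i (\<lambda>x. K k x ^ j))" for i
    using sy_le[OF _ K_power_D(1)[OF j1], of 1] by simp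
  have WD: "symb 1 0 1 (\<lambda>_. partial_D i (W j))" for i
    using sy_le[OF _ W_D(1)[OF j], of 1] by (rule sy_mono) (use gamma in auto)
  have W0: "symb 1 0 1 (\<lambda>_. W j)"
    using sy_le[OF _ W_sy[OF j], of 1] by (rule sy_mono) (use gamma in \<open>auto intro: add_nonneg_nonneg\<close>)
  have "symb 1 (1 + 0) (0 + 1) (\<lambda>k x. partial_D i (\<lambda>x. K k x ^ j) x * partial_D i' (W j) x)" for i i'
    by (rule sy_mult[OF KD WD])
  moreover have "symb 1 (1 + 0) (0 + 1) (\<lambda>k x. iter_D [i, i'] (\<lambda>x. K k x ^ j) x * W j x)"
    by (rule sy_mult[OF K_power_D(2)[OF j1] W0])
  ultimately show "symb 1 1 1 (\<lambda>k x. partial_D i (\<lambda>x. K k x ^ j) x * partial_D i' (W j) x +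
     partial_D i' (\<lambda>x. K k x ^ j) x * partial_D i (W j) x + iter_D [i, i'] (\<lambda>x. K k x ^ j) x * W j x)"
    by (intro sy_add) simp_all
qed

end

lemma iter_D2_add:
  fixes f g :: "real^'n::finite \<Rightarrow> real"
  assumes "open S" "x \<in> S"
    and f: "\<And>y. y \<in> S \<Longrightarrow> f differentiable at y" "\<And>y j. y \<in> S \<Longrightarrow> partial_D j f differentiable at y"
    and g: "\<And>y. y \<in> S \<Longrightarrow> g differentiable at y" "\<And>y j. y \<in> S \<Longrightarrow> partial_D j g differentiable at y"
  shows "iter_D [i, j] (\<lambda>x. f x + g x) x = iter_D [i, j] f x + iter_D [i, j] g x"
proof -
  have "partial_D i (partial_D j (\<lambda>x. f x + g x)) x = partial_D i (\<lambda>x. partial_D j f x + partial_D j g x) x"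
    by (rule partial_D_cong[OF assms(1,2)]) (simp add: partial_D_add f g)
  also have "\<dots> = partial_D i (partial_D j f) x + partial_D i (partial_D j g) x"
    using assms(2) by (subst partial_D_add) (auto simp: f g)
  finally show ?thesis by simp
qed

definition quad :: "real \<Rightarrow> real^3 \<Rightarrow> real" where
  "quad c x = (x $ 1 * x $ 1 + x $ 2 * x $ 2 + x $ 3 * x $ 3) / 2 + c * (x $ 1 * x $ 2)"

definition quad_hess :: "real \<Rightarrow> 3 \<Rightarrow> 3 \<Rightarrow> real" where
  "quad_hess c i j = (if i = j then 1 else if i = 3 \<or> j = 3 then 0 else c)"

lemma differentiable_component [simp]: "(\<lambda>x. x $ j) differentiable at x"
  by (rule bounded_linear_imp_differentiable) (rule bounded_linear_vec_nth)

lemma partial_D_linear2: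
  "partial_D i (\<lambda>x. a * x $ j + b * x $ l) x = a * (if i = j then 1 else 0) + b * (if i = l then 1 else 0)"
  "(\<lambda>x. a * x $ j + b * x $ l) differentiable at x"
proof -
  have "partial_D i (\<lambda>x. a * x $ j) x = a * (if i = j then 1 else 0)" for a i j
    by (subst partial_D_mult) simp_all
  thus "partial_D i (\<lambda>x. a * x $ j + b * x $ l) x = a * (if i = j then 1 else 0) + b * (if i = l then 1 else 0)"
    by (subst partial_D_add) (simp_all add: differentiable_mult)
qed (intro differentiable_add differentiable_mult differentiable_const differentiable_component)

lemma partial_D_quad:
  "partial_D 1 (quad c) = (\<lambda>x. 1 * x $ 1 + c * x $ 2)" "partial_D 2 (quad c) = (\<lambda>x. 1 * x $ 2 + c * x $ 1)"
  "partial_D 3 (quad c) = (\<lambda>x. 1 * x $ 3 + 0 * x $ 1)" "quad c differentiable at x"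
proof -
  define p where "p i j x = x $ i * x $ j" for i j and x :: "real^3"
  have p: "p i j differentiable at x"
    "partial_D l (p i j) x = x $ i * (if l = j then 1 else 0) + (if l = i then 1 else 0) * x $ j" for i j l x
    unfolding p_def by (auto simp: partial_D_mult differentiable_mult)
  have q: "quad c = (\<lambda>x. 1/2 * (p 1 1 x + p 2 2 x + p 3 3 x) + c * p 1 2 x)"
    by (auto simp: quad_def p_def)
  have D: "partial_D l (quad c) x = 1/2 * (partial_D l (p 1 1) x + partial_D l (p 2 2) x + partial_D l (p 3 3) x) + c * partial_D l (p 1 2) x" for l x
    unfolding q
    by (subst partial_D_add, (intro differentiable_mult differentiable_add p differentiable_const)+,
        subst partial_D_mult, (intro differentiable_add p differentiable_const)+,
        subst partial_D_mult, (intro differentiable_add p differentiable_const)+,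
        subst partial_D_add, (intro differentiable_add p differentiable_const)+,
        subst partial_D_add, (intro differentiable_add p differentiable_const)+) simp
  show "partial_D 1 (quad c) = (\<lambda>x. 1 * x $ 1 + c * x $ 2)" "partial_D 2 (quad c) = (\<lambda>x. 1 * x $ 2 + c * x $ 1)"
    "partial_D 3 (quad c) = (\<lambda>x. 1 * x $ 3 + 0 * x $ 1)"
    by (auto simp: D p)
  show "quad c differentiable at x" unfolding q
    by (intro differentiable_add differentiable_mult differentiable_const p)
qed

lemma quad_hessian: "iter_D [i, j] (quad c) x = quad_hess c i j" "partial_D j (quad c) differentiable at x"
proof -
  have "\<forall>i j. iter_D [i, j] (quad c) x = quad_hess c i j"
    unfolding forall_3 iter_D.simps partial_D_quad partial_D_linear2 by (simp add: quad_hess_def)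
  thus "iter_D [i, j] (quad c) x = quad_hess c i j" by blast
  have "\<forall>j. partial_D j (quad c) differentiable at x"
    unfolding forall_3 partial_D_quad using partial_D_linear2(2) by blast
  thus "partial_D j (quad c) differentiable at x" by blast
qed

definition det3 :: "(3 \<Rightarrow> 3 \<Rightarrow> real) \<Rightarrow> real" where
  "det3 f = f 1 1 * f 2 2 * f 3 3 + f 1 2 * f 2 3 * f 3 1 + f 1 3 * f 2 1 * f 3 2
     - f 1 1 * f 2 3 * f 3 2 - f 1 2 * f 2 1 * f 3 3 - f 1 3 * f 2 2 * f 3 1"

lemma det_hessian: "det (hessian u x) = det3 (\<lambda>i j. iter_D [i, j] u x)"
  by (simp add: det_3 det3_def hessian_def)

section \<open>Determinants modulo Lipschitz errors\<close>

context weighted begin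

text \<open>Lipschitz quantities of small amplitude form an ideal in the bounded symbols.\<close>

lemma ideal_mult:
  assumes "symb 1 0 0 f" "symb 1 1 1 g"
  shows "symb 1 1 1 (\<lambda>k x. f k x * g k x)" "symb 1 1 1 (\<lambda>k x. g k x * f k x)"
  using sy_mult[OF assms] by (simp_all add: mult.commute)

text \<open>f g - f' g' = f (g - g') + (f - f') g', and the differences lie in the ideal.\<close>

lemma eqv_mult:
  assumes "symb 1 0 0 f" "symb 1 0 0 g'" "symb 1 1 1 (\<lambda>k x. f k x - f' k x)" "symb 1 1 1 (\<lambda>k x. g k x - g' k x)"
  shows "symb 1 1 1 (\<lambda>k x. f k x * g k x - f' k x * g' k x)"
  using sy_add[OF ideal_mult(1)[OF assms(1,4)] ideal_mult(2)[OF assms(2,3)]] by (simp add: algebra_simps)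

lemma det3_eqv:
  assumes f: "\<And>i j. symb 1 0 0 (f i j)" and g: "\<And>i j. symb 1 0 0 (g i j)"
    and fg: "\<And>i j. symb 1 1 1 (\<lambda>k x. f i j k x - g i j k x)"
  shows "symb 1 1 1 (\<lambda>k x. det3 (\<lambda>i j. f i j k x) - det3 (\<lambda>i j. g i j k x))"
proof -
  have m: "symb 1 0 0 (\<lambda>k x. f i j k x * f i' j' k x)" for i j i' j' using sy_mult[OF f f] by simp
  have t: "symb 1 1 1 (\<lambda>k x. f i j k x * f i' j' k x * f i'' j'' k x - g i j k x * g i' j' k x * g i'' j'' k x)"
    for i j i' j' i'' j''
    by (rule eqv_mult[OF m g eqv_mult[OF f g fg fg] fg])
  have "symb 1 1 1 (\<lambda>k x.
      (f 1 1 k x * f 2 2 k x * f 3 3 k x - g 1 1 k x * g 2 2 k x * g 3 3 k x) +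
      (f 1 2 k x * f 2 3 k x * f 3 1 k x - g 1 2 k x * g 2 3 k x * g 3 1 k x) +
      (f 1 3 k x * f 2 1 k x * f 3 2 k x - g 1 3 k x * g 2 1 k x * g 3 2 k x) -
      (f 1 1 k x * f 2 3 k x * f 3 2 k x - g 1 1 k x * g 2 3 k x * g 3 2 k x) -
      (f 1 2 k x * f 2 1 k x * f 3 3 k x - g 1 2 k x * g 2 1 k x * g 3 3 k x) -
      (f 1 3 k x * f 2 2 k x * f 3 1 k x - g 1 3 k x * g 2 2 k x * g 3 1 k x))"
    by (intro sy_add sy_diff t)
  moreover have "(\<lambda>k x. det3 (\<lambda>i j. f i j k x) - det3 (\<lambda>i j. g i j k x)) = (\<lambda>k x.
      (f 1 1 k x * f 2 2 k x * f 3 3 k x - g 1 1 k x * g 2 2 k x * g 3 3 k x) +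
      (f 1 2 k x * f 2 3 k x * f 3 1 k x - g 1 2 k x * g 2 3 k x * g 3 1 k x) +
      (f 1 3 k x * f 2 1 k x * f 3 2 k x - g 1 3 k x * g 2 1 k x * g 3 2 k x) -
      (f 1 1 k x * f 2 3 k x * f 3 2 k x - g 1 1 k x * g 2 3 k x * g 3 2 k x) -
      (f 1 2 k x * f 2 1 k x * f 3 3 k x - g 1 2 k x * g 2 1 k x * g 3 3 k x) -
      (f 1 3 k x * f 2 2 k x * f 3 1 k x - g 1 3 k x * g 2 2 k x * g 3 1 k x))"
    by (intro ext) (simp add: det3_def)
  ultimately show ?thesis by simp
qed

end

section \<open>Cancellation of the low powers of the radius\<close>

context edge_model begin

text \<open>\<open>pf\<close>, \<open>qf\<close>, \<open>rf\<close> are the coefficients of y^j in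
  the radial, angular and mixed entries of the polar Hessian, and \<open>ee\<close> is that of the
  product of the first two minus the square of the third. They are extended by 0 so that
  convolutions become products of polynomials.\<close>

definition pf :: "nat \<Rightarrow> real \<Rightarrow> real" where "pf j a = (if j \<in> {1..N} then d j * (d j - 1) * h j a else 0)"
definition qf :: "nat \<Rightarrow> real \<Rightarrow> real" where "qf j a = (if j \<in> {1..N} then h2 j a + d j * h j a else 0)"
definition rf :: "nat \<Rightarrow> real \<Rightarrow> real" where "rf j a = (if j \<in> {1..N} then (d j - 1) * h1 j a else 0)"
definition ee :: "nat \<Rightarrow> real \<Rightarrow> real" where
  "ee j a = (\<Sum>l\<le>j. pf l a * qf (j - l) a) - (\<Sum>l\<le>j. rf l a * rf (j - l) a)"

text \<open>This is the profile equation: the convolution reduces to proper indices because the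
  coefficients vanish at 0, and \<open>pf + qf\<close> is h'' + d^2 h.\<close>

lemma ee_low:
  assumes "j \<le> N" "a \<in> {-1..2}"
  shows "pf j a + qf j a + ee j a = 0"
proof (cases "j = 0")
  case True
  thus ?thesis by (simp add: ee_def pf_def qf_def rf_def)
next
  case False
  hence j: "j \<in> {1..N}" using assms by auto
  have "ee j a = (\<Sum>l\<le>j. pf l a * qf (j - l) a - rf l a * rf (j - l) a)"
    by (simp add: ee_def sum_subtractf)
  also have "\<dots> = (\<Sum>l\<in>{1..<j}. pf l a * qf (j - l) a - rf l a * rf (j - l) a)"
    by (rule sum.mono_neutral_right) (auto simp: pf_def qf_def rf_def)
  also have "\<dots> = mixed d h h1 h2 j a"
    unfolding mixed_def by (rule sum.cong[OF refl]) (use assms in \<open>auto simp: pf_def qf_def rf_def\<close>)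
  finally have "ee j a = mixed d h h1 h2 j a" .
  moreover have "h2 j a + (d j)\<^sup>2 * h j a = - mixed d h h1 h2 j a"
    using prof j assms(2) by (auto simp: profiles_def)
  ultimately show ?thesis using j by (simp add: pf_def qf_def power2_eq_square algebra_simps)
qed

text \<open>The coefficient of y^j is \<open>pf + qf + ee\<close>. It vanishes up to order
  \<open>N\<close> by \<open>ee_low\<close>; beyond \<open>N\<close> the linear part is
  absent.\<close>

lemma polar_product:
  fixes y a :: real
  assumes a: "a \<in> {-1..2}"
  defines "P \<equiv> \<Sum>j\<le>N. pf j a * y ^ j" and "Q \<equiv> \<Sum>j\<le>N. qf j a * y ^ j" and "RR \<equiv> \<Sum>j\<le>N. rf j a * y ^ j"
  shows "(1 + P) * (1 + Q) - RR\<^sup>2 = 1 + (\<Sum>j\<in>{N+1..2*N}. y ^ j * ee j a)"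
proof -
  have z: "pf j a = 0" "qf j a = 0" "rf j a = 0" if "j > N" for j using that by (auto simp: pf_def qf_def rf_def)
  have PQ: "P * Q = (\<Sum>j\<le>N+N. (\<Sum>l\<le>j. pf l a * qf (j - l) a) * y ^ j)"
    unfolding P_def Q_def by (rule polynomial_product) (use z in auto)
  have RR: "RR * RR = (\<Sum>j\<le>N+N. (\<Sum>l\<le>j. rf l a * rf (j - l) a) * y ^ j)"
    unfolding RR_def by (rule polynomial_product) (use z in auto)
  have PP: "P + Q = (\<Sum>j\<le>N+N. (pf j a + qf j a) * y ^ j)"
  proof -
    have "P + Q = (\<Sum>j\<le>N. (pf j a + qf j a) * y ^ j)" by (simp add: P_def Q_def sum.distrib distrib_right)
    also have "\<dots> = (\<Sum>j\<le>N+N. (pf j a + qf j a) * y ^ j)"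
      by (rule sum.mono_neutral_left) (auto simp: z)
    finally show ?thesis .
  qed
  have "P + Q + (P * Q - RR * RR) = (\<Sum>j\<le>N+N. (pf j a + qf j a + ee j a) * y ^ j)"
    unfolding PP PQ RR sum.distrib[symmetric] sum_subtractf[symmetric]
    by (rule sum.cong) (simp_all add: ee_def algebra_simps)
  also have "\<dots> = (\<Sum>j\<in>{N+1..2*N}. (pf j a + qf j a + ee j a) * y ^ j)"
    by (rule sum.mono_neutral_right) (auto simp: ee_low[OF _ a])
  also have "\<dots> = (\<Sum>j\<in>{N+1..2*N}. y ^ j * ee j a)"
    by (rule sum.cong) (auto simp: z)
  finally show ?thesis by (simp add: power2_eq_square algebra_simps)
qed

lemma cn_ee: "cn 1 (ee j)"
proof -
  have "cn 1 (h i)" "cn 1 (h1 i)" "cn 1 (h2 i)" if "i \<in> {1..N}" for i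
    using cn_SucD[OF cn_SucD[OF profiles_cn(3)[OF prof that, unfolded numeral_3_eq_3]]]
      cn_SucD[OF profiles_cn(2)[OF prof that, unfolded numeral_2_eq_2]] profiles_cn(1)[OF prof that]
    unfolding One_nat_def .
  hence "cn 1 (pf i)" "cn 1 (qf i)" "cn 1 (rf i)" for i
    unfolding pf_def[abs_def] qf_def[abs_def] rf_def[abs_def]
    by (cases "i \<in> {1..N}"; simp only: if_True if_False; intro cn_intros; simp)+
  thus ?thesis unfolding ee_def[abs_def] by (intro cn_intros)
qed

definition G :: "real \<Rightarrow> real^3 \<Rightarrow> real" where
  "G k x = (sin \<theta>)\<^sup>2 * (\<Sum>j\<in>{N+1..2*N}. K k x ^ j * pol \<theta> (real j * \<gamma>) (ee j) x)"

text \<open>Every surviving power of the radius is at least (N + 1) gamma, hence at least 1.\<close>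

lemma G_sy: "symb 1 1 1 G"
  unfolding G_def[abs_def]
proof (intro sy_cmult sy_sum)
  fix j assume j: "j \<in> {N+1..2*N}"
  have "symb 1 (1 + 0) (0 + real j * \<gamma>) (\<lambda>k x. K k x ^ j * pol \<theta> (real j * \<gamma>) (ee j) x)"
    using sy_mult[OF sy_le[OF _ K_power] pol_sy[OF cn_ee]] j by auto
  moreover have "1 \<le> real j * \<gamma>"
  proof -
    have "(real N + 1) * \<gamma> \<le> real j * \<gamma>" using j gamma by (intro mult_right_mono) auto
    thus ?thesis using N by linarith
  qed
  ultimately show "symb 1 1 1 (\<lambda>k x. K k x ^ j * pol \<theta> (real j * \<gamma>) (ee j) x)"
    by - (erule sy_mono, simp_all del: sy.simps)
qed

text \<open>With the multiplier frozen the two-dimensional determinant is computed exactly: pass to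
  wedge coordinates, rotate into the polar frame and expand in y.\<close>

lemma A_det:
  assumes "0 < k" "k \<le> 1" "x \<in> S"
  shows "(1 + A 1 1 k x) * (1 + A 2 2 k x) - (cos \<theta> + A 1 2 k x) * (cos \<theta> + A 2 1 k x) = (sin \<theta>)\<^sup>2 + G k x"
proof -
  define r where "r = rad \<theta> x"
  define a where "a = ang \<theta> x"
  \<comment> \<open>Second derivatives of the j-th term have degree j gamma, so multiplier and
    radius combine into the j-th power of one number.\<close>
  define y where "y = K k x * r powr \<gamma>"
  have r: "r > 0" using rad_pos PX_pos_S[OF assms(3)] by (simp add: r_def)
  have a: "a \<in> {-1..2}" using ang_range[of x] quadrant[OF assms(3)] weight_pos[OF assms(3)] by (auto simp: a_def)
  have y: "K k x ^ j * pol \<theta> (real j * \<gamma>) f x = y ^ j * f a" for j f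
    using r by (simp add: pol_def y_def power_mult_distrib powr_power r_def[symmetric] a_def)
  have y2: "K k x ^ j * pol \<theta> (d j - 2) f x = y ^ j * f a" for j f using y by simp
  define P where "P = (\<Sum>j\<le>N. pf j a * y ^ j)"
  define Q where "Q = (\<Sum>j\<le>N. qf j a * y ^ j)"
  define RR where "RR = (\<Sum>j\<le>N. rf j a * y ^ j)"
  have P: "P = (\<Sum>j\<in>{1..N}. y ^ j * (d j * (d j - 1) * h j a))"
    unfolding P_def by (rule sum.mono_neutral_cong_right) (auto simp: pf_def)
  have Q: "Q = (\<Sum>j\<in>{1..N}. y ^ j * (h2 j a + d j * h j a))"
    unfolding Q_def by (rule sum.mono_neutral_cong_right) (auto simp: qf_def)
  have RR: "RR = (\<Sum>j\<in>{1..N}. y ^ j * ((d j - 1) * h1 j a))"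
    unfolding RR_def by (rule sum.mono_neutral_cong_right) (auto simp: rf_def)
  define XX where "XX = (\<Sum>j\<in>{1..N}. y ^ j * pXX (d j) (h j) (h1 j) (h2 j) a)"
  define XY where "XY = (\<Sum>j\<in>{1..N}. y ^ j * pXY (d j) (h j) (h1 j) (h2 j) a)"
  define YY where "YY = (\<Sum>j\<in>{1..N}. y ^ j * pYY (d j) (h j) (h1 j) (h2 j) a)"
  have XX: "XX = (cos a)\<^sup>2 * P + (sin a)\<^sup>2 * Q - 2 * sin a * cos a * RR"
    unfolding XX_def P Q RR pXX_def sum_distrib_left sum.distrib[symmetric] sum_subtractf[symmetric]
    by (rule sum.cong) (simp_all add: algebra_simps)
  have XY: "XY = sin a * cos a * (P - Q) + ((cos a)\<^sup>2 - (sin a)\<^sup>2) * RR"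
    unfolding XY_def P Q RR pXY_def sum_distrib_left sum.distrib[symmetric] sum_subtractf[symmetric]
    by (rule sum.cong) (simp_all add: algebra_simps)
  have YY: "YY = (sin a)\<^sup>2 * P + (cos a)\<^sup>2 * Q + 2 * sin a * cos a * RR"
    unfolding YY_def P Q RR pYY_def sum_distrib_left sum.distrib[symmetric] sum_subtractf[symmetric]
    by (rule sum.cong) (simp_all add: algebra_simps)
  have hD: "\<forall>x\<in>{-1..2}. (h j has_real_derivative h1 j x) (at x within {-1..2})"
    "\<forall>x\<in>{-1..2}. (h1 j has_real_derivative h2 j x) (at x within {-1..2})" if "j \<in> {1..N}" for j
    using prof that by (auto simp: profiles_def)
  note H = pol_hessian[OF assms(3) hD]
  have A11: "A 1 1 k x = XX"
    unfolding A_def XX_def by (rule sum.cong[OF refl]) (simp only: H y2)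
  have A12: "A 1 2 k x = cos \<theta> * XX + sin \<theta> * XY" and A21: "A 2 1 k x = cos \<theta> * XX + sin \<theta> * XY"
    unfolding A_def XX_def XY_def sum_distrib_left sum.distrib[symmetric]
    by (rule sum.cong[OF refl]; simp only: H distrib_left y2[symmetric] mult_ac)+
  have A22: "A 2 2 k x = (cos \<theta>)\<^sup>2 * XX + 2 * cos \<theta> * sin \<theta> * XY + (sin \<theta>)\<^sup>2 * YY"
    unfolding A_def XX_def XY_def YY_def sum_distrib_left sum.distrib[symmetric]
    by (rule sum.cong[OF refl]) (simp only: H distrib_left y2[symmetric] mult_ac)
  have "(1 + A 1 1 k x) * (1 + A 2 2 k x) - (cos \<theta> + A 1 2 k x) * (cos \<theta> + A 2 1 k x) =
      (sin \<theta>)\<^sup>2 * ((1 + XX) * (1 + YY) - XY\<^sup>2)"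
    unfolding A11 A12 A21 A22 by (rule linear_change_det) simp
  also have "(1 + XX) * (1 + YY) - XY\<^sup>2 = (1 + P) * (1 + Q) - RR\<^sup>2"
    by (rule polar_hessian_det[OF _ XX XY YY]) simp
  also have "\<dots> = 1 + (\<Sum>j\<in>{N+1..2*N}. y ^ j * ee j a)"
    unfolding P_def Q_def RR_def by (rule polar_product[OF a])
  finally show ?thesis by (simp add: G_def y distrib_left)
qed

lemma A_zero:
  assumes "x \<in> S"
  shows "A 3 i k x = 0" "A i 3 k x = 0"
proof -
  have hD: "\<forall>x\<in>{-1..2}. (h j has_real_derivative h1 j x) (at x within {-1..2})"
    "\<forall>x\<in>{-1..2}. (h1 j has_real_derivative h2 j x) (at x within {-1..2})" if "j \<in> {1..N}" for j
    using prof that by (auto simp: profiles_def)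
  note H = pol_hessian[OF assms hD]
  show "A 3 i k x = 0" "A i 3 k x = 0"
    unfolding A_def by (rule sum.neutral, rule ballI, simp only: H mult_zero_right)+
qed

definition r :: "3 \<Rightarrow> 3 \<Rightarrow> real \<Rightarrow> real^3 \<Rightarrow> real" where "r i j k x = iter_D [i, j] b3 x"

lemma r_sy: "symb 1 0 1 (r i j)"
  using sy_iter[OF b3, of "[i, j]"] by (simp add: r_def[abs_def])

lemma base_hessian:
  assumes "\<And>x. x \<in> S \<Longrightarrow> ub x = quad (cos \<theta>) x + b3 x" "x \<in> S"
  shows "iter_D [i, j] ub x = quad_hess (cos \<theta>) i j + r i j k x"
    and "ub differentiable at x" and "partial_D i ub differentiable at x"
proof -
  have b: "b3 differentiable at y" "partial_D i b3 differentiable at y" if "y \<in> S" for y i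
    using sy_differentiable[OF b3[unfolded numeral_3_eq_3], of 1 y]
      sy_differentiable[OF sy_partial[OF b3[unfolded numeral_3_eq_3]], of 1 y i] that by auto
  have "iter_D [i, j] ub x = iter_D [i, j] (\<lambda>x. quad (cos \<theta>) x + b3 x) x"
    by (rule iter_D_cong[OF open_S assms])
  also have "\<dots> = quad_hess (cos \<theta>) i j + r i j k x"
    by (subst iter_D2_add[OF open_S assms(2)])
      (simp_all only: b partial_D_quad(4) quad_hessian r_def)
  finally show "iter_D [i, j] ub x = quad_hess (cos \<theta>) i j + r i j k x" .
  show "ub differentiable at x"
    by (rule differentiable_cong_open[OF open_S assms(2), of "\<lambda>x. quad (cos \<theta>) x + b3 x"])
      (auto simp: assms(1) b(1)[OF assms(2)] partial_D_quad(4))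
  show "partial_D i ub differentiable at x"
  proof (rule differentiable_cong_open[OF open_S assms(2), of "\<lambda>x. partial_D i (quad (cos \<theta>)) x + partial_D i b3 x"])
    fix y assume y: "y \<in> S"
    have "partial_D i ub y = partial_D i (\<lambda>x. quad (cos \<theta>) x + b3 x) y"
      by (rule partial_D_cong[OF open_S y assms(1)])
    thus "partial_D i (quad (cos \<theta>)) y + partial_D i b3 y = partial_D i ub y"
      by (simp add: partial_D_add partial_D_quad(4) b[OF y])
  qed (use b[OF assms(2)] quad_hessian(2) in \<open>auto intro: differentiable_add\<close>)
qed

lemma det_difference_sy:
  assumes ub: "\<And>x. x \<in> S \<Longrightarrow> ub x = quad (cos \<theta>) x + b3 x"
  shows "symb 1 1 1 (\<lambda>k x. det (hessian (\<lambda>x. ub x + V k x) x) - det (hessian ub x))"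
proof -
  define m where "m i j = quad_hess (cos \<theta>) i j" for i j
  define f where "f i j k x = m i j + r i j k x + A i j k x + B i j k x" for i j k x
  define g where "g i j k x = m i j + r i j k x + A i j k x" for i j k x
  have m: "symb 1 0 0 (\<lambda>_ _. m i j)" for i j by (rule sy_const) simp
  have r0: "symb 1 0 0 (r i j)" for i j by (rule sy_mono[OF r_sy]) auto
  have A0: "symb 1 0 0 (A i j)" for i j by (rule sy_mono[OF A_sy]) auto
  have B0: "symb 1 0 0 (B i j)" for i j by (rule sy_mono[OF B_sy]) auto
  have "symb 1 1 1 (\<lambda>k x. det3 (\<lambda>i j. f i j k x) - det3 (\<lambda>i j. g i j k x))"
  proof (rule det3_eqv)
    show "symb 1 0 0 (f i j)" "symb 1 0 0 (g i j)" for i j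
      unfolding f_def[abs_def] g_def[abs_def] by (intro sy_add m r0 A0 B0)+
    show "symb 1 1 1 (\<lambda>k x. f i j k x - g i j k x)" for i j
      using B_sy by (simp add: f_def g_def)
  qed
  moreover have "symb 1 1 1 (\<lambda>k x. det3 (\<lambda>i j. g i j k x) - det3 (\<lambda>i j. m i j + r i j k x))"
  proof -
    have rA: "symb 1 1 1 (\<lambda>k x. r i j k x * A i' j' k x)" for i j i' j'
      using sy_mult[OF r_sy A_sy] by simp
    have rAr: "symb 1 1 1 (\<lambda>k x. r i j k x * A i' j' k x * r i'' j'' k x)" for i j i' j' i'' j''
      by (rule ideal_mult(2)[OF r0 rA])
    have 1: "symb 1 0 0 (\<lambda>k x. 1 + r 3 3 k x)"
      by (intro sy_add r0 sy_const) simp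
    \<comment> \<open>\<open>r\<close> contributes a power of the weight and \<open>A\<close> a
      power of the amplitude, so every product containing both is in the ideal. The terms in
      \<open>A\<close> without \<open>r\<close> combine to \<open>G\<close> by
      \<open>A_det\<close>.\<close>
    have "symb 1 1 1 (\<lambda>k x. (1 + r 3 3 k x) * (G k x + r 1 1 k x * A 2 2 k x + r 2 2 k x * A 1 1 k x
        - r 1 2 k x * A 2 1 k x - r 2 1 k x * A 1 2 k x) + r 2 3 k x * A 1 2 k x * r 3 1 k x +
        r 1 3 k x * A 2 1 k x * r 3 2 k x - r 2 3 k x * A 1 1 k x * r 3 2 k x - r 1 3 k x * A 2 2 k x * r 3 1 k x)"
      by (intro sy_diff sy_add ideal_mult(1)[OF 1] rA rAr G_sy)
    thus ?thesis
    proof (rule sy_cong[THEN iffD1, rotated])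
      fix k :: real and x assume k: "0 < k" "k \<le> 1" "x \<in> S"
      have G: "G k x = (1 + A 1 1 k x) * (1 + A 2 2 k x) - (cos \<theta> + A 1 2 k x) * (cos \<theta> + A 2 1 k x) - (1 - cos \<theta> * cos \<theta>)"
        using A_det[OF k] sin_cos_squared_add[of \<theta>] unfolding power2_eq_square by linarith
      have m': "m 1 1 = 1" "m 2 2 = 1" "m 3 3 = 1" "m 1 2 = cos \<theta>" "m 2 1 = cos \<theta>" "m 1 3 = 0" "m 3 1 = 0"
        "m 2 3 = 0" "m 3 2 = 0" by (auto simp: m_def quad_hess_def)
      show "(1 + r 3 3 k x) * (G k x + r 1 1 k x * A 2 2 k x + r 2 2 k x * A 1 1 k x
        - r 1 2 k x * A 2 1 k x - r 2 1 k x * A 1 2 k x) + r 2 3 k x * A 1 2 k x * r 3 1 k x +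
        r 1 3 k x * A 2 1 k x * r 3 2 k x - r 2 3 k x * A 1 1 k x * r 3 2 k x - r 1 3 k x * A 2 2 k x * r 3 1 k x =
        det3 (\<lambda>i j. g i j k x) - det3 (\<lambda>i j. m i j + r i j k x)"
        unfolding g_def det3_def m' A_zero[OF k(3)] G by algebra
    qed
  qed
  ultimately have "symb 1 1 1 (\<lambda>k x. (det3 (\<lambda>i j. f i j k x) - det3 (\<lambda>i j. g i j k x)) +
      (det3 (\<lambda>i j. g i j k x) - det3 (\<lambda>i j. m i j + r i j k x)))" by (rule sy_add)
  thus ?thesis
  proof (rule sy_cong[THEN iffD1, rotated])
    fix k :: real and x assume k: "0 < k" "k \<le> 1" "x \<in> S"
    have V: "V k differentiable at y" "partial_D i (V k) differentiable at y" if "y \<in> S" for y i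
      using sy_differentiable[OF V_sy[unfolded numeral_3_eq_3] k(1,2) that]
        sy_differentiable[OF sy_partial[OF V_sy[unfolded numeral_3_eq_3]] k(1,2) that] by auto
    have "iter_D [i, j] (\<lambda>x. ub x + V k x) x = f i j k x" for i j
      unfolding f_def m_def
      by (subst iter_D2_add[OF open_S k(3)])
        (simp_all only: base_hessian[OF ub] V V_hessian[OF k] base_hessian(1)[where k = k, OF ub k(3)] add.assoc)
    thus "det3 (\<lambda>i j. f i j k x) - det3 (\<lambda>i j. g i j k x) +
      (det3 (\<lambda>i j. g i j k x) - det3 (\<lambda>i j. m i j + r i j k x)) =
      det (hessian (\<lambda>x. ub x + V k x) x) - det (hessian ub x)"
      by (simp add: det_hessian base_hessian(1)[where k = k, OF ub k(3)] m_def del: iter_D.simps)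
  qed
qed

text \<open>The leading term of \<open>V\<close> is a multiple of the imaginary part of z^(2 +
  gamma) in the wedge coordinate z, and its second X-derivative is (2 + gamma)(1 + gamma) times that
  of z^gamma. Later terms are of order r^(2 gamma), and \<open>B\<close> is of order r.\<close>

lemma V_11_expansion:
  "symb 1 1 (min (2 * \<gamma>) 1) (\<lambda>k x. iter_D [1, 1] (V k) x -
     K k x * pol \<theta> \<gamma> (\<lambda>a. (2 + \<gamma>) * (1 + \<gamma>) * sin (\<gamma> * a)) x)"
proof -
  have "symb 1 1 (min (2 * \<gamma>) 1) (\<lambda>k x. (\<Sum>j\<in>{2..N}. K k x ^ j * iter_D [1, 1] (W j) x) + B 1 1 k x)"
  proof (intro sy_add sy_sum)
    fix j assume j: "j \<in> {2..N}"
    have "symb 1 (1 + 0) (0 + (d j - 2)) (\<lambda>k x. K k x ^ j * iter_D [1, 1] (W j) x)"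
      using sy_mult[OF sy_le[OF _ K_power] W_D(2)] j by auto
    moreover have "2 * \<gamma> \<le> real j * \<gamma>" using j gamma by (intro mult_right_mono) auto
    ultimately show "symb 1 1 (min (2 * \<gamma>) 1) (\<lambda>k x. K k x ^ j * iter_D [1, 1] (W j) x)"
      by - (erule sy_mono, simp_all del: sy.simps iter_D.simps)
  qed (rule sy_mono[OF B_sy], auto)
  thus ?thesis
  proof (rule sy_cong[THEN iffD1, rotated])
    fix k :: real and x assume k: "0 < k" "k \<le> 1" "x \<in> S"
    have "{1..N} = insert 1 {2..N}" using N by auto
    hence "A 1 1 k x = K k x ^ 1 * iter_D [1, 1] (W 1) x + (\<Sum>j\<in>{2..N}. K k x ^ j * iter_D [1, 1] (W j) x)"
      unfolding A_def by (simp del: iter_D.simps)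
    moreover have "iter_D [1, 1] (W 1) x = pol \<theta> \<gamma> (\<lambda>a. (2 + \<gamma>) * (1 + \<gamma>) * sin (\<gamma> * a)) x"
    proof -
      have h1: "h 1 = (\<lambda>a. sin (d 1 * a))" "h1 1 = (\<lambda>a. d 1 * cos (d 1 * a))" "h2 1 = (\<lambda>a. - (d 1)\<^sup>2 * sin (d 1 * a))"
        using prof N by (auto simp: profiles_def)
      have "\<forall>x\<in>{-1..2}. (h 1 has_real_derivative h1 1 x) (at x within {-1..2})"
        "\<forall>x\<in>{-1..2}. (h1 1 has_real_derivative h2 1 x) (at x within {-1..2})"
        unfolding h1 by (auto intro!: derivative_eq_intros simp: power2_eq_square)
      from pol_hessian(1)[OF k(3) this, of "d 1"]
      have "iter_D [1, 1] (W 1) x = pol \<theta> \<gamma> (pXX (d 1) (h 1) (h1 1) (h2 1)) x" by (simp del: iter_D.simps)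
      moreover have "pXX (d 1) (h 1) (h1 1) (h2 1) = (\<lambda>a. (2 + \<gamma>) * (1 + \<gamma>) * sin (\<gamma> * a))"
      proof (rule ext)
        fix a
        have s: "sin (\<gamma> * a) = sin (d 1 * a) * (cos a * cos a - sin a * sin a) - cos (d 1 * a) * (2 * sin a * cos a)"
        proof -
          have "sin (\<gamma> * a) = sin (d 1 * a - 2 * a)" by (simp add: algebra_simps)
          also have "\<dots> = sin (d 1 * a) * cos (2 * a) - cos (d 1 * a) * sin (2 * a)" by (rule sin_diff)
          finally show ?thesis by (simp only: cos_double sin_double power2_eq_square)
        qed
        have d1: "d 1 = 2 + \<gamma>" by simp
        show "pXX (d 1) (h 1) (h1 1) (h2 1) a = (2 + \<gamma>) * (1 + \<gamma>) * sin (\<gamma> * a)"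
          unfolding s h1 pXX_def unfolding d1 by algebra
      qed
      ultimately show ?thesis by simp
    qed
    ultimately show "(\<Sum>j\<in>{2..N}. K k x ^ j * iter_D [1, 1] (W j) x) + B 1 1 k x = iter_D [1, 1] (V k) x -
        K k x * pol \<theta> \<gamma> (\<lambda>a. (2 + \<gamma>) * (1 + \<gamma>) * sin (\<gamma> * a)) x"
      unfolding V_hessian[OF k] by (simp del: iter_D.simps)
  qed
qed

end

section \<open>The tetrahedron\<close>

definition face3 :: "real^3 \<Rightarrow> real" where "face3 x = 10 - x $ 3"
definition face4 :: "real^3 \<Rightarrow> real" where "face4 x = x $ 3 - 2 * (x $ 1 + x $ 2)"

lemma Omega_iff: "x \<in> Omega \<longleftrightarrow> 0 < x $ 1 \<and> 0 < x $ 2 \<and> 0 < face3 x \<and> 0 < face4 x"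
  by (auto simp: Omega_def face3_def face4_def)

definition tetra :: "(real^3) set" where
  "tetra = {x. 0 \<le> x $ 1 \<and> 0 \<le> x $ 2 \<and> 0 \<le> face3 x \<and> 0 \<le> face4 x}"

lemma open_Omega: "open Omega"
proof -
  have "Omega = {x. 0 < x $ 1} \<inter> {x. 0 < x $ 2} \<inter> {x. x $ 3 < 10} \<inter> {x. 2 * (x $ 1 + x $ 2) < x $ 3}"
    by (auto simp: Omega_def)
  moreover have "open \<dots>" by (intro open_Int open_Collect_less continuous_intros)
  ultimately show ?thesis by simp
qed

lemma closed_tetra: "closed tetra"
proof -
  have "tetra = {x. 0 \<le> x $ 1} \<inter> {x. 0 \<le> x $ 2} \<inter> {x. x $ 3 \<le> 10} \<inter> {x. 2 * (x $ 1 + x $ 2) \<le> x $ 3}"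
    by (auto simp: tetra_def face3_def face4_def)
  moreover have "closed \<dots>" by (intro closed_Int closed_Collect_le continuous_intros)
  ultimately show ?thesis by simp
qed

lemma convex_comb_pos:
  fixes a b u v :: real
  assumes "0 < a" "0 \<le> b" "0 < u" "0 \<le> v"
  shows "0 < u * a + v * b"
  using assms by (simp add: add_pos_nonneg)

lemma tetra_Omega_comb:
  assumes "x \<in> Omega" "y \<in> tetra" "0 < u" "0 \<le> v" "u + v = 1"
  shows "u *\<^sub>R x + v *\<^sub>R y \<in> Omega"
proof -
  have "face3 (u *\<^sub>R x + v *\<^sub>R y) = (u + v) * 10 - (u * x $ 3 + v * y $ 3)"
    using assms(5) by (simp add: face3_def)
  hence "face3 (u *\<^sub>R x + v *\<^sub>R y) = u * face3 x + v * face3 y" by (simp add: face3_def algebra_simps)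
  moreover have "face4 (u *\<^sub>R x + v *\<^sub>R y) = u * face4 x + v * face4 y"
    by (simp add: face4_def algebra_simps)
  ultimately show ?thesis using assms unfolding Omega_iff tetra_def by (auto intro!: convex_comb_pos)
qed

lemma Omega_subset_tetra: "Omega \<subseteq> tetra"
  by (auto simp: Omega_iff tetra_def)

lemma convex_Omega: "convex Omega"
proof (rule convexI)
  fix x y :: "real^3" and u v :: real
  assume *: "x \<in> Omega" "y \<in> Omega" "0 \<le> u" "0 \<le> v" "u + v = 1"
  show "u *\<^sub>R x + v *\<^sub>R y \<in> Omega"
  proof (cases "u = 0")
    case True
    thus ?thesis using * by simp
  next
    case False
    thus ?thesis using * tetra_Omega_comb Omega_subset_tetra by auto
  qed
qed

lemma Omega_witness: "vector [1, 1, 9] \<in> Omega"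
  by (simp add: Omega_def vector_3)

lemma closure_Omega: "closure Omega = tetra"
proof
  show "closure Omega \<subseteq> tetra" using closed_tetra Omega_subset_tetra by (rule closure_minimal[rotated])
  show "tetra \<subseteq> closure Omega"
  proof
    fix y assume y: "y \<in> tetra"
    define z :: "real^3" where "z = vector [1, 1, 9]"
    define f where "f n = inverse (real (Suc n)) *\<^sub>R z + (1 - inverse (real (Suc n))) *\<^sub>R y" for n
    have "f n \<in> Omega" for n unfolding f_def
      by (rule tetra_Omega_comb[OF _ y]) (auto simp: z_def Omega_witness inverse_le_1_iff)
    moreover have "f \<longlonglongrightarrow> 0 *\<^sub>R z + (1 - 0) *\<^sub>R y"
      unfolding f_def by (intro tendsto_intros LIMSEQ_inverse_real_of_nat)
    ultimately show "y \<in> closure Omega" unfolding closure_sequential by auto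
  qed
qed

lemma frontier_Omega: "frontier Omega = tetra - Omega"
  by (simp add: frontier_def closure_Omega interior_open[OF open_Omega])

lemma tetra_bounds:
  assumes "x \<in> tetra"
  shows "0 \<le> x $ 1" "x $ 1 \<le> 5" "0 \<le> x $ 2" "x $ 2 \<le> 5" "0 \<le> x $ 3" "x $ 3 \<le> 10"
  using assms by (auto simp: tetra_def face3_def face4_def)

lemma bounded_tetra: "bounded tetra"
proof -
  have "tetra \<subseteq> cbox (vector [0,0,0]) (vector [5,5,10])"
    by (auto simp: mem_box_cart forall_3 tetra_bounds)
  thus ?thesis by (rule bounded_subset[OF bounded_cbox])
qed

lemma compact_tetra: "compact tetra"
  using closed_tetra bounded_tetra compact_eq_bounded_closed by blast

section \<open>Points on the open edges\<close>

lemma edge_no_two_directions: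
  fixes P :: "(real^3) set"
  assumes "e face_of P" "aff_dim e = 1" "x \<in> e" "0 < t"
    and "x + t *\<^sub>R v \<in> P" "x - t *\<^sub>R v \<in> P" "x + t *\<^sub>R w \<in> P" "x - t *\<^sub>R w \<in> P" "v \<noteq> 0" "w \<noteq> 0"
  shows "\<exists>c. w = c *\<^sub>R v"
proof -
  have in_e: "x + t *\<^sub>R v \<in> e" if "x + t *\<^sub>R v \<in> P" "x - t *\<^sub>R v \<in> P" "v \<noteq> 0" for v
  proof -
    have "x = midpoint (x - t *\<^sub>R v) (x + t *\<^sub>R v)" by (simp add: midpoint_def scaleR_2[symmetric])
    moreover have "x - t *\<^sub>R v \<noteq> x + t *\<^sub>R v"
    proof
      assume eq: "x - t *\<^sub>R v = x + t *\<^sub>R v"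
      have "t * v $ i = 0" for i using arg_cong[OF eq, of "\<lambda>z. z $ i"] by simp
      hence "v $ i = 0" for i using assms(4) by simp
      thus False using that(3) by (simp add: vec_eq_iff)
    qed
    ultimately have "x \<in> open_segment (x - t *\<^sub>R v) (x + t *\<^sub>R v)" by (metis midpoint_in_open_segment)
    thus ?thesis using assms(1,3) that face_ofD by blast
  qed
  \<comment> \<open>A face that contains the midpoint of a segment contains the segment; independent
    directions would put three non-collinear points into a face of dimension 1.\<close>
  have "{x, x + t *\<^sub>R v, x + t *\<^sub>R w} \<subseteq> e" using in_e assms by auto
  moreover have "collinear e" using assms(2) by (simp add: collinear_aff_dim)
  ultimately have "collinear {x, x + t *\<^sub>R v, x + t *\<^sub>R w}" by (rule collinear_subset[rotated])
  hence "collinear {x + t *\<^sub>R v, x, x + t *\<^sub>R w}" by (simp add: insert_commute)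
  hence "collinear {0, t *\<^sub>R v, t *\<^sub>R w}"
    using collinear_3[of "x + t *\<^sub>R v" x "x + t *\<^sub>R w"] by (simp add: NO_MATCH_def)
  then obtain c where "t *\<^sub>R w = c *\<^sub>R (t *\<^sub>R v)"
    unfolding collinear_lemma using assms by auto
  hence "w = c *\<^sub>R v" using assms(4) by (metis scaleR_left_commute scaleR_left_imp_eq less_irrefl)
  thus ?thesis by blast
qed

lemma zero_comb:
  fixes a b u :: real
  assumes "(1 - u) * a + u * b = 0" "0 < u" "u < 1" "0 \<le> a" "0 \<le> b"
  shows "a = 0 \<and> b = 0"
proof -
  have "0 \<le> (1 - u) * a" "0 \<le> u * b" using assms by auto
  hence "(1 - u) * a = 0" "u * b = 0" using assms(1) by linarith+
  thus ?thesis using assms by auto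
qed

text \<open>Constraints active at an interior point of a segment are active at both ends, so a point
  determined by its active constraints lies inside no segment.\<close>

lemma tetra_extreme:
  assumes x: "x \<in> tetra"
    and unique: "\<And>y. y \<in> tetra \<Longrightarrow> (x $ 1 = 0 \<longrightarrow> y $ 1 = 0) \<Longrightarrow> (x $ 2 = 0 \<longrightarrow> y $ 2 = 0) \<Longrightarrow>
        (face3 x = 0 \<longrightarrow> face3 y = 0) \<Longrightarrow> (face4 x = 0 \<longrightarrow> face4 y = 0) \<Longrightarrow> y = x"
  shows "x extreme_point_of tetra"
  unfolding extreme_point_of_def
proof (intro conjI ballI notI x)
  fix a b assume ab: "a \<in> tetra" "b \<in> tetra" "x \<in> open_segment a b"
  then obtain u where u: "0 < u" "u < 1" "x = (1 - u) *\<^sub>R a + u *\<^sub>R b" "a \<noteq> b"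
    by (auto simp: in_segment)
  have c: "x $ i = (1 - u) * a $ i + u * b $ i" for i using u by simp
  have f3: "face3 x = (1 - u) * face3 a + u * face3 b" by (simp add: face3_def c algebra_simps)
  have f4: "face4 x = (1 - u) * face4 a + u * face4 b" by (simp add: face4_def c algebra_simps)
  have z: "x $ 1 = 0 \<Longrightarrow> a $ 1 = 0 \<and> b $ 1 = 0" "x $ 2 = 0 \<Longrightarrow> a $ 2 = 0 \<and> b $ 2 = 0"
    "face3 x = 0 \<Longrightarrow> face3 a = 0 \<and> face3 b = 0" "face4 x = 0 \<Longrightarrow> face4 a = 0 \<and> face4 b = 0"
    using zero_comb[OF _ u(1,2), of "a $ 1" "b $ 1"] zero_comb[OF _ u(1,2), of "a $ 2" "b $ 2"]
      zero_comb[OF _ u(1,2), of "face3 a" "face3 b"] zero_comb[OF _ u(1,2), of "face4 a" "face4 b"]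
      c[of 1] c[of 2] f3 f4 ab by (simp_all add: tetra_def)
  have "a = x" by (rule unique[OF ab(1)]) (use z in simp_all)
  moreover have "b = x" by (rule unique[OF ab(2)]) (use z in simp_all)
  ultimately show False using u(4) by simp
qed

text \<open>If at most one constraint were active, two independent directions tangent to that face
  would stay in the polytope, against \<open>edge_no_two_directions\<close>.\<close>

lemma edge_two_active:
  assumes e: "e face_of tetra" "aff_dim e = 1" "x \<in> e"
  shows "\<not> (0 < x $ 2 \<and> 0 < face3 x \<and> 0 < face4 x)" "\<not> (0 < x $ 1 \<and> 0 < face3 x \<and> 0 < face4 x)"
    "\<not> (0 < x $ 1 \<and> 0 < x $ 2 \<and> 0 < face4 x)" "\<not> (0 < x $ 1 \<and> 0 < x $ 2 \<and> 0 < face3 x)"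
proof -
  have x: "x \<in> tetra" using e face_of_imp_subset by blast
  note defs = tetra_def face3_def face4_def vector_3
  note no = edge_no_two_directions[OF e]
  show "\<not> (0 < x $ 2 \<and> 0 < face3 x \<and> 0 < face4 x)"
  proof
    assume a: "0 < x $ 2 \<and> 0 < face3 x \<and> 0 < face4 x"
    \<comment> \<open>A tenth of the smallest slack is enough: no constraint changes faster than at
      rate 2 along the directions used.\<close>
    define t where "t = min (x $ 2) (min (face3 x) (face4 x)) / 10"
    have t: "0 < t" "10 * t \<le> x $ 2" "10 * t \<le> face3 x" "10 * t \<le> face4 x" using a by (auto simp: t_def)
    have "\<exists>c. (vector [0,0,1] :: real^3) = c *\<^sub>R vector [0,1,0]"
      by (rule no[OF t(1)]) (use t x in \<open>auto simp: defs vec_eq_iff forall_3\<close>)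
    thus False by (auto simp: vec_eq_iff forall_3)
  qed
  show "\<not> (0 < x $ 1 \<and> 0 < face3 x \<and> 0 < face4 x)"
  proof
    assume a: "0 < x $ 1 \<and> 0 < face3 x \<and> 0 < face4 x"
    define t where "t = min (x $ 1) (min (face3 x) (face4 x)) / 10"
    have t: "0 < t" "10 * t \<le> x $ 1" "10 * t \<le> face3 x" "10 * t \<le> face4 x" using a by (auto simp: t_def)
    have "\<exists>c. (vector [0,0,1] :: real^3) = c *\<^sub>R vector [1,0,0]"
      by (rule no[OF t(1)]) (use t x in \<open>auto simp: defs vec_eq_iff forall_3\<close>)
    thus False by (auto simp: vec_eq_iff forall_3)
  qed
  show "\<not> (0 < x $ 1 \<and> 0 < x $ 2 \<and> 0 < face4 x)"
  proof
    assume a: "0 < x $ 1 \<and> 0 < x $ 2 \<and> 0 < face4 x"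
    define t where "t = min (x $ 1) (min (x $ 2) (face4 x)) / 10"
    have t: "0 < t" "10 * t \<le> x $ 1" "10 * t \<le> x $ 2" "10 * t \<le> face4 x" using a by (auto simp: t_def)
    have "\<exists>c. (vector [0,1,0] :: real^3) = c *\<^sub>R vector [1,0,0]"
      by (rule no[OF t(1)]) (use t x in \<open>auto simp: defs vec_eq_iff forall_3\<close>)
    thus False by (auto simp: vec_eq_iff forall_3)
  qed
  show "\<not> (0 < x $ 1 \<and> 0 < x $ 2 \<and> 0 < face3 x)"
  proof
    assume a: "0 < x $ 1 \<and> 0 < x $ 2 \<and> 0 < face3 x"
    define t where "t = min (x $ 1) (min (x $ 2) (face3 x)) / 10"
    have t: "0 < t" "10 * t \<le> x $ 1" "10 * t \<le> x $ 2" "10 * t \<le> face3 x" using a by (auto simp: t_def)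
    \<comment> \<open>Both directions are tangent to the slanted face, whose constraint may be
      active here.\<close>
    have "\<exists>c. (vector [1,0,2] :: real^3) = c *\<^sub>R vector [1,-1,0]"
      by (rule no[OF t(1)]) (use t x in \<open>auto simp: defs vec_eq_iff forall_3\<close>)
    thus False by (auto simp: vec_eq_iff forall_3)
  qed
qed

text \<open>Exactly two constraints are active: \<open>edge_two_active\<close> excludes fewer, and
  any three determine a vertex, which is an extreme point.\<close>

lemma open_edge_cases:
  assumes "x \<in> Gamma1 Omega - Gamma0 Omega"
  obtains (e12) "x $ 1 = 0" "x $ 2 = 0" "0 < x $ 3" "x $ 3 < 10"
    | (e13) "x $ 1 = 0" "x $ 3 = 10" "0 < x $ 2" "x $ 2 < 5"
    | (e23) "x $ 2 = 0" "x $ 3 = 10" "0 < x $ 1" "x $ 1 < 5"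
    | (e14) "x $ 1 = 0" "x $ 3 = 2 * x $ 2" "0 < x $ 2" "x $ 2 < 5"
    | (e24) "x $ 2 = 0" "x $ 3 = 2 * x $ 1" "0 < x $ 1" "x $ 1 < 5"
    | (e34) "x $ 3 = 10" "x $ 1 + x $ 2 = 5" "0 < x $ 1" "0 < x $ 2"
proof -
  obtain e where e: "e face_of tetra" "aff_dim e = 1" "x \<in> e" and ne: "\<not> x extreme_point_of tetra"
    using assms by (auto simp: Gamma1_def Gamma0_def closure_Omega edge_of_def)
  have x: "x \<in> tetra" using e face_of_imp_subset by blast
  note two = edge_two_active[OF e]
  have n1: "\<not> (x $ 1 = 0 \<and> x $ 2 = 0 \<and> face3 x = 0)"
    using ne tetra_extreme[OF x] by (auto simp: vec_eq_iff forall_3 face3_def)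
  have n2: "\<not> (x $ 1 = 0 \<and> x $ 2 = 0 \<and> face4 x = 0)"
    using ne tetra_extreme[OF x] by (auto simp: vec_eq_iff forall_3 face4_def)
  have n3: "\<not> (x $ 1 = 0 \<and> face3 x = 0 \<and> face4 x = 0)"
    using ne tetra_extreme[OF x] by (auto simp: vec_eq_iff forall_3 face3_def face4_def)
  have n4: "\<not> (x $ 2 = 0 \<and> face3 x = 0 \<and> face4 x = 0)"
    using ne tetra_extreme[OF x] by (auto simp: vec_eq_iff forall_3 face3_def face4_def)
  have "0 \<le> x $ 1" "0 \<le> x $ 2" "0 \<le> face3 x" "0 \<le> face4 x" using x by (auto simp: tetra_def)
  with two n1 n2 n3 n4
  consider "x $ 1 = 0" "x $ 2 = 0" "0 < face3 x" "0 < face4 x" | "x $ 1 = 0" "face3 x = 0" "0 < x $ 2" "0 < face4 x"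
    | "x $ 2 = 0" "face3 x = 0" "0 < x $ 1" "0 < face4 x" | "x $ 1 = 0" "face4 x = 0" "0 < x $ 2" "0 < face3 x"
    | "x $ 2 = 0" "face4 x = 0" "0 < x $ 1" "0 < face3 x" | "face3 x = 0" "face4 x = 0" "0 < x $ 1" "0 < x $ 2"
    by (smt (verit))
  thus ?thesis
  proof cases
    case 1 thus ?thesis using e12 by (simp add: face3_def face4_def)
  next
    case 2 thus ?thesis using e13 by (simp add: face3_def face4_def)
  next
    case 3 thus ?thesis using e23 by (simp add: face3_def face4_def)
  next
    case 4 thus ?thesis using e14 by (simp add: face3_def face4_def)
  next
    case 5 thus ?thesis using e24 by (simp add: face3_def face4_def)
  next
    case 6 thus ?thesis using e34 by (simp add: face3_def face4_def)
  qed
qed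

section \<open>The base perturbation\<close>

text \<open>A profile that is positive, flat at 0, and constant on a sequence of intervals tending to 0.\<close>

definition gfun :: "real \<Rightarrow> real" where "gfun s = s ^ 6 * max 0 (sin (inverse s)) ^ 3"
definition cfun :: "real \<Rightarrow> real" where "cfun t = integral {0..t} gfun"

lemma gfun_bounds: "0 \<le> s \<Longrightarrow> 0 \<le> gfun s" "0 \<le> s \<Longrightarrow> gfun s \<le> s ^ 6"
proof -
  have "max 0 (sin (inverse s)) ^ 3 \<le> 1" by (rule power_le_one) auto
  thus "0 \<le> s \<Longrightarrow> 0 \<le> gfun s" "0 \<le> s \<Longrightarrow> gfun s \<le> s ^ 6"
    by (auto simp: gfun_def intro: mult_left_le)
qed

lemma continuous_gfun: "continuous_on {0..11} gfun"
proof -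
  have "continuous (at x within {0..11}) gfun" if x: "x \<in> {0..11}" for x
  proof (cases "x = 0")
    case True
    have "(gfun \<longlongrightarrow> 0) (at 0 within {0..11})"
    proof (rule Lim_null_comparison[where g = "\<lambda>s. s ^ 6"])
      show "\<forall>\<^sub>F s in at 0 within {0..11}. norm (gfun s) \<le> s ^ 6"
        using gfun_bounds by (auto simp: eventually_at_filter)
      show "((\<lambda>s. s ^ 6) \<longlongrightarrow> (0::real)) (at 0 within {0..11})"
        by (rule tendsto_eq_intros | simp)+
    qed
    thus ?thesis using True by (simp add: continuous_within gfun_def)
  next
    case False
    thus ?thesis unfolding gfun_def[abs_def] by (intro continuous_intros) auto
  qed
  thus ?thesis using continuous_on_eq_continuous_within by blast
qed

lemma cfun_derivative_within: "t \<in> {0..11} \<Longrightarrow> (cfun has_real_derivative gfun t) (at t within {0..11})"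
  using integral_has_vector_derivative[OF continuous_gfun]
  unfolding cfun_def[abs_def] has_real_derivative_iff_has_vector_derivative by blast

lemma cfun_derivative: "0 < t \<Longrightarrow> t < 11 \<Longrightarrow> (cfun has_real_derivative gfun t) (at t)"
  using cfun_derivative_within[of t] at_within_Icc_at[of 0 t 11] by simp

lemma cfun_0: "cfun 0 = 0" by (simp add: cfun_def)

lemma continuous_cfun: "continuous_on {0..11} cfun"
  using cfun_derivative_within by (rule DERIV_continuous_on)

lemma cfun_mvt:
  assumes "0 \<le> s" "s < t" "t < 11"
  obtains z where "s < z" "z < t" "cfun t - cfun s = gfun z * (t - s)"
proof (rule mvt[OF assms(2), of cfun "\<lambda>z h. gfun z * h"])
  show "continuous_on {s..t} cfun" by (rule continuous_on_subset[OF continuous_cfun]) (use assms in auto)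
  show "(cfun has_derivative (\<lambda>h. gfun x * h)) (at x)" if "s < x" "x < t" for x
    using cfun_derivative[of x] that assms unfolding has_field_derivative_def by simp
qed (use that in blast)

lemma cfun_mono: "0 \<le> s \<Longrightarrow> s \<le> t \<Longrightarrow> t < 11 \<Longrightarrow> cfun s \<le> cfun t"
proof (cases "s = t")
  case False
  assume a: "0 \<le> s" "s \<le> t" "t < 11"
  then obtain z where "s < z" "z < t" "cfun t - cfun s = gfun z * (t - s)"
    using cfun_mvt[of s t] False by auto
  moreover have "0 \<le> gfun z * (t - s)" using gfun_bounds(1)[of z] calculation a by simp
  ultimately show ?thesis by linarith
qed simp

lemma cfun_le: "0 < t \<Longrightarrow> t < 11 \<Longrightarrow> cfun t \<le> t ^ 7"
proof -
  assume t: "0 < t" "t < 11"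
  then obtain z where z: "0 < z" "z < t" "cfun t - cfun 0 = gfun z * (t - 0)"
    using cfun_mvt[of 0 t] by auto
  have "gfun z \<le> z ^ 6" using gfun_bounds(2) z by simp
  also have "\<dots> \<le> t ^ 6" using z by (intro power_mono) auto
  finally have "gfun z * t \<le> t ^ 6 * t" using t by (intro mult_right_mono) auto
  thus ?thesis using z(3) by (simp add: cfun_0 power_numeral_reduce mult_ac)
qed

lemma gfun_pos_small:
  assumes "0 < t"
  obtains z where "0 < z" "z < t" "0 < gfun z"
proof -
  obtain n :: nat where n: "inverse t < real n" using reals_Archimedean2 by blast
  define z where "z = inverse (pi / 2 + 2 * real n * pi)"
  have pz: "0 < pi / 2 + 2 * real n * pi" by (simp add: add_pos_nonneg)
  have "real n * 1 \<le> real n * (2 * pi)" using pi_gt3 by (intro mult_left_mono) auto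
  moreover have "real n * (2 * pi) = 2 * real n * pi" by simp
  ultimately have "inverse t < pi / 2 + 2 * real n * pi" using n pi_gt_zero by linarith
  hence "z < t" unfolding z_def using assms pz by (metis inverse_inverse_eq inverse_positive_iff_positive less_imp_inverse_less)
  moreover have "sin (inverse z) = 1"
    by (simp add: z_def sin_add)
  moreover have "0 < z" using pz by (simp add: z_def)
  ultimately show ?thesis using that by (simp add: gfun_def)
qed

text \<open>\<open>cfun\<close> is nondecreasing, and \<open>gfun\<close> is positive at points
  arbitrarily close to 0, so \<open>cfun\<close> cannot vanish on an initial interval.\<close>

lemma cfun_pos: "0 < t \<Longrightarrow> t < 11 \<Longrightarrow> 0 < cfun t"
proof (rule ccontr)
  assume t: "0 < t" "t < 11" "\<not> 0 < cfun t"
  obtain z where z: "0 < z" "z < t" "0 < gfun z" using gfun_pos_small t by blast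
  have "cfun s = 0" if "s \<in> {0<..<t}" for s
    using cfun_mono[of 0 s] cfun_mono[of s t] that t cfun_0 by auto
  hence "(cfun has_real_derivative 0) (at z)"
    using has_field_derivative_transform_within_open[OF DERIV_const[of 0 "at z"], of "{0<..<t}" cfun] z by auto
  moreover have "(cfun has_real_derivative gfun z) (at z)" using z t by (intro cfun_derivative) auto
  ultimately have "gfun z = 0" using DERIV_unique by blast
  thus False using z by simp
qed

text \<open>On these intervals sin(1/t) is negative, hence \<open>gfun\<close> vanishes and
  \<open>cfun\<close> is constant. \<open>tk k\<close> is the midpoint in the variable 1/t.\<close>

definition slab :: "nat \<Rightarrow> real set" where
  "slab k = {t. 0 < t \<and> (2 * real k + 1) * pi < inverse t \<and> inverse t < (2 * real k + 2) * pi}"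
definition tk :: "nat \<Rightarrow> real" where "tk k = inverse ((2 * real k + 3/2) * pi)"

lemma slab_interval: "slab k = {inverse ((2 * real k + 2) * pi)<..<inverse ((2 * real k + 1) * pi)}"
proof -
  have *: "{t. 0 < t \<and> a < inverse t \<and> inverse t < b} = {inverse b<..<inverse a}" if "0 < a" "0 < b" for a b :: real
  proof -
    have "a < inverse t \<longleftrightarrow> t < inverse a" "inverse t < b \<longleftrightarrow> inverse b < t" if "0 < t" for t
      using that \<open>0 < a\<close> \<open>0 < b\<close> by (simp_all add: field_simps)
    moreover have "0 < t" if "inverse b < t" for t using that \<open>0 < b\<close> by (meson less_trans positive_imp_inverse_positive)
    ultimately show ?thesis by auto
  qed
  show ?thesis unfolding slab_def by (rule *) (auto intro!: mult_pos_pos)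
qed

lemma open_slab: "open (slab k)" by (simp add: slab_interval)

lemma tk_slab: "tk k \<in> slab k"
  unfolding slab_def tk_def by (auto intro!: mult_pos_pos mult_strict_right_mono)

lemma slab_bounds: assumes "t \<in> slab k" shows "0 < t" "t < 1"
proof -
  show "0 < t" using assms by (simp add: slab_def)
  have "1 < (2 * real k + 1) * pi" using pi_gt3 by (smt (verit) mult_left_le_one_le of_nat_0_le_iff mult_less_cancel_right2)
  hence "1 < inverse t" using assms by (auto simp: slab_def)
  thus "t < 1" using \<open>0 < t\<close> by (simp add: field_simps)
qed

lemma slab_disjoint: assumes "t \<in> slab k" "t \<in> slab l" shows "k = l"
proof (rule ccontr)
  assume "k \<noteq> l"
  have *: False if "t \<in> slab k" "t \<in> slab l" "k < l" for k l
  proof -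
    have "(2 * real k + 2) * pi \<le> (2 * real l + 1) * pi" using that(3) by (intro mult_right_mono) auto
    moreover have "(2 * real l + 1) * pi < inverse t" "inverse t < (2 * real k + 2) * pi"
      using that by (simp_all add: slab_def)
    ultimately show False by linarith
  qed
  show False using *[of k l] *[of l k] assms \<open>k \<noteq> l\<close> by linarith
qed

lemma cfun_slab: "t \<in> slab k \<Longrightarrow> cfun t = cfun (tk k)"
proof -
  have g: "gfun s = 0" if s: "s \<in> slab k" for s
  proof -
    have "sin (u + 2 * real k * pi) = sin u" for u by (simp add: sin_add)
    from this[of "inverse s - 2 * real k * pi"]
    have "sin (inverse s) = sin (inverse s - 2 * real k * pi)" by simp
    also have "\<dots> \<le> 0" by (rule sin_le_zero) (use s in \<open>auto simp: slab_def algebra_simps\<close>)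
    finally show ?thesis by (simp add: gfun_def)
  qed
  have d: "(cfun has_real_derivative 0) (at s)" if "s \<in> slab k" for s
    using cfun_derivative[of s] slab_bounds[OF that] g[OF that] by simp
  show "t \<in> slab k \<Longrightarrow> cfun t = cfun (tk k)"
    using d tk_slab[of k] unfolding slab_interval
    by (intro DERIV_isconst3[of "inverse ((2 * real k + 2) * pi)" "inverse ((2 * real k + 1) * pi)"]) auto
qed

text \<open>On the vertical edge the other two face functions are 10 - t and t, so their product
  with \<open>qfun t\<close> is \<open>cfun t\<close> for t at most 1. The positive part, absent
  there, keeps the denominator away from 0 up to and beyond the apex.\<close>

definition qfun :: "real \<Rightarrow> real" where
  "qfun t = cfun t * inverse t * inverse (10 - t + max 0 (t - 1) ^ 4)"

lemma denominator_ge: "0 \<le> t \<Longrightarrow> 8 \<le> 10 - t + max 0 (t - 1) ^ 4" for t :: real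
proof (cases "t \<le> 2")
  case False
  have "1 ^ 3 \<le> (t - 1) ^ 3" using False by (intro power_mono) auto
  hence "(t - 1) * 1 \<le> (t - 1) * (t - 1) ^ 3" using False by (intro mult_left_mono) auto
  moreover have "(t - 1) ^ 4 = (t - 1) * (t - 1) ^ 3" by (simp add: power_numeral_reduce)
  ultimately have "t - 1 \<le> (t - 1) ^ 4" by (simp only: mult_1_right)
  moreover have "max 0 (t - 1) = t - 1" using False by simp
  ultimately show ?thesis by simp
next
  case True
  moreover have "0 \<le> max 0 (t - 1) ^ 4" by simp
  ultimately show ?thesis by linarith
qed

lemma qfun_pos: "0 < t \<Longrightarrow> t < 11 \<Longrightarrow> 0 < qfun t"
  using cfun_pos[of t] denominator_ge[of t] unfolding qfun_def by (intro mult_pos_pos) auto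

text \<open>An open neighbourhood of the closed polytope without the origin, so that Hessians at
  edge points can be computed. The origin itself is handled by the flatness of
  \<open>cfun\<close>.\<close>

definition box3 :: "(real^3) set" where "box3 = {x. \<bar>x $ 1\<bar> < 11 \<and> \<bar>x $ 2\<bar> < 11 \<and> 0 < x $ 3 \<and> x $ 3 < 11}"

lemma open_box3: "open box3"
proof -
  have "box3 = {x. \<bar>x $ 1\<bar> < 11} \<inter> {x. \<bar>x $ 2\<bar> < 11} \<inter> {x. 0 < x $ 3} \<inter> {x. x $ 3 < 11}"
    by (auto simp: box3_def)
  moreover have "open \<dots>" by (intro open_Int open_Collect_less continuous_intros)
  ultimately show ?thesis by simp
qed

lemma tetra_box3: "x \<in> tetra \<Longrightarrow> 0 < x $ 3 \<Longrightarrow> x \<in> box3"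
  using tetra_bounds[of x] by (auto simp: box3_def)

lemma Omega_box3: "Omega \<subseteq> box3"
  using tetra_box3 Omega_subset_tetra by (auto simp: Omega_def subset_iff)

lemma partial_D_third:
  assumes "(F has_real_derivative F') (at (x $ 3))"
  shows "partial_D i (\<lambda>x. F (x $ 3)) (x :: real^3) = F' * (if i = 3 then 1 else 0)" "(\<lambda>x. F (x $ 3)) differentiable at x"
  using partial_D_chain[of F F' "\<lambda>x. x $ 3" x] assms by auto

lemma box3_nz: "x \<in> box3 \<Longrightarrow> x $ 3 \<noteq> 0"
  by (auto simp: box3_def)

text \<open>The weight is the square of the height, because a derivative of sin(1/t) costs
  t^(-2).\<close>

interpretation box: weighted box3 "\<lambda>x. x $ 3 * x $ 3" 121
proof
  fix x :: "real^3" assume x: "x \<in> box3"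
  have "x $ 3 * x $ 3 \<le> 11 * 11" using x by (intro mult_mono) (auto simp: box3_def)
  thus "x $ 3 * x $ 3 \<le> 121" by simp
next
  show "0 < x $ 3 * x $ 3" if "x \<in> box3" for x using that by (simp add: box3_def)
qed (rule open_box3)

lemma square_powr: "0 < t \<Longrightarrow> (t * t) powr a = t powr (2 * a)" for t :: real
proof -
  assume "0 < t"
  hence "t * t = t powr 2" by (simp add: powr_numeral power2_eq_square)
  thus ?thesis by (simp add: powr_powr)
qed

lemma third_sy: "box.symb n 0 (1/2) (\<lambda>_ x. x $ 3)"
  by (rule box.sy_component) (auto intro!: wboundI[where C = 1] simp: square_powr box3_def)

lemma inverse_third_sy: "box.symb n 0 (-1/2) (\<lambda>_ x. inverse (x $ 3))"
  using box.sy_inverse[OF third_sy, of 1] by (simp add: square_powr box3_def)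

lemma sy_mult0: "box.symb n 0 0 f \<Longrightarrow> box.symb n 0 d g \<Longrightarrow> box.symb n 0 d (\<lambda>k x. f k x * g k x)"
  using box.sy_mult[of n 0 0 f 0 d g] by simp

lemma sin_cos_inverse_sy:
  "box.symb n 0 0 (\<lambda>_ x. sin (inverse (x $ 3))) \<and> box.symb n 0 0 (\<lambda>_ x. cos (inverse (x $ 3)))"
proof (induction n)
  case 0
  show ?case by (auto intro!: wboundI[where C = 1] simp: box3_nz)
next
  case (Suc n)
  have i2: "box.symb n 0 (-1) (\<lambda>_ x. inverse (x $ 3) * inverse (x $ 3))"
    using box.sy_mult[OF inverse_third_sy inverse_third_sy, of n] by simp
  have ds: "((\<lambda>t. sin (inverse t)) has_real_derivative - (cos (inverse t) * (inverse t * inverse t))) (at t)"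
    and dc: "((\<lambda>t. cos (inverse t)) has_real_derivative sin (inverse t) * (inverse t * inverse t)) (at t)"
    if "t \<noteq> 0" for t :: real
    using that by (auto intro!: derivative_eq_intros simp: power2_eq_square)
  have nz: "x $ 3 \<noteq> 0" if "x \<in> box3" for x using that by (auto simp: box3_def)
  have d: "box.symb n 0 (-1) (\<lambda>k. partial_D i (\<lambda>x. sin (inverse (x $ 3))))"
    "box.symb n 0 (-1) (\<lambda>k. partial_D i (\<lambda>x. cos (inverse (x $ 3))))" for i
  proof -
    have "box.symb n 0 (-1) (\<lambda>_ x. cos (inverse (x $ 3)) * (inverse (x $ 3) * inverse (x $ 3)))"
      by (rule sy_mult0) (use Suc i2 in auto)
    from box.sy_cmult[OF this, of "- (if i = 3 then 1 else 0)"]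
    show "box.symb n 0 (-1) (\<lambda>k. partial_D i (\<lambda>x. sin (inverse (x $ 3))))"
      by (rule box.sy_cong[THEN iffD1, rotated]) (simp add: partial_D_third(1)[OF ds[OF nz]])
    have "box.symb n 0 (-1) (\<lambda>_ x. sin (inverse (x $ 3)) * (inverse (x $ 3) * inverse (x $ 3)))"
      by (rule sy_mult0) (use Suc i2 in auto)
    from box.sy_cmult[OF this, of "if i = 3 then 1 else 0"]
    show "box.symb n 0 (-1) (\<lambda>k. partial_D i (\<lambda>x. cos (inverse (x $ 3))))"
      by (rule box.sy_cong[THEN iffD1, rotated]) (simp add: partial_D_third(1)[OF dc[OF nz]])
  qed
  have "wbound box3 (\<lambda>x. x $ 3 * x $ 3) 0 0 (\<lambda>_ x. sin (inverse (x $ 3)))"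
    "wbound box3 (\<lambda>x. x $ 3 * x $ 3) 0 0 (\<lambda>_ x. cos (inverse (x $ 3)))"
    by (auto intro!: wboundI[where C = 1] simp: box3_nz)
  thus ?case using d by (simp add: partial_D_third(2)[OF ds[OF nz]] partial_D_third(2)[OF dc[OF nz]])
qed

text \<open>The exponents in \<open>gfun\<close> are fixed by this count. The power 6 makes
  \<open>cfun\<close> of order t^7, weight 7/2; the factor 1/t in \<open>qfun\<close> leaves 3,
  which pays for three bounded derivatives of \<open>Vb\<close>. The cube gives \<open>gfun\<close>
  its two derivatives.\<close>

lemma cfun_sy: "box.symb 3 0 (7/2) (\<lambda>_ x. cfun (x $ 3))"
proof -
  have "box.symb 2 0 (6 * (1/2) + 0) (\<lambda>_ x. x $ 3 ^ 6 * max 0 (sin (inverse (x $ 3))) ^ 3)"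
  proof -
    have t: "box.symb 2 0 (1/2) (\<lambda>_ x. x $ 3)" by (rule third_sy)
    have t2: "box.symb 2 0 1 (\<lambda>_ x. x $ 3 * x $ 3)" using box.sy_mult[OF t t] by simp
    have "box.symb 2 0 (1 + (1 + 1)) (\<lambda>_ x. (x $ 3 * x $ 3) * ((x $ 3 * x $ 3) * (x $ 3 * x $ 3)))"
      using box.sy_mult[OF t2 box.sy_mult[OF t2 t2]] by simp
    moreover have "box.symb 2 0 0 (\<lambda>_ x. max 0 (sin (inverse (x $ 3))) ^ 3)"
      by (rule box.sy_max_power) (use sin_cos_inverse_sy in auto)
    ultimately have "box.symb 2 (0 + 0) (1 + (1 + 1) + 0)
        (\<lambda>_ x. (x $ 3 * x $ 3) * ((x $ 3 * x $ 3) * (x $ 3 * x $ 3)) * max 0 (sin (inverse (x $ 3))) ^ 3)"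
      by (rule box.sy_mult)
    thus ?thesis by (simp add: power_numeral_reduce mult_ac)
  qed
  hence g: "box.symb 2 0 (7/2 - 1) (\<lambda>_ x. gfun (x $ 3))"
    unfolding gfun_def by (rule box.sy_mono) auto
  have cd: "(cfun has_real_derivative gfun (x $ 3)) (at (x $ 3))" if "x \<in> box3" for x
    using that by (intro cfun_derivative) (auto simp: box3_def)
  have "box.symb 2 0 (7/2 - 1) (\<lambda>k. partial_D i (\<lambda>x. cfun (x $ 3)))" for i
    using box.sy_cmult[OF g, of "if i = 3 then 1 else 0"]
    by (rule box.sy_cong[THEN iffD1, rotated]) (simp add: partial_D_third(1)[OF cd])
  moreover have "wbound box3 (\<lambda>x. x $ 3 * x $ 3) 0 (7/2) (\<lambda>_ x. cfun (x $ 3))"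
  proof (rule wboundI[where C = 1])
    fix k :: real and x :: "real^3" assume x: "x \<in> box3"
    hence t: "0 < x $ 3" "x $ 3 < 11" by (auto simp: box3_def)
    have "x $ 3 powr 7 = x $ 3 ^ 7" using t by (simp add: powr_numeral)
    thus "\<bar>cfun (x $ 3)\<bar> \<le> 1 * k ^ 0 * (x $ 3 * x $ 3) powr (7/2)"
      using cfun_le[OF t] cfun_pos[OF t] by (simp add: square_powr[OF t(1)])
  qed
  ultimately show ?thesis unfolding numeral_3_eq_3 numeral_2_eq_2
    by (simp add: partial_D_third(2)[OF cd])
qed

lemma component_sy_box: "box.symb n 0 0 (\<lambda>_ x. x $ i)"
proof -
  have "\<bar>x $ i\<bar> \<le> 11" if "x \<in> box3" for x
    using that by (cases i rule: exhaust_3[THEN disjE]) (auto simp: box3_def)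
  thus ?thesis
    by (intro box.sy_component) (auto intro!: wboundI[where C = 11] simp: box3_nz)
qed

lemma qfun_sy: "box.symb 3 0 3 (\<lambda>_ x. qfun (x $ 3))"
proof -
  have m: "box.symb 3 0 0 (\<lambda>_ x. 10 - x $ 3 + max 0 (x $ 3 - 1) ^ 4)"
    by (intro box.sy_add box.sy_diff box.sy_const component_sy_box box.sy_max_power) auto
  have "box.symb 3 0 (-0) (\<lambda>_ x. inverse (10 - x $ 3 + max 0 (x $ 3 - 1) ^ 4))"
  proof (rule box.sy_inverse[OF m, of 8])
    fix x :: "real^3" assume "x \<in> box3"
    thus "8 * (x $ 3 * x $ 3) powr 0 \<le> \<bar>10 - x $ 3 + max 0 (x $ 3 - 1) ^ 4\<bar>"
      using denominator_ge[of "x $ 3"] by (auto simp: box3_def)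
  qed simp
  from box.sy_mult[OF box.sy_mult[OF cfun_sy inverse_third_sy] this]
  show ?thesis unfolding qfun_def by simp
qed

definition Vb :: "real^3 \<Rightarrow> real" where
  "Vb x = x $ 1 * x $ 2 * (face3 x * face4 x * qfun (x $ 3))"

lemma polynomial_sy: "box.symb n 0 0 (\<lambda>_. face3)" "box.symb n 0 0 (\<lambda>_. face4)"
  unfolding face3_def[abs_def] face4_def[abs_def]
  by (intro box.sy_diff box.sy_cmult box.sy_add box.sy_const component_sy_box order_refl)+

lemma Vb_sy: "box.symb 3 0 3 (\<lambda>_. Vb)"
  unfolding Vb_def[abs_def] mult.assoc
  by (intro sy_mult0 component_sy_box polynomial_sy qfun_sy)

lemma Vb_bounded: "sy 3 box3 (\<lambda>_. 1) 0 0 (\<lambda>_. Vb)"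
  by (rule box.sy_bounded[OF Vb_sy]) simp

text \<open>Here \<open>face4 x\<close> divided by the height is 1 - 2 (x1 + x2) / x3. This splits
  off a quadratic term with constant coefficient and leaves one that is cubic at the edge.\<close>

lemma Vb_slab:
  assumes "x $ 3 \<in> slab k"
  shows "Vb x = cfun (tk k) * (x $ 1 * x $ 2) - cfun (tk k) * (2 * (x $ 1 * x $ 2 * (x $ 1 + x $ 2) * inverse (x $ 3)))"
proof -
  have t: "0 < x $ 3" "x $ 3 < 1" using slab_bounds[OF assms] by auto
  hence q: "qfun (x $ 3) = cfun (tk k) * inverse (x $ 3) * inverse (10 - x $ 3)"
    by (simp add: qfun_def cfun_slab[OF assms])
  show ?thesis unfolding Vb_def q face3_def face4_def using t by (simp add: field_simps)
qed

lemma Vb_zero: "x $ 1 = 0 \<or> x $ 2 = 0 \<or> face3 x = 0 \<or> face4 x = 0 \<Longrightarrow> Vb x = 0"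
  by (auto simp: Vb_def)

section \<open>Hessians at the edges\<close>

definition twice :: "(real^3) set \<Rightarrow> (real^3 \<Rightarrow> real) \<Rightarrow> bool" where
  "twice S g \<longleftrightarrow> (\<forall>y\<in>S. g differentiable at y \<and> (\<forall>j. partial_D j g differentiable at y))"

lemma sy_twice: "sy 2 S \<rho> e d (\<lambda>_. g) \<Longrightarrow> twice S g"
  by (force simp: twice_def numeral_2_eq_2 intro: exI[of _ "1::real"])

lemma twice_hessian_product:
  assumes "open S" "x \<in> S" "twice S f" "twice S g" "f x = 0"
  shows "iter_D [i, j] (\<lambda>x. f x * g x) x =
    partial_D i f x * partial_D j g x + partial_D j f x * partial_D i g x + iter_D [i, j] f x * g x"
  using iter_D2_mult[OF assms(1,2), of f g i j] assms(3-5) by (simp add: twice_def)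

lemma twice_mult:
  assumes "open S" "twice S f" "twice S g"
  shows "twice S (\<lambda>x. f x * g x)"
  unfolding twice_def
proof (intro ballI conjI allI)
  fix y j assume y: "y \<in> S"
  show "(\<lambda>x. f x * g x) differentiable at y" using assms y by (simp add: twice_def differentiable_mult)
  show "partial_D j (\<lambda>x. f x * g x) differentiable at y"
    by (rule differentiable_cong_open[OF assms(1) y, of "\<lambda>x. f x * partial_D j g x + partial_D j f x * g x"])
      (use assms y in \<open>auto simp: twice_def partial_D_mult intro!: differentiable_mult differentiable_add\<close>)
qed

text \<open>Where both factors vanish, only the terms that differentiate each of them exactly once
  survive.\<close>

lemma hessian_two_zeros:
  assumes "open S" "x \<in> S" "twice S l" "twice S m" "twice S g" "l x = 0" "m x = 0"
  shows "iter_D [i, j] (\<lambda>x. l x * m x * g x) x =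
    g x * (partial_D i l x * partial_D j m x + partial_D j l x * partial_D i m x)"
proof -
  have "partial_D i (\<lambda>x. l x * m x) x = 0" for i
    using assms by (subst partial_D_mult) (auto simp: twice_def)
  moreover have "iter_D [i, j] (\<lambda>x. l x * m x) x = partial_D i l x * partial_D j m x + partial_D j l x * partial_D i m x"
    by (subst twice_hessian_product[OF assms(1-4,6)]) (simp add: assms(7))
  ultimately show ?thesis
    by (subst twice_hessian_product[OF assms(1,2) twice_mult[OF assms(1,3,4)] assms(5)])
      (simp_all add: assms(6) del: iter_D.simps)
qed

section \<open>Localised perturbations\<close>

lemma iter_D_zero: "iter_D is (\<lambda>_. 0) x = 0"
proof (induction "is" arbitrary: x)
  case (Cons i "is")
  hence "iter_D is (\<lambda>_. 0) = (\<lambda>_. 0)" by blast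
  thus ?case by simp
qed simp

lemma iter_D_zero_near:
  assumes "open U" "x \<in> U" "\<And>y. y \<in> U \<Longrightarrow> g y = 0"
  shows "iter_D is g x = 0" "iter_D is g differentiable at x"
proof -
  have 0: "iter_D is g y = 0" if "y \<in> U" for y
    using iter_D_cong[OF assms(1) _ that, of g "\<lambda>_. 0" "is"] assms(3) iter_D_zero by simp
  show "iter_D is g x = 0" using 0 assms(2) by blast
  show "iter_D is g differentiable at x"
    by (rule differentiable_cong_open[OF assms(1,2), of "\<lambda>_. 0"]) (use 0 in auto)
qed

text \<open>Estimates proved on one slab carry over to the whole polytope, since the localised
  functions vanish near every point outside the slab.\<close>

lemma sy_extend:
  assumes "weighted T \<rho> M" "sy n S \<rho> e d g"
    and "\<And>x. x \<in> T \<Longrightarrow> x \<notin> S \<Longrightarrow> \<exists>U. open U \<and> x \<in> U \<and> (\<forall>k. \<forall>y\<in>U. g k y = 0)"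
  shows "sy n T \<rho> e d g"
proof -
  interpret weighted T \<rho> M by fact
  have w: "wbound T \<rho> e d g"
    if w: "wbound S \<rho> e d g" and z: "\<And>x. x \<in> T \<Longrightarrow> x \<notin> S \<Longrightarrow> \<exists>U. open U \<and> x \<in> U \<and> (\<forall>k. \<forall>y\<in>U. g k y = 0)"
    for d g
  proof -
    obtain C where C: "C > 0" "\<And>k x. 0 < k \<Longrightarrow> k \<le> 1 \<Longrightarrow> x \<in> S \<Longrightarrow> \<bar>g k x\<bar> \<le> C * k ^ e * \<rho> x powr d"
      using wboundE[OF w] by blast
    show ?thesis
    proof (rule wboundI)
      fix k :: real and x assume k: "0 < k" "k \<le> 1" "x \<in> T"
      show "\<bar>g k x\<bar> \<le> C * k ^ e * \<rho> x powr d"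
      proof (cases "x \<in> S")
        case False
        hence "g k x = 0" using z k by blast
        thus ?thesis using C k by simp
      qed (use C k in auto)
    qed
  qed
  show ?thesis using assms(2,3)
  proof (induction n arbitrary: d g)
    case 0
    have "wbound T \<rho> e d g" by (rule w) (use 0 in auto)
    thus ?case by simp
  next
    case (Suc n)
    have zD: "\<exists>U. open U \<and> x \<in> U \<and> (\<forall>k. \<forall>y\<in>U. partial_D i (g k) y = 0)" if x: "x \<in> T" "x \<notin> S" for x i
    proof -
      obtain U where U: "open U" "x \<in> U" "\<forall>k. \<forall>y\<in>U. g k y = 0" using Suc.prems(2) x by blast
      have "partial_D i (g k) y = 0" if "y \<in> U" for k y
        using iter_D_zero_near(1)[OF U(1) that, of "g k" "[i]"] U(3) by simp
      thus ?thesis using U by blast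
    qed
    have "g k differentiable at x" if k: "0 < k" "k \<le> 1" "x \<in> T" for k x
    proof (cases "x \<in> S")
      case True
      thus ?thesis using Suc.prems(1) k by simp
    next
      case False
      then obtain U where U: "open U" "x \<in> U" "\<forall>k. \<forall>y\<in>U. g k y = 0" using Suc.prems(2) k by blast
      thus ?thesis using iter_D_zero_near(2)[OF U(1,2), of "g k" "[]"] by simp
    qed
    moreover have "wbound T \<rho> e d g" by (rule w) (use Suc.prems sy_wbound in blast)+
    moreover have "sy n T \<rho> e (d - 1) (\<lambda>k. partial_D i (g k))" for i
      by (rule Suc.IH[OF sy_partial[OF Suc.prems(1)] zD])
    ultimately show ?case by simp
  qed
qed

abbreviation rho :: "real^3 \<Rightarrow> real" where "rho \<equiv> \<lambda>x. x $ 1 + x $ 2"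

lemma Omega_bounds: "x \<in> Omega \<Longrightarrow> 0 < rho x" "x \<in> Omega \<Longrightarrow> rho x \<le> 10" "x \<in> Omega \<Longrightarrow> \<bar>x $ i\<bar> \<le> 10"
  "x \<in> Omega \<Longrightarrow> 0 < x $ 3"
proof -
  assume x: "x \<in> Omega"
  show "0 < rho x" "rho x \<le> 10" "0 < x $ 3" using x by (auto simp: Omega_def)
  have "\<forall>i. \<bar>x $ i\<bar> \<le> 10" unfolding forall_3 using x by (auto simp: Omega_def)
  thus "\<bar>x $ i\<bar> \<le> 10" by blast
qed

lemma weighted_Omega: "weighted Omega rho 10"
  by unfold_locales (auto simp: open_Omega Omega_bounds)

lemma rho_dist: "\<bar>rho x - rho y\<bar> \<le> 2 * dist x y"
proof -
  have "\<bar>x $ i - y $ i\<bar> \<le> dist x y" for i using dist_vec_nth_le[of x i y] by (simp add: dist_real_def)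
  from this[of 1] this[of 2] show ?thesis by linarith
qed

text \<open>Near the edge \<open>g\<close> is small, of order rho^a; away from the edge its gradient
  is bounded. Together they give a continuous extension to the closed polytope although the gradient
  may blow up at the edge.\<close>

lemma uniformly_continuous_weighted:
  assumes g: "sy 1 Omega rho e a (\<lambda>_. g)" and a: "0 < a" "a \<le> 1"
  shows "uniformly_continuous_on Omega g"
  unfolding uniformly_continuous_on_def
proof (intro allI impI)
  fix \<epsilon> :: real assume \<epsilon>: "0 < \<epsilon>"
  have s0: "wbound Omega rho e a (\<lambda>_. g)" "g differentiable at x" "wbound Omega rho e (a - 1) (\<lambda>_. partial_D i g)"
    if "x \<in> Omega" for x i using g that by (auto intro: exI[of _ 1] zero_less_one)
  obtain C where C: "C > 0" "\<And>x. x \<in> Omega \<Longrightarrow> \<bar>g x\<bar> \<le> C * rho x powr a"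
    using wboundE[OF s0(1)[OF Omega_witness]] by (metis mult.right_neutral order_refl power_one zero_less_one)
  have "\<exists>D>0. \<forall>x\<in>Omega. \<bar>partial_D i g x\<bar> \<le> D * rho x powr (a - 1)" for i
    using wboundE[OF s0(3)[OF Omega_witness, of i]] by (metis mult.right_neutral order_refl power_one zero_less_one)
  then obtain D where D: "\<And>i. D i > 0" "\<And>i x. x \<in> Omega \<Longrightarrow> \<bar>partial_D i g x\<bar> \<le> D i * rho x powr (a - 1)"
    by metis
  \<comment> \<open>Chosen so that the bound C r^a on \<open>g\<close> equals \<epsilon>/4.\<close>
  define r where "r = (\<epsilon> / (4 * C)) powr (1 / a)"
  have r: "0 < r" "r powr a = \<epsilon> / (4 * C)" using \<epsilon> C a by (auto simp: r_def powr_powr)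
  define L where "L = (D 1 + D 2 + D 3) * (r / 4) powr (a - 1)"
  have L: "0 < L" using D(1) r by (auto simp: L_def intro!: mult_pos_pos add_pos_pos)
  define S where "S = Omega \<inter> {x. r / 4 \<le> rho x}"
  have Si: "S = Omega \<inter> {x. r / 4 \<le> inner (vector [1,1,0]) x}"
    by (simp add: S_def inner_vec_def sum_3)
  have "convex S" unfolding Si by (intro convex_Int convex_Omega convex_halfspace_ge)
  have dS: "\<bar>partial_D i g x\<bar> \<le> L" if "x \<in> S" for i x
  proof -
    have "\<bar>partial_D i g x\<bar> \<le> D i * rho x powr (a - 1)" using D that by (auto simp: S_def)
    also have "\<dots> \<le> (D 1 + D 2 + D 3) * (r / 4) powr (a - 1)"
    proof (intro mult_mono powr_mono2')
      have "\<forall>i. D i \<le> D 1 + D 2 + D 3" unfolding forall_3 using D(1)[of 1] D(1)[of 2] D(1)[of 3] by auto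
      thus "D i \<le> D 1 + D 2 + D 3" by blast
      show "0 \<le> D 1 + D 2 + D 3" using D(1)[of 1] D(1)[of 2] D(1)[of 3] by auto
    qed (use that r a in \<open>auto simp: S_def\<close>)
    finally show ?thesis by (simp add: L_def)
  qed
  \<comment> \<open>\<open>rho\<close> is 2-Lipschitz, so points this close differ by at most r/4 in
    \<open>rho\<close> and fall into the same one of the two regimes.\<close>
  define \<delta> where "\<delta> = min (r / 8) (\<epsilon> / (4 * L))"
  have \<delta>: "0 < \<delta>" using r \<epsilon> L by (simp add: \<delta>_def)
  show "\<exists>d>0. \<forall>x\<in>Omega. \<forall>x'\<in>Omega. dist x' x < d \<longrightarrow> dist (g x') (g x) < \<epsilon>"
  proof (intro exI[of _ \<delta>] conjI ballI impI \<delta>)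
    fix x y assume xy: "x \<in> Omega" "y \<in> Omega" "dist y x < \<delta>"
    have d: "\<bar>rho y - rho x\<bar> \<le> r / 4" using rho_dist[of y x] xy by (simp add: \<delta>_def)
    show "dist (g y) (g x) < \<epsilon>"
    proof (cases "rho x < r / 2")
      case True
      have small: "\<bar>g z\<bar> < \<epsilon> / 2" if "z \<in> Omega" "rho z < r" for z
      proof -
        have "\<bar>g z\<bar> \<le> C * rho z powr a" using C that by blast
        also have "\<dots> \<le> C * r powr a" using C(1) that Omega_bounds[OF that(1)] a
          by (intro mult_left_mono powr_mono2) auto
        also have "\<dots> = \<epsilon> / 4" using C(1) by (simp add: r)
        finally show ?thesis using \<epsilon> by simp
      qed
      have "rho y < r" using d True by linarith
      hence "\<bar>g y\<bar> < \<epsilon> / 2" "\<bar>g x\<bar> < \<epsilon> / 2" using small xy True r by auto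
      thus ?thesis by (simp add: dist_real_def)
    next
      case False
      hence "r / 4 \<le> rho x" "r / 4 \<le> rho y" using d r(1) by linarith+
      hence "x \<in> S" "y \<in> S" using xy by (simp_all add: S_def)
      hence "\<bar>g y - g x\<bar> \<le> real CARD(3) * L * norm (y - x)"
        by (intro bounded_partials_imp_lipschitz[OF \<open>convex S\<close>]) (auto simp: dS S_def s0)
      also have "\<dots> = 3 * L * dist y x" by (simp add: dist_norm)
      also have "\<dots> < \<epsilon>"
      proof -
        have "L * dist y x \<le> L * (\<epsilon> / (4 * L))" using xy L by (intro mult_left_mono) (auto simp: \<delta>_def)
        also have "\<dots> = \<epsilon> / 4" using L by simp
        finally have "L * dist y x \<le> \<epsilon> / 4" .
        moreover have "3 * L * dist y x = 3 * (L * dist y x)" by simp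
        ultimately show ?thesis using \<epsilon> by linarith
      qed
      finally show ?thesis by (simp add: dist_real_def)
    qed
  qed
qed

lemma bump_zero:
  assumes "\<delta> \<le> \<bar>x $ 3 - t0\<bar> \<or> \<delta> \<le> \<bar>x $ 1\<bar> \<or> \<delta> \<le> \<bar>x $ 2\<bar>" "0 < \<delta>"
  shows "bump t0 \<delta> x = 0"
proof -
  have "\<delta>\<^sup>2 \<le> z * z" if "\<delta> \<le> \<bar>z\<bar>" for z
    using that assms(2) by (metis abs_mult_self_eq abs_of_pos less_imp_le mult_mono' power2_eq_square abs_ge_zero)
  hence "\<delta>\<^sup>2 \<le> x $ 1 * x $ 1 + x $ 2 * x $ 2 + (x $ 3 - t0) * (x $ 3 - t0)"
    using assms(1) zero_le_square[of "x $ 1"] zero_le_square[of "x $ 2"] zero_le_square[of "x $ 3 - t0"]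
    by (smt (verit))
  thus ?thesis by (simp add: bump_def max_def)
qed

lemma (in wedge) ang_faces:
  assumes "0 < x $ 1 + x $ 2"
  shows "x $ 2 = 0 \<Longrightarrow> ang \<theta> x = 0" "x $ 1 = 0 \<Longrightarrow> ang \<theta> x = \<theta>"
proof -
  show "x $ 2 = 0 \<Longrightarrow> ang \<theta> x = 0" by (simp add: ang_def PY_def)
  assume "x $ 1 = 0"
  hence "ang \<theta> x = arctan (tan \<theta>)" using assms by (simp add: ang_def PX_def PY_def tan_def)
  thus "ang \<theta> x = \<theta>" using theta by (simp add: arctan_tan)
qed

lemma (in wedge) pol_continuous_on:
  assumes h: "cn n h" and d: "0 < d"
  shows "continuous_on {x. 0 \<le> x $ 1 \<and> 0 \<le> x $ 2} (pol \<theta> d h)"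
proof -
  have "continuous (at x within {x. 0 \<le> x $ 1 \<and> 0 \<le> x $ 2}) (pol \<theta> d h)" if x: "0 \<le> x $ 1" "0 \<le> x $ 2" for x
  proof (cases "x $ 1 + x $ 2 = 0")
    case True
    hence x0: "x $ 1 = 0" "x $ 2 = 0" using x by auto
    hence r0: "pol \<theta> d h x = 0" by (simp add: pol_def rad_def PX_def PY_def)
    obtain C where C: "C > 0" "\<And>x. x $ 1 \<ge> 0 \<Longrightarrow> x $ 2 \<ge> 0 \<Longrightarrow> 0 < x $ 1 + x $ 2 \<Longrightarrow> \<bar>pol \<theta> d h x\<bar> \<le> C * (x $ 1 + x $ 2) powr d"
      using pol_bound[OF h, of d] by blast
    have "((pol \<theta> d h) \<longlongrightarrow> 0) (at x within {x. 0 \<le> x $ 1 \<and> 0 \<le> x $ 2})"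
    proof (rule Lim_null_comparison[where g = "\<lambda>x. C * \<bar>x $ 1 + x $ 2\<bar> powr d"])
      have "norm (pol \<theta> d h y) \<le> C * \<bar>y $ 1 + y $ 2\<bar> powr d" if "0 \<le> y $ 1" "0 \<le> y $ 2" for y
      proof (cases "y $ 1 + y $ 2 = 0")
        case True
        hence "y $ 1 = 0" "y $ 2 = 0" using that by auto
        thus ?thesis by (simp add: pol_def rad_def PX_def PY_def)
      qed (use C(2)[of y] that in auto)
      thus "\<forall>\<^sub>F y in at x within {x. 0 \<le> x $ 1 \<and> 0 \<le> x $ 2}. norm (pol \<theta> d h y) \<le> C * \<bar>y $ 1 + y $ 2\<bar> powr d"
        by (auto simp: eventually_at_filter)
      have "((\<lambda>y. C * \<bar>y $ 1 + y $ 2\<bar> powr d) \<longlongrightarrow> C * \<bar>x $ 1 + x $ 2\<bar> powr d) (at x within {x. 0 \<le> x $ 1 \<and> 0 \<le> x $ 2})"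
        by (intro tendsto_intros tendsto_powr2) (use d in \<open>auto simp: eventually_at_filter\<close>)
      thus "((\<lambda>y. C * \<bar>y $ 1 + y $ 2\<bar> powr d) \<longlongrightarrow> 0) (at x within {x. 0 \<le> x $ 1 \<and> 0 \<le> x $ 2})"
        using x0 by simp
    qed
    thus ?thesis by (simp add: continuous_within r0)
  next
    case False
    hence p: "0 < x $ 1 + x $ 2" using x by linarith
    have X: "PX \<theta> x > 0" by (rule PX_pos[OF x p])
    have "isCont (rad \<theta>) x" using rad_derivative[OF X] has_derivative_continuous by blast
    moreover have "isCont (ang \<theta>) x" using ang_derivative[OF X] has_derivative_continuous by blast
    moreover have "isCont h (ang \<theta> x)"
      using cn_continuous[OF h] ang_range[OF x p] by (intro continuous_on_interior[of "{-1..2}"]) auto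
    ultimately have "isCont (pol \<theta> d h) x"
      unfolding pol_def[abs_def] using rad_pos[OF X]
      by (intro continuous_intros) (auto intro: isCont_o2)
    thus ?thesis by (rule continuous_at_imp_continuous_at_within)
  qed
  thus ?thesis by (auto simp: continuous_on_eq_continuous_within)
qed

text \<open>The least \<open>N\<close> that reaches the Lipschitz threshold; minimality gives
  \<open>real N * \<gamma> < 1\<close>, which non-resonance requires.\<close>

lemma exponent_exists:
  assumes "0 < \<gamma>" "\<gamma> < (1::real)"
  obtains N :: nat where "1 \<le> N" "1 \<le> (real N + 1) * \<gamma>" "real N * \<gamma> < 1"
proof -
  obtain n :: nat where n: "1 / \<gamma> < real n" using reals_Archimedean2 by blast
  hence ex: "1 \<le> (real n + 1) * \<gamma>" using assms by (simp add: field_simps)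
  define N where "N = (LEAST n. 1 \<le> (real n + 1) * \<gamma>)"
  have 1: "1 \<le> (real N + 1) * \<gamma>" unfolding N_def using ex by (rule LeastI)
  have "N \<noteq> 0"
  proof
    assume "N = 0"
    thus False using 1 assms by simp
  qed
  moreover have "\<not> 1 \<le> (real (N - 1) + 1) * \<gamma>"
    using \<open>N \<noteq> 0\<close> not_less_Least[of "N - 1" "\<lambda>n. 1 \<le> (real n + 1) * \<gamma>"] by (auto simp: N_def)
  ultimately show ?thesis using that[of N] 1 by (simp add: of_nat_diff)
qed

text \<open>With theta = pi / (2 + gamma), the first angle (2 + gamma) theta is pi, and for 2 <= j
  <= N the angle (2 + j gamma) theta lies strictly between pi and 2 pi.\<close>

lemma profiles_for_angle:
  assumes "0 < \<gamma>" "\<gamma> < 1" "real N * \<gamma> < 1" "\<theta> = pi / (2 + \<gamma>)"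
  shows "\<exists>h h1 h2. profiles \<theta> (\<lambda>j. 2 + real j * \<gamma>) N h h1 h2"
proof (rule profiles_exist)
  show "2 + real 1 * \<gamma> \<noteq> 0" using assms by simp
  show "sin ((2 + real 1 * \<gamma>) * \<theta>) = 0" using assms by simp
  fix j assume j: "j \<in> {2..N}"
  have "real j * \<gamma> \<le> real N * \<gamma>" using j assms by (intro mult_right_mono) auto
  from le_less_trans[OF this assms(3)] have jg: "real j * \<gamma> < 1" "2 * \<gamma> \<le> real j * \<gamma>"
    using j assms(1) by auto
  have t: "0 < \<theta>" using assms by simp
  have t2: "(2 + \<gamma>) * \<theta> = pi" "(4 + 2 * \<gamma>) * \<theta> = 2 * pi" using assms by (auto simp: field_simps)
  have "(2 + \<gamma>) * \<theta> < (2 + real j * \<gamma>) * \<theta>" "(2 + real j * \<gamma>) * \<theta> < (4 + 2 * \<gamma>) * \<theta>"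
    using jg assms(1) by (intro mult_strict_right_mono t; linarith)+
  hence "pi < (2 + real j * \<gamma>) * \<theta>" "(2 + real j * \<gamma>) * \<theta> < 2 * pi" unfolding t2 .
  thus "2 + real j * \<gamma> \<noteq> 0 \<and> sin ((2 + real j * \<gamma>) * \<theta>) \<noteq> 0"
    using sin_lt_zero[of "(2 + real j * \<gamma>) * \<theta>"] assms by (auto simp: add_nonneg_eq_0_iff)
qed

lemma hoelder_on_subset: "hoelder_on \<alpha> S g \<Longrightarrow> T \<subseteq> S \<Longrightarrow> hoelder_on \<alpha> T g"
  unfolding hoelder_on_def by (meson subsetD)

lemma powr_at_right_0: "0 < b \<Longrightarrow> ((\<lambda>s. s powr b) \<longlongrightarrow> 0) (at_right (0::real))"
proof -
  assume b: "0 < b"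
  have "((\<lambda>s. s powr b) \<longlongrightarrow> 0 powr b) (at_right (0::real))"
    by (rule tendsto_powr2[OF _ tendsto_const _ b]) (auto simp: eventually_at_right_less intro: eventually_at_rightI[of 0 1])
  thus ?thesis by simp
qed

section \<open>Failure of the Hoelder estimate on a ray\<close>

context edge_model begin

definition diag :: "real \<Rightarrow> real^3" where "diag s = vector [s, s, t0]"

lemma diag_dist: "0 < s' \<Longrightarrow> s' < s \<Longrightarrow> dist (diag s) (diag s') \<le> 2 * s"
proof -
  assume s: "0 < s'" "s' < s"
  have "dist (diag s) (diag s') \<le> (\<Sum>i\<in>UNIV. \<bar>(diag s - diag s') $ i\<bar>)"
    unfolding dist_norm by (rule norm_le_l1_cart)
  also have "\<dots> \<le> 2 * s" using s by (simp add: sum_3 diag_def)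
  finally show ?thesis .
qed

text \<open>The wedge angle is constant on the ray, so homogeneous functions become pure powers of
  \<open>s\<close> there.\<close>

lemma pol_diag:
  assumes "0 < s"
  shows "pol \<theta> b f (diag s) = s powr b * (rad \<theta> (diag 1) powr b * f (ang \<theta> (diag 1)))"
proof -
  have "rad \<theta> (diag s) = sqrt (s\<^sup>2 * ((PX \<theta> (diag 1))\<^sup>2 + (PY \<theta> (diag 1))\<^sup>2))"
    by (simp add: rad_def PX_def PY_def diag_def power2_eq_square algebra_simps)
  hence r: "rad \<theta> (diag s) = s * rad \<theta> (diag 1)" using assms by (simp add: rad_def real_sqrt_mult)
  have a: "ang \<theta> (diag s) = ang \<theta> (diag 1)"
  proof -
    have "PY \<theta> (diag s) = s * PY \<theta> (diag 1)" "PX \<theta> (diag s) = s * PX \<theta> (diag 1)"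
      by (simp_all add: PX_def PY_def diag_def algebra_simps)
    thus ?thesis using assms by (simp add: ang_def)
  qed
  have "0 \<le> rad \<theta> (diag 1)" by (simp add: rad_def)
  thus ?thesis using assms by (simp add: pol_def r a powr_mult)
qed

text \<open>On the ray the second derivative is 1 + T(s) A0 s^gamma plus an error of order s + s^mu,
  with mu > gamma and T(0) A0 > 0. A Hoelder bound with \<open>\<alpha> > \<gamma>\<close> would
  give T(s) A0 s^gamma = o(s^gamma), a contradiction after division.\<close>

lemma not_hoelder:
  assumes ub: "\<And>x. x \<in> S \<Longrightarrow> ub x = quad (cos \<theta>) x + b3 x"
    and k: "0 < k" "k \<le> 1" and \<delta>: "0 < \<delta>" and \<alpha>: "\<gamma> < \<alpha>"
    and s0: "0 < s0" "\<And>s. 0 < s \<Longrightarrow> s < s0 \<Longrightarrow> diag s \<in> S"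
  shows "\<not> hoelder_on \<alpha> S (iter_D [1, 1] (\<lambda>x. ub x + V k x))"
proof
  assume "hoelder_on \<alpha> S (iter_D [1, 1] (\<lambda>x. ub x + V k x))"
  then obtain C where C: "\<And>x y. x \<in> S \<Longrightarrow> y \<in> S \<Longrightarrow>
      \<bar>iter_D [1, 1] (\<lambda>x. ub x + V k x) x - iter_D [1, 1] (\<lambda>x. ub x + V k x) y\<bar> \<le> C * dist x y powr \<alpha>"
    unfolding hoelder_on_def by blast
  define H where "H s = iter_D [1, 1] (\<lambda>x. ub x + V k x) (diag s)" for s
  define \<mu> where "\<mu> = min (2 * \<gamma>) 1"
  have \<mu>: "\<gamma> < \<mu>" "0 < \<mu>" using gamma by (auto simp: \<mu>_def)
  define A0 where "A0 = rad \<theta> (diag 1) powr \<gamma> * ((2 + \<gamma>) * (1 + \<gamma>) * sin (\<gamma> * ang \<theta> (diag 1)))"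
  have A0: "0 < A0"
  proof -
    have d1: "diag 1 $ 1 = 1" "diag 1 $ 2 = 1" by (simp_all add: diag_def)
    have X: "0 < PX \<theta> (diag 1)" using PX_pos[of "diag 1"] by (simp add: d1)
    have a: "ang \<theta> (diag 1) < 2" using ang_range[of "diag 1"] by (simp add: d1)
    have a0: "0 < ang \<theta> (diag 1)" using X cos_sin_pos by (simp add: ang_def PY_def d1)
    have "\<gamma> * ang \<theta> (diag 1) < 1 * 2" using a a0 gamma by (intro mult_strict_mono) auto
    hence "\<gamma> * ang \<theta> (diag 1) < pi" using pi_gt3 by linarith
    hence "0 < sin (\<gamma> * ang \<theta> (diag 1))" using a0 gamma by (intro sin_gt_zero) auto
    thus ?thesis using rad_pos[OF X] gamma by (auto simp: A0_def intro!: mult_pos_pos)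
  qed
  obtain C1 where C1: "C1 > 0" "\<And>x. x \<in> S \<Longrightarrow> \<bar>r 1 1 k x\<bar> \<le> C1 * (x $ 1 + x $ 2)"
  proof -
    obtain c where c: "c > 0" "\<And>k x. 0 < k \<Longrightarrow> k \<le> 1 \<Longrightarrow> x \<in> S \<Longrightarrow> \<bar>r 1 1 k x\<bar> \<le> c * k ^ 0 * (x $ 1 + x $ 2) powr 1"
      using wboundE[OF sy_wbound[OF r_sy[of 1 1]]] by blast
    show ?thesis
    proof (rule that[OF c(1)])
      fix x assume x: "x \<in> S"
      show "\<bar>r 1 1 k x\<bar> \<le> c * (x $ 1 + x $ 2)" using c(2)[OF k x] weight_pos[OF x] by simp
    qed
  qed
  obtain C2 where C2: "C2 > 0" "\<And>x. x \<in> S \<Longrightarrow> \<bar>iter_D [1, 1] (V k) x - K k x * pol \<theta> \<gamma> (\<lambda>a. (2 + \<gamma>) * (1 + \<gamma>) * sin (\<gamma> * a)) x\<bar> \<le> C2 * (x $ 1 + x $ 2) powr \<mu>"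
  proof -
    obtain c where c: "c > 0" "\<And>k x. 0 < k \<Longrightarrow> k \<le> 1 \<Longrightarrow> x \<in> S \<Longrightarrow>
        \<bar>iter_D [1, 1] (V k) x - K k x * pol \<theta> \<gamma> (\<lambda>a. (2 + \<gamma>) * (1 + \<gamma>) * sin (\<gamma> * a)) x\<bar> \<le> c * k ^ 1 * (x $ 1 + x $ 2) powr \<mu>"
      using wboundE[OF sy_wbound[OF V_11_expansion]] unfolding \<mu>_def by blast
    show ?thesis
    proof (rule that[OF c(1)])
      fix x assume x: "x \<in> S"
      have "c * k ^ 1 * (x $ 1 + x $ 2) powr \<mu> \<le> c * 1 * (x $ 1 + x $ 2) powr \<mu>"
        using c(1) k by (intro mult_right_mono mult_left_mono) auto
      with c(2)[OF k x] show "\<bar>iter_D [1, 1] (V k) x - K k x * pol \<theta> \<gamma> (\<lambda>a. (2 + \<gamma>) * (1 + \<gamma>) * sin (\<gamma> * a)) x\<bar> \<le> c * (x $ 1 + x $ 2) powr \<mu>"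
        by simp
    qed
  qed
  have H: "\<bar>H s - 1 - K k (diag s) * s powr \<gamma> * A0\<bar> \<le> C1 * (2 * s) + C2 * (2 * s) powr \<mu>" if s: "0 < s" "s < s0" for s
  proof -
    have x: "diag s \<in> S" using s0 s by blast
    have Vd: "V k differentiable at y" "partial_D i (V k) differentiable at y" if "y \<in> S" for y i
      using sy_differentiable[OF V_sy[unfolded numeral_3_eq_3] k that]
        sy_differentiable[OF sy_partial[OF V_sy[unfolded numeral_3_eq_3]] k that] by auto
    have "H s = iter_D [1, 1] ub (diag s) + iter_D [1, 1] (V k) (diag s)"
      unfolding H_def by (rule iter_D2_add[OF open_S x]) (auto simp: base_hessian[OF ub] Vd)
    also have "iter_D [1, 1] ub (diag s) = 1 + r 1 1 k (diag s)"
      using base_hessian(1)[where i = 1 and j = 1 and k = k, OF ub x] unfolding quad_hess_def by simp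
    finally have e: "H s - 1 - K k (diag s) * s powr \<gamma> * A0 = r 1 1 k (diag s) +
        (iter_D [1, 1] (V k) (diag s) - K k (diag s) * pol \<theta> \<gamma> (\<lambda>a. (2 + \<gamma>) * (1 + \<gamma>) * sin (\<gamma> * a)) (diag s))"
      unfolding pol_diag[OF s(1)] A0_def by (simp add: mult.assoc del: iter_D.simps)
    have "diag s $ 1 + diag s $ 2 = 2 * s" by (simp add: diag_def)
    with C1(2)[OF x] C2(2)[OF x] show ?thesis unfolding e by (simp del: iter_D.simps)
  qed
  define T where "T s = k * max 0 (\<delta>\<^sup>2 - 2 * s\<^sup>2) ^ 4" for s
  have K: "K k (diag s) = T s" for s
    by (simp add: T_def bump_def diag_def power2_eq_square)
  have T: "(T \<longlongrightarrow> k * max 0 (\<delta>\<^sup>2 - 2 * 0\<^sup>2) ^ 4) (at_right 0)"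
    unfolding T_def by (intro tendsto_intros)
  have err: "((\<lambda>s. C1 * (2 * s) + C2 * (2 * s) powr \<mu>) \<longlongrightarrow> C1 * (2 * 0) + C2 * (2 * 0) powr \<mu>) (at_right 0)"
    by (intro tendsto_intros tendsto_powr2) (use \<mu> in \<open>auto simp: eventually_at_right_less intro: eventually_at_rightI[of 0 1]\<close>)
  have near: "\<forall>\<^sub>F s in at_right 0. 0 < s \<and> s < s0"
    using s0(1) by (auto simp: eventually_at_right intro!: exI[of _ s0])
  have "((\<lambda>s. H s - 1 - T s * s powr \<gamma> * A0) \<longlongrightarrow> 0) (at_right 0)"
  proof (rule Lim_null_comparison)
    show "\<forall>\<^sub>F s in at_right 0. norm (H s - 1 - T s * s powr \<gamma> * A0) \<le> C1 * (2 * s) + C2 * (2 * s) powr \<mu>"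
      using near by eventually_elim (use H K in simp)
    show "((\<lambda>s. C1 * (2 * s) + C2 * (2 * s) powr \<mu>) \<longlongrightarrow> 0) (at_right 0)" using err \<mu> by simp
  qed
  moreover have "((\<lambda>s. 1 + T s * s powr \<gamma> * A0) \<longlongrightarrow> 1 + k * max 0 (\<delta>\<^sup>2 - 2 * 0\<^sup>2) ^ 4 * 0 * A0) (at_right 0)"
    by (intro tendsto_intros T powr_at_right_0 gamma)
  ultimately have "((\<lambda>s. (H s - 1 - T s * s powr \<gamma> * A0) + (1 + T s * s powr \<gamma> * A0)) \<longlongrightarrow> 0 + (1 + k * max 0 (\<delta>\<^sup>2 - 2 * 0\<^sup>2) ^ 4 * 0 * A0)) (at_right 0)"
    by (rule tendsto_add)
  hence H1: "(H \<longlongrightarrow> 1) (at_right 0)" by simp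
  \<comment> \<open>The second point of the Hoelder quotient is moved along the ray to the edge,
    where the second derivative tends to 1.\<close>
  have up: "\<bar>H s - 1\<bar> \<le> \<bar>C\<bar> * (2 * s) powr \<alpha>" if s: "0 < s" "s < s0" for s
  proof (rule tendsto_upperbound)
    show "((\<lambda>s'. \<bar>H s - H s'\<bar>) \<longlongrightarrow> \<bar>H s - 1\<bar>) (at_right 0)" by (intro tendsto_intros H1)
    have "\<bar>H s - H s'\<bar> \<le> \<bar>C\<bar> * (2 * s) powr \<alpha>" if s': "0 < s'" "s' < s" for s'
    proof -
      have "\<bar>H s - H s'\<bar> \<le> C * dist (diag s) (diag s') powr \<alpha>"
        unfolding H_def by (rule C) (use s0 s s' in auto)
      also have "\<dots> \<le> \<bar>C\<bar> * (2 * s) powr \<alpha>"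
        using diag_dist[OF s'] \<alpha> gamma by (intro mult_mono powr_mono2) auto
      finally show ?thesis .
    qed
    thus "\<forall>\<^sub>F s' in at_right 0. \<bar>H s - H s'\<bar> \<le> \<bar>C\<bar> * (2 * s) powr \<alpha>"
      using s(1) by (auto simp: eventually_at_right intro!: exI[of _ s])
  qed simp
  have main: "T s * A0 \<le> \<bar>C\<bar> * 2 powr \<alpha> * s powr (\<alpha> - \<gamma>) + (C1 * 2 * s powr (1 - \<gamma>) + C2 * 2 powr \<mu> * s powr (\<mu> - \<gamma>))"
    if s: "0 < s" "s < s0" for s
  proof -
    have "T s * s powr \<gamma> * A0 \<le> \<bar>C\<bar> * (2 * s) powr \<alpha> + (C1 * (2 * s) + C2 * (2 * s) powr \<mu>)"
      using H[OF s] up[OF s] unfolding K by linarith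
    also have "\<dots> = \<bar>C\<bar> * (2 powr \<alpha> * s powr \<alpha>) + (C1 * (2 * s powr 1) + C2 * (2 powr \<mu> * s powr \<mu>))"
      using s by (simp add: powr_mult)
    also have "\<dots> = s powr \<gamma> * (\<bar>C\<bar> * 2 powr \<alpha> * s powr (\<alpha> - \<gamma>) + (C1 * 2 * s powr (1 - \<gamma>) + C2 * 2 powr \<mu> * s powr (\<mu> - \<gamma>)))"
    proof -
      have "s powr a = s powr \<gamma> * s powr (a - \<gamma>)" for a using s by (simp add: powr_add[symmetric])
      from this[of \<alpha>] this[of 1] this[of \<mu>] show ?thesis by (simp add: distrib_left)
    qed
    finally have "s powr \<gamma> * (T s * A0) \<le> s powr \<gamma> * (\<bar>C\<bar> * 2 powr \<alpha> * s powr (\<alpha> - \<gamma>) + (C1 * 2 * s powr (1 - \<gamma>) + C2 * 2 powr \<mu> * s powr (\<mu> - \<gamma>)))"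
      by (simp add: mult_ac)
    thus ?thesis using s by (simp add: mult_le_cancel_left)
  qed
  have "k * max 0 (\<delta>\<^sup>2 - 2 * 0\<^sup>2) ^ 4 * A0 \<le> \<bar>C\<bar> * 2 powr \<alpha> * 0 + (C1 * 2 * 0 + C2 * 2 powr \<mu> * 0)"
  proof (rule tendsto_le[where F = "at_right (0::real)"])
    show "((\<lambda>s. T s * A0) \<longlongrightarrow> k * max 0 (\<delta>\<^sup>2 - 2 * 0\<^sup>2) ^ 4 * A0) (at_right 0)"
      by (intro tendsto_intros T)
    show "((\<lambda>s. \<bar>C\<bar> * 2 powr \<alpha> * s powr (\<alpha> - \<gamma>) + (C1 * 2 * s powr (1 - \<gamma>) + C2 * 2 powr \<mu> * s powr (\<mu> - \<gamma>))) \<longlongrightarrow>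
        \<bar>C\<bar> * 2 powr \<alpha> * 0 + (C1 * 2 * 0 + C2 * 2 powr \<mu> * 0)) (at_right 0)"
      by (intro tendsto_intros powr_at_right_0) (use \<alpha> gamma \<mu> in auto)
    show "\<forall>\<^sub>F s in at_right 0. T s * A0 \<le> \<bar>C\<bar> * 2 powr \<alpha> * s powr (\<alpha> - \<gamma>) + (C1 * 2 * s powr (1 - \<gamma>) + C2 * 2 powr \<mu> * s powr (\<mu> - \<gamma>))"
      using near by eventually_elim (use main in blast)
  qed simp
  moreover have "0 < k * max 0 (\<delta>\<^sup>2 - 2 * 0\<^sup>2) ^ 4 * A0" using k A0 \<delta> by (auto intro!: mult_pos_pos)
  ultimately show False by simp
qed

end

section \<open>Exponents attached to the slabs\<close>

definition edge_gap :: "real \<Rightarrow> nat \<Rightarrow> real" where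
  "edge_gap \<epsilon> k = pi / arccos (\<epsilon> * cfun (tk k)) - 2"

lemma cfun_tk: "0 < cfun (tk k)" "cfun (tk k) < 1" "cfun (tk k) \<le> tk k" "0 < tk k" "tk k < 1"
proof -
  have t: "0 < tk k" "tk k < 1" using slab_bounds[OF tk_slab] by auto
  show "0 < tk k" "tk k < 1" by (fact t)+
  show "0 < cfun (tk k)" using cfun_pos t by simp
  have "tk k ^ 7 \<le> tk k ^ 1" using t by (intro power_decreasing) auto
  thus "cfun (tk k) \<le> tk k" using cfun_le[of "tk k"] t by simp
  thus "cfun (tk k) < 1" using t by simp
qed

text \<open>\<open>\<epsilon> \<le> 1/2\<close> and \<open>cfun (tk k) < 1\<close> give a cosine
  between 0 and 1/2, hence an angle between pi/3 and pi/2 and a gap between 0 and 1.\<close>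

lemma edge_gap_bounds:
  assumes "0 < \<epsilon>" "\<epsilon> \<le> 1/2"
  shows "0 < edge_gap \<epsilon> k" "edge_gap \<epsilon> k < 1" "0 < arccos (\<epsilon> * cfun (tk k))" "arccos (\<epsilon> * cfun (tk k)) < pi / 2"
    "cos (arccos (\<epsilon> * cfun (tk k))) = \<epsilon> * cfun (tk k)" "arccos (\<epsilon> * cfun (tk k)) = pi / (2 + edge_gap \<epsilon> k)"
proof -
  define c where "c = \<epsilon> * cfun (tk k)"
  have c: "0 < c" "c < 1/2"
  proof -
    show "0 < c" using assms cfun_tk(1) by (simp add: c_def)
    have "c < 1/2 * 1" unfolding c_def using assms cfun_tk[of k]
      by (intro mult_le_less_imp_less) auto
    thus "c < 1/2" by simp
  qed
  have 1: "arccos c < arccos 0" using c by (intro arccos_less_mono[THEN iffD2]) auto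
  have 2: "arccos (1/2) < arccos c" using c by (intro arccos_less_mono[THEN iffD2]) auto
  have 3: "arccos (1/2) = pi / 3" using arccos_cos[of "pi / 3"] by (simp add: cos_60)
  show "0 < arccos (\<epsilon> * cfun (tk k))" "arccos (\<epsilon> * cfun (tk k)) < pi / 2"
    using 1 2 3 pi_gt_zero unfolding c_def[symmetric] by (auto intro: less_trans)
  show "0 < edge_gap \<epsilon> k" "edge_gap \<epsilon> k < 1"
    using 1 2 3 pi_gt_zero unfolding edge_gap_def c_def[symmetric] by (auto simp: field_simps)
  show "cos (arccos (\<epsilon> * cfun (tk k))) = \<epsilon> * cfun (tk k)"
    unfolding c_def[symmetric] using c by simp
  show "arccos (\<epsilon> * cfun (tk k)) = pi / (2 + edge_gap \<epsilon> k)"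
    using 2 3 pi_gt_zero unfolding edge_gap_def c_def[symmetric] by simp
qed

lemma tk_tendsto: "tk \<longlonglongrightarrow> 0"
proof (rule Lim_null_comparison[OF _ LIMSEQ_inverse_real_of_nat])
  have "tk k \<le> inverse (real (Suc k))" for k
  proof -
    have "(2 * real k + 3/2) * 1 \<le> (2 * real k + 3/2) * pi" using pi_gt3 by (intro mult_left_mono) auto
    moreover have "real (Suc k) \<le> (2 * real k + 3/2) * 1" by simp
    ultimately have "real (Suc k) \<le> (2 * real k + 3/2) * pi" by linarith
    thus ?thesis unfolding tk_def by (intro le_imp_inverse_le) auto
  qed
  thus "\<forall>\<^sub>F k in sequentially. norm (tk k) \<le> inverse (real (Suc k))"
    using cfun_tk(4) by (simp add: less_imp_le)
qed

lemma edge_gap_tendsto: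
  assumes "0 < \<epsilon>" "\<epsilon> \<le> 1/2"
  shows "edge_gap \<epsilon> \<longlonglongrightarrow> 0"
proof -
  have "(\<lambda>k. cfun (tk k)) \<longlonglongrightarrow> 0"
    by (rule Lim_null_comparison[OF _ tk_tendsto]) (use cfun_tk in \<open>simp add: less_imp_le\<close>)
  hence c: "(\<lambda>k. \<epsilon> * cfun (tk k)) \<longlonglongrightarrow> \<epsilon> * 0" by (intro tendsto_intros)
  have "isCont arccos 0" by (rule isCont_arccos) auto
  hence "(\<lambda>k. arccos (\<epsilon> * cfun (tk k))) \<longlonglongrightarrow> arccos 0"
    using isCont_tendsto_compose c by fastforce
  hence "(\<lambda>k. pi / arccos (\<epsilon> * cfun (tk k)) - 2) \<longlonglongrightarrow> pi / arccos 0 - 2"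
    by (intro tendsto_intros) auto
  thus ?thesis by (simp add: edge_gap_def[abs_def])
qed

lemma wbound_fix:
  assumes "wbound S \<rho> e d g" "0 < k" "k \<le> 1"
  shows "wbound S \<rho> 0 d (\<lambda>_. g k)"
proof -
  obtain C where C: "C > 0" "\<And>k x. 0 < k \<Longrightarrow> k \<le> 1 \<Longrightarrow> x \<in> S \<Longrightarrow> \<bar>g k x\<bar> \<le> C * k ^ e * \<rho> x powr d"
    using wboundE[OF assms(1)] by blast
  thus ?thesis using assms(2,3) by (intro wboundI[where C = "C * k ^ e"]) simp
qed

lemma sy_fix:
  assumes "sy n S \<rho> e d g" "0 < k" "k \<le> 1"
  shows "sy n S \<rho> 0 d (\<lambda>_. g k)"
  using assms(1)
proof (induction n arbitrary: d g)
  case 0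
  thus ?case using wbound_fix assms by simp
next
  case (Suc n)
  have "sy n S \<rho> 0 (d - 1) (\<lambda>_. partial_D i (g k))" for i
    by (rule Suc.IH[of "d - 1" "\<lambda>k. partial_D i (g k)"]) (use Suc.prems in simp)
  thus ?case using wbound_fix[of S \<rho> e d g k] Suc.prems assms by simp
qed

section \<open>One singular perturbation for each slab\<close>

definition det_gap :: "(real^3 \<Rightarrow> real) \<Rightarrow> (real^3 \<Rightarrow> real) \<Rightarrow> real^3 \<Rightarrow> real" where
  "det_gap ub V x = det (hessian (\<lambda>x. ub x + V x) x) - det (hessian ub x)"

text \<open>The bound on the gap vanishes on all six edges, so the perturbation does not change the limit of
  the determinant there.\<close>

definition slab_perturbation :: "(real^3 \<Rightarrow> real) \<Rightarrow> real \<Rightarrow> nat \<Rightarrow> real \<Rightarrow> (real^3 \<Rightarrow> real) \<Rightarrow> bool" where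
  "slab_perturbation ub \<epsilon> k \<eta> V \<longleftrightarrow>
    continuous_on tetra V \<and> (\<forall>x\<in>tetra - Omega. V x = 0) \<and> (\<forall>x\<in>tetra. x $ 3 \<notin> slab k \<longrightarrow> V x = 0) \<and>
    (\<forall>x\<in>tetra. \<bar>V x\<bar> \<le> \<eta>) \<and>
    (\<forall>is. length is \<le> 2 \<longrightarrow> uniformly_continuous_on Omega (iter_D is V) \<and>
       (\<forall>x\<in>Omega. iter_D is V differentiable at x \<and> \<bar>iter_D is V x\<bar> \<le> \<eta>)) \<and>
    (\<forall>x\<in>Omega. \<bar>det_gap ub V x\<bar> \<le> rho x * (face3 x * face4 x) \<and> det_gap ub V differentiable at x \<and>
       (\<forall>i. \<bar>partial_D i (det_gap ub V) x\<bar> \<le> 1)) \<and>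
    (\<forall>\<alpha>. edge_gap \<epsilon> k < \<alpha> \<longrightarrow>
       \<not> hoelder_on \<alpha> (Omega \<inter> {x. x $ 3 \<in> slab k}) (iter_D [1, 1] (\<lambda>x. ub x + V x)))"

lemma hessian_cong:
  assumes "open U" "x \<in> U" "\<And>y. y \<in> U \<Longrightarrow> f y = g y"
  shows "hessian f x = hessian g x"
proof -
  have "iter_D is f x = iter_D is g x" for "is" by (rule iter_D_cong[OF assms(1,3,2)])
  thus ?thesis unfolding hessian_def by (simp only:)
qed

lemma wbound_Omega_0:
  assumes "wbound Omega rho 1 0 g"
  obtains C where "0 < C" "\<And>k x. 0 < k \<Longrightarrow> k \<le> 1 \<Longrightarrow> x \<in> Omega \<Longrightarrow> \<bar>g k x\<bar> \<le> C * k"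
proof -
  obtain C where C: "C > 0" "\<And>k x. 0 < k \<Longrightarrow> k \<le> 1 \<Longrightarrow> x \<in> Omega \<Longrightarrow> \<bar>g k x\<bar> \<le> C * k ^ 1 * rho x powr 0"
    using wboundE[OF assms] by blast
  show ?thesis
  proof (rule that[OF C(1)])
    fix k :: real and x assume k: "0 < k" "k \<le> 1" "x \<in> Omega"
    have "rho x \<noteq> 0" using Omega_bounds(1)[OF k(3)] by simp
    thus "\<bar>g k x\<bar> \<le> C * k" using C(2)[OF k] by simp
  qed
qed

text \<open>The edge model at the point of height \<open>tk k\<close>, with angle arccos of the
  constant mixed coefficient. All estimates are linear in the amplitude, so one small amplitude
  achieves every required bound.\<close>

lemma slab_perturbation_exists:
  assumes \<epsilon>: "0 < \<epsilon>" "\<epsilon> \<le> 1/2" and \<eta>: "0 < \<eta>"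
    and ub: "\<And>x. x \<in> Omega \<Longrightarrow> x $ 3 \<in> slab k \<Longrightarrow> ub x = quad 0 x + \<epsilon> * Vb x"
  shows "\<exists>V. slab_perturbation ub \<epsilon> k \<eta> V"
proof -
  define c where "c = cfun (tk k)"
  define \<theta> where "\<theta> = arccos (\<epsilon> * c)"
  define \<gamma> where "\<gamma> = edge_gap \<epsilon> k"
  note gap = edge_gap_bounds[OF \<epsilon>, of k, folded c_def, folded \<theta>_def \<gamma>_def]
  obtain N where N: "1 \<le> N" "1 \<le> (real N + 1) * \<gamma>" "real N * \<gamma> < 1" using exponent_exists gap by blast
  obtain h h1 h2 where prof: "profiles \<theta> (\<lambda>j. 2 + real j * \<gamma>) N h h1 h2"
    using profiles_for_angle[OF gap(1,2) N(3) gap(6)] by blast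
  define S where "S = Omega \<inter> {x. x $ 3 \<in> slab k}"
  have "open {x :: real^3. x $ 3 \<in> slab k}"
    unfolding slab_interval by (simp add: open_Int open_Collect_conj open_Collect_less continuous_intros)
  hence opS: "open S" unfolding S_def using open_Omega by blast
  define b3 where "b3 x = - (\<epsilon> * c) * (2 * (x $ 1 * (x $ 2 * ((x $ 1 + x $ 2) * inverse (x $ 3)))))" for x :: "real^3"
  have ubS: "ub x = quad (cos \<theta>) x + b3 x" if "x \<in> S" for x
    using ub[of x] that Vb_slab[of x k] gap(5) by (simp add: S_def quad_def b3_def c_def algebra_simps)
  have wS: "weighted S rho 10"
    by unfold_locales (use opS Omega_bounds in \<open>auto simp: S_def\<close>)
  interpret W: weighted S rho 10 by (rule wS)
  have b3: "W.symb 3 0 3 (\<lambda>_. b3)"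
  proof -
    have x1: "W.symb 3 0 1 (\<lambda>_ x. x $ 1)" and x2: "W.symb 3 0 1 (\<lambda>_ x. x $ 2)"
      by (rule W.sy_component; auto intro!: wboundI[where C = 1] simp: S_def Omega_def)+
    have x3: "W.symb 3 0 0 (\<lambda>_ x. x $ 3)"
      by (rule W.sy_component) (use W.weight_nz Omega_bounds in \<open>auto intro!: wboundI[where C = 10] simp: S_def\<close>)
    \<comment> \<open>On a fixed slab the height is bounded below by its left end point.\<close>
    have "W.symb 3 0 (-0) (\<lambda>_ x. inverse (x $ 3))"
    proof (rule W.sy_inverse[OF x3])
      show "0 < inverse ((2 * real k + 2) * pi)" by (auto intro!: mult_pos_pos)
      fix x assume "x \<in> S"
      thus "inverse ((2 * real k + 2) * pi) * rho x powr 0 \<le> \<bar>x $ 3\<bar>"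
        using W.weight_nz[of x] unfolding S_def slab_interval by auto
    qed
    hence x3': "W.symb 3 0 0 (\<lambda>_ x. inverse (x $ 3))" by simp
    have "W.symb 3 (0 + (0 + (0 + 0))) (1 + (1 + (1 + 0))) (\<lambda>_ x. x $ 1 * (x $ 2 * ((x $ 1 + x $ 2) * inverse (x $ 3))))"
      by (intro W.sy_mult x1 x2 W.sy_add x3')
    from W.sy_cmult[OF W.sy_cmult[OF this, of 2], of "- (\<epsilon> * c)"] show ?thesis
      by (simp add: b3_def[abs_def])
  qed
  obtain e where e: "0 < e" "\<And>t. \<bar>t - tk k\<bar> < e \<Longrightarrow> t \<in> slab k"
    using open_slab[of k] tk_slab[of k] unfolding open_dist dist_real_def by blast
  \<comment> \<open>The first bound keeps the support inside the slab. By the second,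
    \<open>face4 x\<close> is at least tk - 5 delta, hence at least tk / 2, on the support.\<close>
  define \<delta> where "\<delta> = min (e / 2) (tk k / 10)"
  have \<delta>: "0 < \<delta>" "\<delta> < e" "10 * \<delta> \<le> tk k" using e(1) cfun_tk(4)[of k] by (auto simp: \<delta>_def)
  interpret E: edge_model \<theta> S 10 "tk k" \<delta> \<gamma> 10 N h h1 h2 b3
    by unfold_locales (use gap N prof b3 Omega_bounds(3) in \<open>auto simp: S_def Omega_def\<close>)
  define VV where "VV = pert \<theta> \<gamma> (tk k) \<delta> N h"
  have VV0: "VV \<kappa> x = 0" if "bump (tk k) \<delta> x = 0" for \<kappa> x
    unfolding VV_def pert_def that by (rule sum.neutral) auto
  define near where "near x \<longleftrightarrow> \<bar>x $ 3 - tk k\<bar> \<le> \<delta> \<and> \<bar>x $ 1\<bar> \<le> \<delta> \<and> \<bar>x $ 2\<bar> \<le> \<delta>" for x :: "real^3"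
  have far: "\<exists>U. open U \<and> x \<in> U \<and> (\<forall>\<kappa>. \<forall>y\<in>U. VV \<kappa> y = 0)" if "\<not> near x" for x
  proof (intro exI[of _ "{x. \<delta> < \<bar>x $ 3 - tk k\<bar>} \<union> {x. \<delta> < \<bar>x $ 1\<bar>} \<union> {x. \<delta> < \<bar>x $ 2\<bar>}"] conjI)
    show "open ({x :: real^3. \<delta> < \<bar>x $ 3 - tk k\<bar>} \<union> {x. \<delta> < \<bar>x $ 1\<bar>} \<union> {x. \<delta> < \<bar>x $ 2\<bar>})"
      by (intro open_Un open_Collect_less continuous_intros)
    show "x \<in> {x. \<delta> < \<bar>x $ 3 - tk k\<bar>} \<union> {x. \<delta> < \<bar>x $ 1\<bar>} \<union> {x. \<delta> < \<bar>x $ 2\<bar>}"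
      using that by (auto simp: near_def)
    show "\<forall>\<kappa>. \<forall>y\<in>{x. \<delta> < \<bar>x $ 3 - tk k\<bar>} \<union> {x. \<delta> < \<bar>x $ 1\<bar>} \<union> {x. \<delta> < \<bar>x $ 2\<bar>}. VV \<kappa> y = 0"
      using \<delta>(1) by (auto intro!: VV0 bump_zero)
  qed
  have nearS: "x \<in> S" if "x \<in> Omega" "near x" for x
    using that e(2)[of "x $ 3"] \<delta> by (auto simp: S_def near_def)
  have VO: "sy 3 Omega rho 1 (2 + \<gamma>) VV"
  proof (rule sy_extend[OF weighted_Omega])
    show "sy 3 S rho 1 (2 + \<gamma>) VV" unfolding VV_def by (rule E.V_sy)
    show "\<exists>U. open U \<and> x \<in> U \<and> (\<forall>\<kappa>. \<forall>y\<in>U. VV \<kappa> y = 0)" if "x \<in> Omega" "x \<notin> S" for x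
      using far nearS that by (cases "near x") simp_all
  qed
  define FF where "FF \<kappa> = det_gap ub (VV \<kappa>)" for \<kappa>
  have FF0: "\<exists>U. open U \<and> x \<in> U \<and> (\<forall>\<kappa>. \<forall>y\<in>U. FF \<kappa> y = 0)" if "\<not> near x" for x
  proof -
    from far[OF that] obtain U where U: "open U" "x \<in> U" "\<forall>\<kappa>. \<forall>y\<in>U. VV \<kappa> y = 0" by (elim exE conjE)
    have "FF \<kappa> y = 0" if "y \<in> U" for \<kappa> y
      using hessian_cong[OF U(1) that, of "\<lambda>x. ub x + VV \<kappa> x" ub] U(3) by (simp add: FF_def det_gap_def)
    thus ?thesis using U(1,2) by (intro exI[of _ U]) simp
  qed
  have FO: "sy 1 Omega rho 1 1 FF"
  proof (rule sy_extend[OF weighted_Omega])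
    show "sy 1 S rho 1 1 FF" unfolding FF_def VV_def det_gap_def
      by (rule E.det_difference_sy) (rule ubS)
    show "\<exists>U. open U \<and> x \<in> U \<and> (\<forall>\<kappa>. \<forall>y\<in>U. FF \<kappa> y = 0)" if "x \<in> Omega" "x \<notin> S" for x
      using FF0 nearS that by (cases "near x") simp_all
  qed
  interpret O: weighted Omega rho 10 by (rule weighted_Omega)
  have VD: "sy 1 Omega rho 1 \<gamma> (\<lambda>\<kappa>. iter_D is (VV \<kappa>))" if "length is \<le> 2" for "is"
  proof -
    have "sy (3 - length is) Omega rho 1 (2 + \<gamma> - real (length is)) (\<lambda>\<kappa>. iter_D is (VV \<kappa>))"
      by (rule sy_iter[OF VO]) (use that in simp)
    hence "sy 1 Omega rho 1 (2 + \<gamma> - real (length is)) (\<lambda>\<kappa>. iter_D is (VV \<kappa>))"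
      by (rule sy_le[rotated]) (use that in simp)
    thus ?thesis by (rule O.sy_mono) (use that in auto)
  qed
  define L where "L = {is :: 3 list. length is \<le> 2}"
  have L: "finite L" unfolding L_def using finite_lists_length_le[of "UNIV :: 3 set" 2] by simp
  have "\<exists>C>0. \<forall>\<kappa> x. 0 < \<kappa> \<longrightarrow> \<kappa> \<le> 1 \<longrightarrow> x \<in> Omega \<longrightarrow> \<bar>iter_D is (VV \<kappa>) x\<bar> \<le> C * \<kappa>" if "is \<in> L" for "is"
  proof -
    have "length is \<le> 2" using that by (simp add: L_def)
    from O.wbound_mono[OF order_refl _ sy_wbound[OF VD[OF this]], of 0]
    have "wbound Omega rho 1 0 (\<lambda>\<kappa>. iter_D is (VV \<kappa>))" using gap(1) by simp
    from wbound_Omega_0[OF this] show ?thesis by metis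
  qed
  then obtain CV where CV: "\<And>is. is \<in> L \<Longrightarrow> 0 < CV is"
    "\<And>is \<kappa> x. is \<in> L \<Longrightarrow> 0 < \<kappa> \<Longrightarrow> \<kappa> \<le> 1 \<Longrightarrow> x \<in> Omega \<Longrightarrow> \<bar>iter_D is (VV \<kappa>) x\<bar> \<le> CV is * \<kappa>" by metis
  define C0 where "C0 = (\<Sum>is\<in>L. CV is)"
  have CV_le: "CV is \<le> C0" if "is \<in> L" for "is"
    unfolding C0_def by (rule member_le_sum) (use that L CV(1) in \<open>auto simp: less_imp_le\<close>)
  have C0: "0 < C0" using CV_le[of "[]"] CV(1)[of "[]"] by (simp add: L_def)
  obtain CF where CF: "0 < CF" "\<And>\<kappa> x. 0 < \<kappa> \<Longrightarrow> \<kappa> \<le> 1 \<Longrightarrow> x \<in> Omega \<Longrightarrow> \<bar>FF \<kappa> x\<bar> \<le> CF * \<kappa> ^ 1 * rho x powr 1"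
    using wboundE[OF sy_wbound[OF FO]] by blast
  have "wbound Omega rho 1 0 (\<lambda>\<kappa>. partial_D i (FF \<kappa>))" for i
    using sy_wbound[OF sy_partial[OF FO[unfolded One_nat_def]], of i] by simp
  from wbound_Omega_0[OF this]
  have "\<exists>C>0. \<forall>\<kappa> x. 0 < \<kappa> \<longrightarrow> \<kappa> \<le> 1 \<longrightarrow> x \<in> Omega \<longrightarrow> \<bar>partial_D i (FF \<kappa>) x\<bar> \<le> C * \<kappa>" for i
    by metis
  then obtain CP where CP: "\<And>i. 0 < CP i"
    "\<And>i \<kappa> x. 0 < \<kappa> \<Longrightarrow> \<kappa> \<le> 1 \<Longrightarrow> x \<in> Omega \<Longrightarrow> \<bar>partial_D i (FF \<kappa>) x\<bar> \<le> CP i * \<kappa>" by metis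
  define C1 where "C1 = (\<Sum>i\<in>UNIV. CP i)"
  have CP_le: "CP i \<le> C1" for i
    unfolding C1_def by (rule member_le_sum) (use CP(1) in \<open>auto simp: less_imp_le\<close>)
  have C1: "0 < C1" using CP_le[of 1] CP(1)[of 1] by simp
  \<comment> \<open>The bounds serve, in turn, the admissible range, the size of the derivatives,
    the gap bound (on the support \<open>face4\<close> is at least tk / 2 and \<open>face3\<close>
    at least 1), and the gradient of the gap.\<close>
  define \<kappa> where "\<kappa> = min (min 1 (\<eta> / C0)) (min (tk k / 2 / CF) (1 / C1))"
  have \<kappa>: "0 < \<kappa>" "\<kappa> \<le> 1" using \<eta> C0 CF(1) C1 cfun_tk(4)[of k] by (auto simp: \<kappa>_def)
  have \<kappa>C0: "C0 * \<kappa> \<le> \<eta>"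
  proof -
    have "\<kappa> \<le> \<eta> / C0" by (simp add: \<kappa>_def)
    thus ?thesis using C0 by (simp add: field_simps)
  qed
  have \<kappa>CF: "CF * \<kappa> \<le> tk k / 2"
  proof -
    have "\<kappa> \<le> tk k / 2 / CF" by (simp add: \<kappa>_def)
    thus ?thesis using CF by (simp add: field_simps)
  qed
  have \<kappa>C1: "C1 * \<kappa> \<le> 1"
  proof -
    have "\<kappa> \<le> 1 / C1" by (simp add: \<kappa>_def)
    thus ?thesis using C1 by (simp add: field_simps)
  qed
  have cont: "continuous_on tetra (VV \<kappa>)"
    unfolding VV_def pert_def[abs_def]
  proof (intro continuous_on_sum continuous_on_mult continuous_on_power continuous_on_const)
    show "continuous_on tetra (bump (tk k) \<delta>)"
      unfolding bump_def[abs_def] by (intro continuous_intros)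
    fix j assume j: "j \<in> {1..N}"
    show "continuous_on tetra (pol \<theta> (2 + real j * \<gamma>) (h j))"
      by (rule continuous_on_subset[OF E.pol_continuous_on[OF profiles_cn(3)[OF prof j]]])
        (use gap(1) in \<open>auto simp: tetra_def intro: add_pos_nonneg\<close>)
  qed
  have zero: "VV \<kappa> x = 0" if x: "x \<in> tetra" "x \<notin> Omega" for x
  proof -
    have nn: "0 \<le> x $ 1" "0 \<le> x $ 2" using x by (auto simp: tetra_def)
    consider "x $ 1 = 0 \<or> x $ 2 = 0" | "face3 x = 0" | "face4 x = 0"
      using x by (auto simp: tetra_def Omega_iff less_le)
    thus ?thesis
    proof cases
      case 1
      have "pol \<theta> (2 + real j * \<gamma>) (h j) x = 0" if j: "j \<in> {1..N}" for j
      proof (cases "x $ 1 + x $ 2 = 0")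
        case True
        hence "x $ 1 = 0" "x $ 2 = 0" using nn by auto
        thus ?thesis by (simp add: pol_def rad_def PX_def PY_def)
      next
        case False
        hence "0 < x $ 1 + x $ 2" using nn by linarith
        hence "ang \<theta> x = 0 \<or> ang \<theta> x = \<theta>" using 1 E.ang_faces by blast
        thus ?thesis using prof j by (auto simp: pol_def profiles_def)
      qed
      thus ?thesis unfolding VV_def pert_def by (intro sum.neutral) auto
    next
      case 2
      hence "\<delta> \<le> \<bar>x $ 3 - tk k\<bar>" using \<delta>(3) cfun_tk(5)[of k] cfun_tk(4)[of k] by (simp add: face3_def)
      thus ?thesis by (intro VV0 bump_zero) (use \<delta>(1) in auto)
    next
      case 3
      have "\<delta> \<le> \<bar>x $ 3 - tk k\<bar> \<or> \<delta> \<le> \<bar>x $ 1\<bar> \<or> \<delta> \<le> \<bar>x $ 2\<bar>"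
      proof (rule ccontr)
        assume "\<not> ?thesis"
        hence "x $ 1 < \<delta>" "x $ 2 < \<delta>" "tk k - \<delta> < x $ 3" by (auto simp: abs_if split: if_splits)
        thus False using 3 \<delta> by (simp add: face4_def)
      qed
      thus ?thesis by (intro VV0 bump_zero) (use \<delta>(1) in auto)
    qed
  qed
  have off: "VV \<kappa> x = 0" if "x $ 3 \<notin> slab k" for x
  proof -
    have "e \<le> \<bar>x $ 3 - tk k\<bar>" using e(2)[of "x $ 3"] that by (meson not_le)
    thus ?thesis by (intro VV0 bump_zero) (use \<delta> in auto)
  qed
  have bd: "\<bar>iter_D is (VV \<kappa>) x\<bar> \<le> \<eta>" if "length is \<le> 2" "x \<in> Omega" for "is" x
  proof -
    have l: "is \<in> L" using that by (simp add: L_def)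
    have "\<bar>iter_D is (VV \<kappa>) x\<bar> \<le> CV is * \<kappa>" by (rule CV(2)[OF l \<kappa> that(2)])
    also have "\<dots> \<le> C0 * \<kappa>" using CV_le[OF l] \<kappa> by (intro mult_right_mono) auto
    finally show ?thesis using \<kappa>C0 by linarith
  qed
  have Fb: "\<bar>FF \<kappa> x\<bar> \<le> rho x * (face3 x * face4 x)" if x: "x \<in> Omega" for x
  proof (cases "near x")
    case False
    from FF0[OF False] obtain U where "x \<in> U" "\<forall>\<kappa>. \<forall>y\<in>U. FF \<kappa> y = 0" by (elim exE conjE)
    hence "FF \<kappa> x = 0" by blast
    thus ?thesis using x Omega_bounds(1)[OF x] by (auto simp: Omega_iff intro!: mult_nonneg_nonneg)
  next
    case True
    have r: "0 < rho x" by (rule Omega_bounds(1)[OF x])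
    have "x $ 1 \<le> \<delta>" "x $ 2 \<le> \<delta>" "tk k - \<delta> \<le> x $ 3" "x $ 3 \<le> tk k + \<delta>" using True by (auto simp: near_def)
    hence f: "tk k / 2 \<le> face4 x" "1 \<le> face3 x"
      using \<delta> cfun_tk(5)[of k] by (auto simp: face3_def face4_def)
    have "\<bar>FF \<kappa> x\<bar> \<le> CF * \<kappa> ^ 1 * rho x powr 1" by (rule CF(2)[OF \<kappa> x])
    also have "\<dots> = (CF * \<kappa>) * rho x" using r by simp
    also have "\<dots> \<le> (1 * (tk k / 2)) * rho x" using \<kappa>CF r by (intro mult_right_mono) auto
    also have "\<dots> \<le> (face3 x * face4 x) * rho x"
      using f r cfun_tk(4)[of k] by (intro mult_right_mono mult_mono) auto
    finally show ?thesis by (simp add: mult_ac)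
  qed
  have Fp: "\<bar>partial_D i (FF \<kappa>) x\<bar> \<le> 1" if x: "x \<in> Omega" for x i
  proof -
    have "\<bar>partial_D i (FF \<kappa>) x\<bar> \<le> CP i * \<kappa>" by (rule CP(2)[OF \<kappa> x])
    also have "\<dots> \<le> C1 * \<kappa>" using CP_le \<kappa> by (intro mult_right_mono) auto
    finally show ?thesis using \<kappa>C1 by linarith
  qed
  have "slab_perturbation ub \<epsilon> k \<eta> (VV \<kappa>)"
    unfolding slab_perturbation_def
  proof (intro conjI ballI allI impI)
    show "continuous_on tetra (VV \<kappa>)" by (rule cont)
    show "VV \<kappa> x = 0" if "x \<in> tetra - Omega" for x using zero that by auto
    show "VV \<kappa> x = 0" if "x $ 3 \<notin> slab k" for x using off that by auto
    show "\<bar>VV \<kappa> x\<bar> \<le> \<eta>" if "x \<in> tetra" for x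
      using bd[of "[]" x] zero[of x] that \<eta> by (cases "x \<in> Omega") auto
    show "uniformly_continuous_on Omega (iter_D is (VV \<kappa>))" if "length is \<le> 2" for "is"
      by (rule uniformly_continuous_weighted[OF sy_fix[OF VD[OF that] \<kappa>]]) (use gap in auto)
    show "iter_D is (VV \<kappa>) differentiable at x" if "length is \<le> 2" "x \<in> Omega" for "is" x
      using sy_differentiable[OF VD[OF that(1), unfolded One_nat_def] \<kappa> that(2)] .
    show "\<bar>iter_D is (VV \<kappa>) x\<bar> \<le> \<eta>" if "length is \<le> 2" "x \<in> Omega" for "is" x by (rule bd[OF that])
    show "\<bar>det_gap ub (VV \<kappa>) x\<bar> \<le> rho x * (face3 x * face4 x)" if "x \<in> Omega" for x
      using Fb[OF that] by (simp add: FF_def)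
    show "det_gap ub (VV \<kappa>) differentiable at x" if "x \<in> Omega" for x
      using sy_differentiable[OF FO[unfolded One_nat_def] \<kappa> that] by (simp add: FF_def)
    show "\<bar>partial_D i (det_gap ub (VV \<kappa>)) x\<bar> \<le> 1" if "x \<in> Omega" for x i
      using Fp[OF that] by (simp add: FF_def)
    show "\<not> hoelder_on \<alpha> (Omega \<inter> {x. x $ 3 \<in> slab k}) (iter_D [1, 1] (\<lambda>x. ub x + VV \<kappa> x))"
      if "edge_gap \<epsilon> k < \<alpha>" for \<alpha>
      unfolding S_def[symmetric] VV_def
    proof (rule E.not_hoelder[OF ubS \<kappa> \<delta>(1)])
      show "\<gamma> < \<alpha>" using that by (simp add: \<gamma>_def)
      show "0 < tk k / 10" using cfun_tk(4) by simp
      show "E.diag s \<in> S" if "0 < s" "s < tk k / 10" for s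
        using that cfun_tk(5)[of k] tk_slab[of k] by (simp add: E.diag_def S_def Omega_def)
    qed
  qed
  thus ?thesis by blast
qed

section \<open>The boundary data\<close>

lemma iter_D_append: "iter_D (is @ js) f = iter_D is (iter_D js f)"
  by (induction "is") auto

lemma smooth_partial: "smooth f \<Longrightarrow> smooth (partial_D i f)"
  unfolding smooth_def using iter_D_append[of _ "[i]" f] by (metis iter_D.simps)

lemma smooth_differentiable: "smooth f \<Longrightarrow> f differentiable at x"
  unfolding smooth_def by (metis iter_D.simps(1))

lemma weighted_box3_1: "weighted box3 (\<lambda>_. 1) 1"
  by unfold_locales (auto simp: open_box3)

interpretation bx: weighted box3 "\<lambda>_. 1" 1 by (rule weighted_box3_1)

lemma bounded_box3: "bounded box3"
proof -
  have "box3 \<subseteq> cbox (vector [-11,-11,0]) (vector [11,11,11])"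
    by (auto simp: mem_box_cart forall_3 box3_def)
  thus ?thesis by (rule bounded_subset[OF bounded_cbox])
qed

lemma continuous_bounded_box3:
  assumes "continuous_on UNIV (f :: real^3 \<Rightarrow> real)"
  shows "\<exists>B. \<forall>x\<in>box3. \<bar>f x\<bar> \<le> B"
proof -
  have "compact (closure box3)" using bounded_box3 compact_closure by blast
  hence "compact (f ` closure box3)"
    by (rule compact_continuous_image[rotated]) (rule continuous_on_subset[OF assms], simp)
  then obtain B where "\<forall>y\<in>f ` closure box3. norm y \<le> B" using compact_imp_bounded bounded_iff by blast
  thus ?thesis using closure_subset[of box3] by (intro exI[of _ B]) (auto simp: subset_iff)
qed

lemma smooth_sy: "smooth f \<Longrightarrow> sy n box3 (\<lambda>_. 1) 0 d (\<lambda>_. f)"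
proof (induction n arbitrary: d f)
  have w: "wbound box3 (\<lambda>_. 1) 0 d (\<lambda>_. f)" if "smooth f" for d f
  proof -
    have "continuous_on UNIV f"
      using smooth_differentiable[OF that] differentiable_imp_continuous_within
      by (auto simp: continuous_on_eq_continuous_within)
    then obtain B where "\<forall>x\<in>box3. \<bar>f x\<bar> \<le> B" using continuous_bounded_box3 by blast
    thus ?thesis by (intro wboundI[where C = B]) simp
  qed
  {
    case 0
    thus ?case using w by simp
  next
    case (Suc n)
    show ?case
      using w[OF Suc.prems] Suc.IH[OF smooth_partial[OF Suc.prems]] smooth_differentiable[OF Suc.prems] by simp
  }
qed

lemma component_sy_1: "bx.symb n 0 0 (\<lambda>_ x. x $ i)"
proof (rule bx.sy_component)
  have "\<forall>i. \<bar>x $ i\<bar> \<le> 11" if "x \<in> box3" for x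
    using that by (auto simp: box3_def forall_3)
  thus "wbound box3 (\<lambda>_. 1) 0 0 (\<lambda>_ x. x $ i)" by (intro wboundI[where C = 11]) auto
qed simp

lemma sy_mult1: "bx.symb n 0 0 f \<Longrightarrow> bx.symb n 0 0 g \<Longrightarrow> bx.symb n 0 0 (\<lambda>k x. f k x * g k x)"
  using bx.sy_mult[of n 0 0 f 0 0 g] by simp

definition psi :: "(real^3 \<Rightarrow> real) \<Rightarrow> real^3 \<Rightarrow> real" where "psi \<zeta> x = x $ 1 * (x $ 2 * \<zeta> x)"

lemma psi_sy: "smooth \<zeta> \<Longrightarrow> bx.symb n 0 0 (\<lambda>_. psi \<zeta>)"
  unfolding psi_def[abs_def] by (intro sy_mult1 component_sy_1 smooth_sy)

lemma quad_sy: "bx.symb n 0 0 (\<lambda>_. quad c)"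
proof -
  have "bx.symb n 0 0 (\<lambda>_ x. 1/2 * (x $ 1 * x $ 1 + x $ 2 * x $ 2 + x $ 3 * x $ 3) + c * (x $ 1 * x $ 2))"
    by (intro bx.sy_add bx.sy_cmult sy_mult1 component_sy_1)
  thus ?thesis by (simp add: quad_def[abs_def])
qed

lemma phi_eq: "phi lam \<zeta> = (\<lambda>x. quad 0 x + lam * psi \<zeta> x)"
proof
  fix x :: "real^3"
  have "(norm x)\<^sup>2 = x $ 1 * x $ 1 + x $ 2 * x $ 2 + x $ 3 * x $ 3"
    by (simp add: power2_norm_eq_inner inner_vec_def sum_3)
  thus "phi lam \<zeta> x = quad 0 x + lam * psi \<zeta> x" by (simp add: phi_def quad_def psi_def mult_ac)
qed

definition base :: "real \<Rightarrow> (real^3 \<Rightarrow> real) \<Rightarrow> real \<Rightarrow> real^3 \<Rightarrow> real" where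
  "base lam \<zeta> \<epsilon> x = quad 0 x + (lam * psi \<zeta> x + \<epsilon> * Vb x)"

lemma base_sy: "smooth \<zeta> \<Longrightarrow> bx.symb 3 0 0 (\<lambda>_. base lam \<zeta> \<epsilon>)"
  unfolding base_def[abs_def] by (intro bx.sy_add bx.sy_cmult quad_sy psi_sy Vb_bounded)

lemma bounded_hessian:
  assumes "bx.symb 3 0 0 (\<lambda>_. g)"
  shows "\<exists>B>0. \<forall>x\<in>box3. \<forall>i j. \<bar>iter_D [i, j] g x\<bar> \<le> B"
proof -
  have "\<exists>B>0. \<forall>x\<in>box3. \<bar>iter_D [i, j] g x\<bar> \<le> B" for i j
  proof -
    have "wbound box3 (\<lambda>_. 1) 0 (0 - real (length [i, j])) (\<lambda>_. iter_D [i, j] g)"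
      by (rule sy_wbound[OF sy_iter[OF assms]]) simp
    then obtain C where "C > 0" "\<And>k x. 0 < (k::real) \<Longrightarrow> k \<le> 1 \<Longrightarrow> x \<in> box3 \<Longrightarrow> \<bar>iter_D [i, j] g x\<bar> \<le> C * k ^ 0 * 1 powr (0 - real (length [i, j]))"
      using wboundE by metis
    thus ?thesis by (intro exI[of _ C]) (auto intro: zero_less_one)
  qed
  then obtain B where B: "\<And>i j. B i j > 0" "\<And>i j x. x \<in> box3 \<Longrightarrow> \<bar>iter_D [i, j] g x\<bar> \<le> B i j" by metis
  define M where "M = (\<Sum>i\<in>UNIV. \<Sum>j\<in>UNIV. B i j)"
  have le: "B i j \<le> M" for i j
  proof -
    have "B i j \<le> (\<Sum>j\<in>UNIV. B i j)" by (rule member_le_sum) (use B in \<open>auto simp: less_imp_le\<close>)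
    also have "\<dots> \<le> M" unfolding M_def by (rule member_le_sum) (use B in \<open>auto simp: less_imp_le intro!: sum_nonneg\<close>)
    finally show ?thesis .
  qed
  have "0 < M" using B(1)[of 1 1] le[of 1 1] by linarith
  thus ?thesis using B(2) le by (intro exI[of _ M]) (meson order_trans)
qed

lemma twice_box: "bx.symb 3 0 0 (\<lambda>_. g) \<Longrightarrow> twice box3 g"
  by (rule sy_twice[OF sy_le[of 2 3]]) simp_all

lemma iter_D2_cmult:
  fixes g :: "real^3 \<Rightarrow> real"
  assumes "open S" "x \<in> S" "twice S g"
  shows "iter_D [i, j] (\<lambda>x. c * g x) x = c * iter_D [i, j] g x"
proof -
  have c: "partial_D j (\<lambda>_. c) = (\<lambda>_. 0)" for j by (rule ext) simp
  show ?thesis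
    using iter_D2_mult[OF assms(1,2), of "\<lambda>_. c" g i j] assms(3) by (simp add: twice_def c)
qed

lemma twice_add: "open S \<Longrightarrow> twice S f \<Longrightarrow> twice S g \<Longrightarrow> twice S (\<lambda>x. f x + g x)"
proof -
  assume a: "open S" "twice S f" "twice S g"
  have "partial_D j (\<lambda>x. f x + g x) differentiable at y" if y: "y \<in> S" for y j
    by (rule differentiable_cong_open[OF a(1) y, of "\<lambda>x. partial_D j f x + partial_D j g x"])
      (use a y in \<open>auto simp: twice_def partial_D_add intro!: differentiable_add\<close>)
  thus ?thesis using a by (auto simp: twice_def intro!: differentiable_add)
qed

lemma base_hessian:
  assumes "smooth \<zeta>" "x \<in> box3"
  shows "iter_D [i, j] (phi lam \<zeta>) x = (if i = j then 1 else 0) + lam * iter_D [i, j] (psi \<zeta>) x"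
    and "iter_D [i, j] (base lam \<zeta> \<epsilon>) x =
      (if i = j then 1 else 0) + (lam * iter_D [i, j] (psi \<zeta>) x + \<epsilon> * iter_D [i, j] Vb x)"
proof -
  have q: "twice box3 (quad 0)" by (rule twice_box[OF quad_sy])
  have p: "twice box3 (\<lambda>x. lam * psi \<zeta> x)" "twice box3 (psi \<zeta>)"
    by (rule twice_box; intro bx.sy_cmult psi_sy assms)+
  have v: "twice box3 (\<lambda>x. \<epsilon> * Vb x)" "twice box3 Vb"
    by (rule twice_box; intro bx.sy_cmult Vb_bounded)+
  have A: "iter_D [i, j] (\<lambda>x. f x + g x) x = iter_D [i, j] f x + iter_D [i, j] g x"
    if "twice box3 f" "twice box3 g" for f g
    by (rule iter_D2_add[OF open_box3 assms(2)]) (use that in \<open>auto simp: twice_def\<close>)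
  have Q: "iter_D [i, j] (quad 0) x = (if i = j then 1 else 0)"
    unfolding quad_hessian quad_hess_def by simp
  show "iter_D [i, j] (phi lam \<zeta>) x = (if i = j then 1 else 0) + lam * iter_D [i, j] (psi \<zeta>) x"
    unfolding phi_eq A[OF q p(1)] Q iter_D2_cmult[OF open_box3 assms(2) p(2)] ..
  show "iter_D [i, j] (base lam \<zeta> \<epsilon>) x =
      (if i = j then 1 else 0) + (lam * iter_D [i, j] (psi \<zeta>) x + \<epsilon> * iter_D [i, j] Vb x)"
    unfolding base_def[abs_def] A[OF q twice_add[OF open_box3 p(1) v(1)]] Q A[OF p(1) v(1)]
      iter_D2_cmult[OF open_box3 assms(2) p(2)] iter_D2_cmult[OF open_box3 assms(2) v(2)] ..
qed

section \<open>Rank two Hessians and the strict inequality on the edges\<close>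

definition rank2 :: "3 \<Rightarrow> (3 \<Rightarrow> real) \<Rightarrow> 3 \<Rightarrow> 3 \<Rightarrow> real" where
  "rank2 l h i j = (if i = l then 1 else 0) * h j + (if j = l then 1 else 0) * h i"

text \<open>For a unit vector e, det(I + e h^t + h e^t) = (1 + e.h)^2 - |h|^2. Hessians of products
  with a factor vanishing at the point have this form, e and h being gradients of the factors up to
  scaling.\<close>

lemma det3_rank2: "det3 (\<lambda>i j. (if i = j then 1 else 0) + rank2 l h i j) = (1 + h l)\<^sup>2 - ((h 1)\<^sup>2 + (h 2)\<^sup>2 + (h 3)\<^sup>2)"
proof -
  have "\<forall>l. det3 (\<lambda>i j. (if i = j then 1 else 0) + rank2 l h i j) = (1 + h l)\<^sup>2 - ((h 1)\<^sup>2 + (h 2)\<^sup>2 + (h 3)\<^sup>2)"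
    unfolding forall_3 det3_def rank2_def by (simp add: power2_eq_square algebra_simps)
  thus ?thesis by blast
qed

lemma rank2_add: "c * rank2 l g i j + d * rank2 l h i j = rank2 l (\<lambda>i. c * g i + d * h i) i j"
  by (simp add: rank2_def algebra_simps)

lemma rank2_cmult: "c * rank2 l g i j = rank2 l (\<lambda>i. c * g i) i j"
  by (simp add: rank2_def algebra_simps)

lemma apex_nth: "apex $ 1 = 0" "apex $ 2 = 0" "apex $ 3 = 10"
  by (simp_all add: apex_def)

definition cutoff_at_apex :: "(real^3 \<Rightarrow> real) \<Rightarrow> bool" where
  "cutoff_at_apex \<zeta> \<longleftrightarrow> smooth \<zeta> \<and> (\<forall>x\<in>ball apex (1/2). \<zeta> x = 1) \<and> (\<forall>x. x \<notin> ball apex 1 \<longrightarrow> \<zeta> x = 0)"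

text \<open>The strict inequality puts the point into the open complement of the closed unit ball,
  where the cut-off vanishes identically together with all derivatives.\<close>

lemma cutoff_zero_near:
  assumes "cutoff_at_apex \<zeta>" "1 < \<bar>x $ i - apex $ i\<bar>"
  shows "iter_D is (psi \<zeta>) x = 0" "iter_D is \<zeta> x = 0"
proof -
  have op: "open (- cball apex 1 :: (real^3) set)" by (simp add: open_Compl)
  have x: "x \<in> - cball apex 1" using assms(2) dist_vec_nth_le[of x i apex] by (simp add: dist_real_def dist_commute)
  show "iter_D is \<zeta> x = 0" "iter_D is (psi \<zeta>) x = 0"
    by (rule iter_D_zero_near(1)[OF op x]; use assms(1) in \<open>auto simp: cutoff_at_apex_def psi_def\<close>)+
qed

lemma psi_hessian_face:
  assumes "smooth \<zeta>" "x \<in> box3"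
  shows "x $ 1 = 0 \<Longrightarrow> iter_D [i, j] (psi \<zeta>) x =
      rank2 1 (\<lambda>j. x $ 2 * partial_D j \<zeta> x + (if j = 2 then 1 else 0) * \<zeta> x) i j"
    and "x $ 2 = 0 \<Longrightarrow> iter_D [i, j] (psi \<zeta>) x =
      rank2 2 (\<lambda>j. x $ 1 * partial_D j \<zeta> x + (if j = 1 then 1 else 0) * \<zeta> x) i j"
proof -
  have c: "twice box3 (\<lambda>x. x $ i)" for i by (rule twice_box[OF component_sy_1])
  have X: "twice box3 (\<lambda>x. x $ i * \<zeta> x)" for i
    by (rule twice_box[OF sy_mult1[OF component_sy_1 smooth_sy[OF assms(1)]]])
  have z: "iter_D [i, j] (\<lambda>x. x $ l) x = 0" for l
  proof -
    have "partial_D j (\<lambda>x. x $ l) = (\<lambda>_. if j = l then 1 else 0)" by (rule ext) simp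
    thus ?thesis by simp
  qed
  have d: "partial_D j (\<lambda>x. x $ l * \<zeta> x) x = x $ l * partial_D j \<zeta> x + (if j = l then 1 else 0) * \<zeta> x" for l j
    by (subst partial_D_mult) (simp_all add: smooth_differentiable[OF assms(1)])
  show "x $ 1 = 0 \<Longrightarrow> iter_D [i, j] (psi \<zeta>) x =
      rank2 1 (\<lambda>j. x $ 2 * partial_D j \<zeta> x + (if j = 2 then 1 else 0) * \<zeta> x) i j"
    unfolding psi_def[abs_def]
    by (subst twice_hessian_product[OF open_box3 assms(2) c X], assumption)
      (simp add: z d rank2_def del: iter_D.simps)
  have e: "psi \<zeta> = (\<lambda>x. x $ 2 * (x $ 1 * \<zeta> x))" by (simp add: psi_def[abs_def] mult_ac)
  show "x $ 2 = 0 \<Longrightarrow> iter_D [i, j] (psi \<zeta>) x =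
      rank2 2 (\<lambda>j. x $ 1 * partial_D j \<zeta> x + (if j = 1 then 1 else 0) * \<zeta> x) i j"
    unfolding e
    by (subst twice_hessian_product[OF open_box3 assms(2) c X], assumption)
      (simp add: z d rank2_def del: iter_D.simps)
qed

lemma face_partial:
  "partial_D j face3 x = (if j = 3 then - 1 else 0)" "partial_D j face4 x = (if j = 3 then 1 else - 2)"
proof -
  have "(face3 has_derivative (\<lambda>v. - v $ 3)) (at x)"
    unfolding face3_def[abs_def]
    using has_derivative_diff[OF has_derivative_const[of 10 "at x"] bounded_linear_imp_has_derivative[OF bounded_linear_vec_nth[of 3], of "at x"]] by simp
  from partial_D_eq[OF this] show "partial_D j face3 x = (if j = 3 then - 1 else 0)" by (simp add: axis_def)
  have "bounded_linear face4"
    unfolding face4_def[abs_def]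
    by (intro bounded_linear_sub bounded_linear_const_mult bounded_linear_add bounded_linear_vec_nth)
  hence "(face4 has_derivative face4) (at x)" by (rule bounded_linear_imp_has_derivative)
  from partial_D_eq[OF this, of j] have "partial_D j face4 x = face4 (axis j 1)" .
  moreover have "\<forall>j. face4 (axis j 1) = (if j = 3 then 1 else - 2)"
    unfolding forall_3 by (simp add: face4_def axis_def)
  ultimately show "partial_D j face4 x = (if j = 3 then 1 else - 2)" by simp
qed

text \<open>\<open>hessian_two_zeros\<close> for the two factors that vanish on the edge; the
  vectors are gradients of the face functions. On the last edge the sign of the gradient of
  \<open>face3\<close> has been moved to the other vector.\<close>

lemma Vb_hessian_edge:
  assumes x: "x \<in> box3"
  shows "x $ 1 = 0 \<Longrightarrow> x $ 2 = 0 \<Longrightarrow> iter_D [i, j] Vb x =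
      (face3 x * face4 x * qfun (x $ 3)) * rank2 1 (\<lambda>j. if j = 2 then 1 else 0) i j"
    and "x $ 1 = 0 \<Longrightarrow> face3 x = 0 \<Longrightarrow> iter_D [i, j] Vb x =
      (x $ 2 * face4 x * qfun (x $ 3)) * rank2 1 (\<lambda>j. if j = 3 then - 1 else 0) i j"
    and "x $ 2 = 0 \<Longrightarrow> face3 x = 0 \<Longrightarrow> iter_D [i, j] Vb x =
      (x $ 1 * face4 x * qfun (x $ 3)) * rank2 2 (\<lambda>j. if j = 3 then - 1 else 0) i j"
    and "x $ 1 = 0 \<Longrightarrow> face4 x = 0 \<Longrightarrow> iter_D [i, j] Vb x =
      (x $ 2 * face3 x * qfun (x $ 3)) * rank2 1 (\<lambda>j. if j = 3 then 1 else - 2) i j"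
    and "x $ 2 = 0 \<Longrightarrow> face4 x = 0 \<Longrightarrow> iter_D [i, j] Vb x =
      (x $ 1 * face3 x * qfun (x $ 3)) * rank2 2 (\<lambda>j. if j = 3 then 1 else - 2) i j"
    and "face3 x = 0 \<Longrightarrow> face4 x = 0 \<Longrightarrow> iter_D [i, j] Vb x =
      (x $ 1 * x $ 2 * qfun (x $ 3)) * rank2 3 (\<lambda>j. if j = 3 then - 1 else 2) i j"
proof -
  have c: "twice box3 (\<lambda>x. x $ i)" for i by (rule twice_box[OF component_sy_1])
  have f3: "twice box3 face3" and f4: "twice box3 face4"
    by (rule sy_twice, rule polynomial_sy)+
  have q: "twice box3 (\<lambda>x. qfun (x $ 3))" by (rule twice_box, rule box.sy_bounded[OF qfun_sy]) simp
  note m = twice_mult[OF open_box3]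
  note H = hessian_two_zeros[OF open_box3 x]
  have e: "Vb = (\<lambda>x. x $ 1 * x $ 2 * (face3 x * face4 x * qfun (x $ 3)))"
    "Vb = (\<lambda>x. x $ 1 * face3 x * (x $ 2 * face4 x * qfun (x $ 3)))"
    "Vb = (\<lambda>x. x $ 2 * face3 x * (x $ 1 * face4 x * qfun (x $ 3)))"
    "Vb = (\<lambda>x. x $ 1 * face4 x * (x $ 2 * face3 x * qfun (x $ 3)))"
    "Vb = (\<lambda>x. x $ 2 * face4 x * (x $ 1 * face3 x * qfun (x $ 3)))"
    "Vb = (\<lambda>x. face3 x * face4 x * (x $ 1 * x $ 2 * qfun (x $ 3)))"
    by (auto simp: Vb_def fun_eq_iff)
  show "x $ 1 = 0 \<Longrightarrow> x $ 2 = 0 \<Longrightarrow> iter_D [i, j] Vb x =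
      (face3 x * face4 x * qfun (x $ 3)) * rank2 1 (\<lambda>j. if j = 2 then 1 else 0) i j"
    unfolding e(1) by (subst H[OF c c m[OF m[OF f3 f4] q]]) (simp_all add: rank2_def)
  show "x $ 1 = 0 \<Longrightarrow> face3 x = 0 \<Longrightarrow> iter_D [i, j] Vb x =
      (x $ 2 * face4 x * qfun (x $ 3)) * rank2 1 (\<lambda>j. if j = 3 then - 1 else 0) i j"
    unfolding e(2) by (subst H[OF c f3 m[OF m[OF c f4] q]]) (simp_all add: rank2_def face_partial)
  show "x $ 2 = 0 \<Longrightarrow> face3 x = 0 \<Longrightarrow> iter_D [i, j] Vb x =
      (x $ 1 * face4 x * qfun (x $ 3)) * rank2 2 (\<lambda>j. if j = 3 then - 1 else 0) i j"
    unfolding e(3) by (subst H[OF c f3 m[OF m[OF c f4] q]]) (simp_all add: rank2_def face_partial)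
  show "x $ 1 = 0 \<Longrightarrow> face4 x = 0 \<Longrightarrow> iter_D [i, j] Vb x =
      (x $ 2 * face3 x * qfun (x $ 3)) * rank2 1 (\<lambda>j. if j = 3 then 1 else - 2) i j"
    unfolding e(4) by (subst H[OF c f4 m[OF m[OF c f3] q]]) (simp_all add: rank2_def face_partial)
  show "x $ 2 = 0 \<Longrightarrow> face4 x = 0 \<Longrightarrow> iter_D [i, j] Vb x =
      (x $ 1 * face3 x * qfun (x $ 3)) * rank2 2 (\<lambda>j. if j = 3 then 1 else - 2) i j"
    unfolding e(5) by (subst H[OF c f4 m[OF m[OF c f3] q]]) (simp_all add: rank2_def face_partial)
  show "face3 x = 0 \<Longrightarrow> face4 x = 0 \<Longrightarrow> iter_D [i, j] Vb x =
      (x $ 1 * x $ 2 * qfun (x $ 3)) * rank2 3 (\<lambda>j. if j = 3 then - 1 else 2) i j"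
    unfolding e(6) by (subst H[OF f3 f4 m[OF m[OF c c] q]], assumption, assumption, unfold rank2_def face_partial)
      (cases "i = 3"; cases "j = 3"; simp)
qed

lemma rank2_det_less:
  assumes "smooth \<zeta>" "x \<in> box3"
    and g: "\<And>i j. iter_D [i, j] (psi \<zeta>) x = rank2 l g i j" and n: "\<And>i j. iter_D [i, j] Vb x = s * rank2 l n i j"
    and less: "(1 + (lam * g l + \<epsilon> * s * n l))\<^sup>2 - ((lam * g 1 + \<epsilon> * s * n 1)\<^sup>2 + (lam * g 2 + \<epsilon> * s * n 2)\<^sup>2 + (lam * g 3 + \<epsilon> * s * n 3)\<^sup>2)
      < (1 + lam * g l)\<^sup>2 - ((lam * g 1)\<^sup>2 + (lam * g 2)\<^sup>2 + (lam * g 3)\<^sup>2)"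
  shows "det (hessian (base lam \<zeta> \<epsilon>) x) < det (hessian (phi lam \<zeta>) x)"
proof -
  have "det (hessian (phi lam \<zeta>) x) = det3 (\<lambda>i j. (if i = j then 1 else 0) + rank2 l (\<lambda>i. lam * g i) i j)"
    unfolding det_hessian base_hessian(1)[OF assms(1,2)] g rank2_cmult ..
  moreover have "det (hessian (base lam \<zeta> \<epsilon>) x) = det3 (\<lambda>i j. (if i = j then 1 else 0) + rank2 l (\<lambda>i. lam * g i + \<epsilon> * s * n i) i j)"
    unfolding det_hessian base_hessian(2)[OF assms(1,2)] g n mult.assoc[symmetric] rank2_add ..
  ultimately show ?thesis unfolding det3_rank2 using less by simp
qed

lemma Gamma1_tetra: "Gamma1 Omega \<subseteq> tetra"
  by (auto simp: Gamma1_def Gamma0_def closure_Omega edge_of_def extreme_point_of_def dest: face_of_imp_subset)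

text \<open>Only the three edges at the apex meet the support of the cut-off. In its transition zone
  sign and slope are arbitrary, but there \<open>qfun \<ge> q0\<close>, and
  \<open>lam * B < \<epsilon> * q0\<close> lets the contribution of \<open>Vb\<close> dominate.
  Elsewhere on the edges the relevant terms are nonnegative or vanish.\<close>

lemma edge_det_less:
  assumes \<zeta>: "cutoff_at_apex \<zeta>" and x: "x \<in> Gamma1 Omega - Gamma0 Omega"
    and B: "\<And>y i. y \<in> box3 \<Longrightarrow> \<bar>partial_D i \<zeta> y\<bar> \<le> B" "\<And>y. y \<in> box3 \<Longrightarrow> \<bar>\<zeta> y\<bar> \<le> B"
    and q0: "0 < q0" "\<And>t. 9 \<le> t \<Longrightarrow> t \<le> 10 \<Longrightarrow> q0 \<le> qfun t"
    and lam: "0 < lam" "lam * B < \<epsilon> * q0" and \<epsilon>: "0 < \<epsilon>"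
  shows "det (hessian (base lam \<zeta> \<epsilon>) x) < det (hessian (phi lam \<zeta>) x)"
proof -
  have sm: "smooth \<zeta>" using \<zeta> by (simp add: cutoff_at_apex_def)
  have xt: "x \<in> tetra" using x Gamma1_tetra by auto
  have x3: "0 < x $ 3"
    using open_edge_cases[OF x] by (smt (verit))
  have xb: "x \<in> box3" by (rule tetra_box3[OF xt x3])
  have q: "0 < qfun (x $ 3)" using qfun_pos x3 tetra_bounds(6)[OF xt] by simp
  note less = rank2_det_less[OF sm xb]
  have ball: "x \<in> ball apex r" if "\<bar>x $ 1\<bar> + \<bar>x $ 2\<bar> + \<bar>x $ 3 - 10\<bar> < r" for r
  proof -
    have "dist x apex \<le> (\<Sum>i\<in>UNIV. \<bar>(x - apex) $ i\<bar>)" unfolding dist_norm by (rule norm_le_l1_cart)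
    thus ?thesis using that by (simp add: sum_3 apex_nth dist_commute)
  qed
  have nball: "\<zeta> x = 0" if "1 \<le> \<bar>x $ i - apex $ i\<bar>" for i
  proof -
    have "1 \<le> dist x apex" using that dist_vec_nth_le[of x i apex] by (simp add: dist_real_def)
    thus ?thesis using \<zeta> by (auto simp: cutoff_at_apex_def dist_commute)
  qed
  \<comment> \<open>Off the cut-off the determinant changes by 2 eps s n_l + (eps s)^2 (n_l^2 -
    |n|^2): the first term is negative and the second is not positive.\<close>
  have far: "det (hessian (base lam \<zeta> \<epsilon>) x) < det (hessian (phi lam \<zeta>) x)"
    if z: "\<And>i j. iter_D [i, j] (psi \<zeta>) x = 0" and n: "\<And>i j. iter_D [i, j] Vb x = s * rank2 l n i j"
      and s: "0 < s" "n l < 0" "(n l)\<^sup>2 \<le> (n 1)\<^sup>2 + (n 2)\<^sup>2 + (n 3)\<^sup>2" for l n s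
  proof (rule less[where l = l and g = "\<lambda>_. 0" and n = n and s = s])
    show "iter_D [i, j] (psi \<zeta>) x = rank2 l (\<lambda>_. 0) i j" for i j
      unfolding z rank2_def by simp
    have p: "0 < \<epsilon> * s" using s \<epsilon> by simp
    have "\<epsilon> * s * n l < 0" using p s(2) by (rule mult_pos_neg)
    moreover have "(\<epsilon> * s)\<^sup>2 * (n l)\<^sup>2 \<le> (\<epsilon> * s)\<^sup>2 * ((n 1)\<^sup>2 + (n 2)\<^sup>2 + (n 3)\<^sup>2)" using s(3) by (intro mult_left_mono) auto
    ultimately show "(1 + (lam * 0 + \<epsilon> * s * n l))\<^sup>2 - ((lam * 0 + \<epsilon> * s * n 1)\<^sup>2 + (lam * 0 + \<epsilon> * s * n 2)\<^sup>2 + (lam * 0 + \<epsilon> * s * n 3)\<^sup>2)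
      < (1 + lam * 0)\<^sup>2 - ((lam * 0)\<^sup>2 + (lam * 0)\<^sup>2 + (lam * 0)\<^sup>2)"
      by (simp add: power_mult_distrib power2_sum algebra_simps)
  qed (rule n)
  \<comment> \<open>Near the apex the cut-off is 1 and beyond distance 1 it is 0, so its derivative
    matters only for 1/2 <= x_l <= 1, where \<open>face4 x\<close> is at least 8.\<close>
  have top: "2 * (lam * (x $ l * partial_D 3 \<zeta> x)) < \<epsilon> * (x $ l * face4 x * qfun (x $ 3))"
    if l: "0 < x $ l" "x $ l < 5" "apex $ l = 0" "face4 x = 10 - 2 * x $ l" "\<bar>x $ 1\<bar> + \<bar>x $ 2\<bar> = x $ l" "x $ 3 = 10" for l
  proof (cases "x $ l < 1/2 \<or> 1 < x $ l")
    case True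
    have "partial_D 3 \<zeta> x = 0" using True
    proof
      assume "x $ l < 1/2"
      hence xb2: "x \<in> ball apex (1/2)" using l by (intro ball) auto
      have "partial_D 3 \<zeta> x = partial_D 3 (\<lambda>_. 1) x"
        by (rule partial_D_cong[OF open_ball xb2]) (use \<zeta> in \<open>auto simp: cutoff_at_apex_def\<close>)
      thus ?thesis by simp
    next
      assume "1 < x $ l"
      thus ?thesis using cutoff_zero_near(2)[OF \<zeta>, of x l "[3]"] l(3) by simp
    qed
    thus ?thesis using l q \<epsilon> by simp
  next
    case False
    have "x $ l * 8 * q0 \<le> x $ l * face4 x * qfun (x $ 3)"
      using False l q0 by (intro mult_mono) auto
    hence "\<epsilon> * (x $ l * 8 * q0) \<le> \<epsilon> * (x $ l * face4 x * qfun (x $ 3))" using \<epsilon> by (intro mult_left_mono) auto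
    moreover have "(lam * x $ l) * partial_D 3 \<zeta> x \<le> (lam * x $ l) * B"
      using B(1)[OF xb, of 3] lam l by (intro mult_left_mono) auto
    moreover have "x $ l * (lam * B) < x $ l * (\<epsilon> * q0)" using lam(2) l by (intro mult_strict_left_mono) auto
    moreover have "0 < x $ l * (\<epsilon> * q0)" using l \<epsilon> q0 by simp
    moreover have "\<epsilon> * (x $ l * 8 * q0) = 8 * (x $ l * (\<epsilon> * q0))" "(lam * x $ l) * B = x $ l * (lam * B)"
      "(lam * x $ l) * partial_D 3 \<zeta> x = lam * (x $ l * partial_D 3 \<zeta> x)" by simp_all
    ultimately show ?thesis by linarith
  qed
  show ?thesis using x
  proof (cases rule: open_edge_cases)
    case e12
    define s where "s = face3 x * face4 x * qfun (x $ 3)"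
    have sp: "0 < s" using e12 q by (simp add: s_def face3_def face4_def)
    \<comment> \<open>The determinant on this edge is 1 minus the square of the mixed entry, and the
      claim compares the two squares. The cut-off can be negative only at heights between 9 and
      19/2, where \<open>face3\<close> is at least 1/2 and \<open>face4\<close> exceeds 9.\<close>
    have zs: "0 < \<epsilon> * s * (\<epsilon> * s + 2 * (lam * \<zeta> x))"
    proof (cases "19/2 < x $ 3 \<or> x $ 3 \<le> 9")
      case True
      hence "0 \<le> \<zeta> x"
      proof
        assume "19/2 < x $ 3"
        hence "x \<in> ball apex (1/2)" using e12 by (intro ball) auto
        thus ?thesis using \<zeta> by (simp add: cutoff_at_apex_def)
      next
        assume "x $ 3 \<le> 9"
        thus ?thesis using nball[of 3] by (simp add: apex_nth)
      qed
      hence "0 \<le> lam * \<zeta> x" using lam by simp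
      thus ?thesis using sp \<epsilon> by (intro mult_pos_pos add_pos_nonneg) auto
    next
      case False
      have "(1/2) * 9 * q0 \<le> s" unfolding s_def
        using False e12 q0 by (intro mult_mono) (auto simp: face3_def face4_def)
      hence "\<epsilon> * ((1/2) * 9 * q0) \<le> \<epsilon> * s" using \<epsilon> by (intro mult_left_mono) auto
      moreover have "lam * \<bar>\<zeta> x\<bar> \<le> lam * B" using B(2)[OF xb] lam by (intro mult_left_mono) auto
      moreover have "lam * (- \<zeta> x) \<le> lam * \<bar>\<zeta> x\<bar>" using lam by (intro mult_left_mono) auto
      moreover have "- (lam * \<zeta> x) = lam * (- \<zeta> x)" by simp
      moreover have "0 < \<epsilon> * q0" using \<epsilon> q0 by simp
      moreover have "\<epsilon> * ((1/2) * 9 * q0) = 9/2 * (\<epsilon> * q0)" by simp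
      ultimately have "0 < \<epsilon> * s + 2 * (lam * \<zeta> x)" using lam(2) by linarith
      thus ?thesis using sp \<epsilon> by (intro mult_pos_pos) auto
    qed
    thus ?thesis using e12(2)
      by (intro less[OF psi_hessian_face(1)[OF sm xb e12(1)] Vb_hessian_edge(1)[OF xb e12(1,2)], folded s_def])
        (simp add: power2_eq_square algebra_simps)
  next
    case e13
    have f: "face3 x = 0" using e13 by (simp add: face3_def)
    define s where "s = x $ 2 * face4 x * qfun (x $ 3)"
    have sp: "0 < s" using e13 q by (simp add: s_def face4_def)
    have "2 * (lam * (x $ 2 * partial_D 3 \<zeta> x)) < \<epsilon> * s"
      unfolding s_def by (rule top) (use e13 in \<open>auto simp: apex_nth face4_def\<close>)
    hence "0 < \<epsilon> * s * (\<epsilon> * s - 2 * (lam * (x $ 2 * partial_D 3 \<zeta> x)))" using sp \<epsilon> by simp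
    thus ?thesis
      by (intro less[OF psi_hessian_face(1)[OF sm xb e13(1)] Vb_hessian_edge(2)[OF xb e13(1) f], folded s_def])
        (simp add: power2_eq_square algebra_simps)
  next
    case e23
    have f: "face3 x = 0" using e23 by (simp add: face3_def)
    define s where "s = x $ 1 * face4 x * qfun (x $ 3)"
    have sp: "0 < s" using e23 q by (simp add: s_def face4_def)
    have "2 * (lam * (x $ 1 * partial_D 3 \<zeta> x)) < \<epsilon> * s"
      unfolding s_def by (rule top) (use e23 in \<open>auto simp: apex_nth face4_def\<close>)
    hence "0 < \<epsilon> * s * (\<epsilon> * s - 2 * (lam * (x $ 1 * partial_D 3 \<zeta> x)))" using sp \<epsilon> by simp
    thus ?thesis
      by (intro less[OF psi_hessian_face(2)[OF sm xb e23(1)] Vb_hessian_edge(3)[OF xb e23(1) f], folded s_def])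
        (simp add: power2_eq_square algebra_simps)
  next
    case e14
    have f: "face4 x = 0" using e14 by (simp add: face4_def)
    have z: "iter_D [i, j] (psi \<zeta>) x = 0" for i j
    proof (cases "1 < x $ 2")
      case True
      thus ?thesis by (intro cutoff_zero_near(1)[OF \<zeta>, of x 2]) (simp add: apex_nth)
    next
      case False
      thus ?thesis using e14 by (intro cutoff_zero_near(1)[OF \<zeta>, of x 3]) (simp add: apex_nth)
    qed
    show ?thesis
      by (rule far[OF z Vb_hessian_edge(4)[OF xb e14(1) f]]) (use e14 q in \<open>auto simp: face3_def\<close>)
  next
    case e24
    have f: "face4 x = 0" using e24 by (simp add: face4_def)
    have z: "iter_D [i, j] (psi \<zeta>) x = 0" for i j
    proof (cases "1 < x $ 1")
      case True
      thus ?thesis by (intro cutoff_zero_near(1)[OF \<zeta>, of x 1]) (simp add: apex_nth)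
    next
      case False
      thus ?thesis using e24 by (intro cutoff_zero_near(1)[OF \<zeta>, of x 3]) (simp add: apex_nth)
    qed
    show ?thesis
      by (rule far[OF z Vb_hessian_edge(5)[OF xb e24(1) f]]) (use e24 q in \<open>auto simp: face3_def\<close>)
  next
    case e34
    have f: "face3 x = 0" "face4 x = 0" using e34 by (simp_all add: face3_def face4_def)
    have z: "iter_D [i, j] (psi \<zeta>) x = 0" for i j
    proof (cases "1 < x $ 1")
      case True
      thus ?thesis by (intro cutoff_zero_near(1)[OF \<zeta>, of x 1]) (simp add: apex_nth)
    next
      case False
      thus ?thesis using e34 by (intro cutoff_zero_near(1)[OF \<zeta>, of x 2]) (simp add: apex_nth)
    qed
    show ?thesis
      by (rule far[OF z Vb_hessian_edge(6)[OF xb f]]) (use e34 q in auto)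
  qed
qed

section \<open>Convexity from the Hessian\<close>

lemma line_derivative:
  fixes g :: "real^'n::finite \<Rightarrow> real"
  assumes "g differentiable at (x + s *\<^sub>R v)"
  shows "((\<lambda>s. g (x + s *\<^sub>R v)) has_real_derivative (\<Sum>i\<in>UNIV. v $ i * partial_D i g (x + s *\<^sub>R v))) (at s)"
proof -
  have 1: "((\<lambda>s. x + s *\<^sub>R v) has_derivative (\<lambda>h. h *\<^sub>R v)) (at s)"
    by (auto intro!: derivative_eq_intros)
  have "((\<lambda>s. g (x + s *\<^sub>R v)) has_derivative (\<lambda>h. \<Sum>i\<in>UNIV. (h *\<^sub>R v) $ i * partial_D i g (x + s *\<^sub>R v))) (at s)"
    by (rule has_derivative_compose[OF 1 has_derivative_partial_D[OF assms]])
  thus ?thesis unfolding has_field_derivative_def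
    by (rule has_derivative_eq_rhs) (simp add: fun_eq_iff sum_distrib_left mult_ac)
qed

text \<open>By |v_i v_j| <= (v_i^2 + v_j^2) / 2, entries of size 1/4 perturb the form by at most 3/4
  |v|^2, which the identity absorbs.\<close>

lemma quadratic_form_nonneg:
  fixes v :: "real^3"
  assumes "\<And>i j. \<bar>H i j - (if i = j then 1 else 0)\<bar> \<le> 1/4"
  shows "0 \<le> (\<Sum>i\<in>UNIV. v $ i * (\<Sum>j\<in>UNIV. v $ j * H j i))"
proof -
  define E where "E i j = H i j - (if i = j then 1 else 0)" for i j
  have E: "\<bar>v $ i * v $ j * E j i\<bar> \<le> \<bar>v $ i\<bar> * \<bar>v $ j\<bar> * (1/4)" for i j
    unfolding abs_mult using assms by (intro mult_left_mono) (auto simp: E_def)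
  have am: "\<bar>v $ i\<bar> * \<bar>v $ j\<bar> \<le> ((v $ i)\<^sup>2 + (v $ j)\<^sup>2) / 2" for i j
    using zero_le_power2[of "\<bar>v $ i\<bar> - \<bar>v $ j\<bar>"] by (simp add: power2_diff)
  have EE: "- (((v $ i)\<^sup>2 + (v $ j)\<^sup>2) / 8) \<le> v $ i * v $ j * E j i" for i j
    using E[of i j] am[of i j] by linarith
  define Q where "Q = (v $ 1)\<^sup>2 + (v $ 2)\<^sup>2 + (v $ 3)\<^sup>2"
  define T where "T = (\<Sum>i\<in>UNIV. \<Sum>j\<in>UNIV. v $ i * v $ j * E j i)"
  have "(\<Sum>i\<in>UNIV. v $ i * (\<Sum>j\<in>UNIV. v $ j * H j i)) = Q + T"
    unfolding E_def sum_3 Q_def T_def by (simp add: power2_eq_square algebra_simps)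
  moreover have "(\<Sum>i\<in>UNIV. \<Sum>j\<in>UNIV. - (((v $ i)\<^sup>2 + (v $ j)\<^sup>2) / 8)) \<le> T"
    unfolding T_def by (intro sum_mono EE)
  moreover have "(\<Sum>i\<in>UNIV. \<Sum>j\<in>UNIV. - (((v $ i)\<^sup>2 + (v $ j)\<^sup>2) / 8)) = - (3/4) * Q"
    unfolding sum_3 Q_def by (simp add: field_simps)
  moreover have "0 \<le> Q" by (simp add: Q_def)
  ultimately show ?thesis by simp
qed

lemma convex_from_hessian:
  assumes u: "twice Omega u" and H: "\<And>x i j. x \<in> Omega \<Longrightarrow> \<bar>iter_D [i, j] u x - (if i = j then 1 else 0)\<bar> \<le> 1/4"
  shows "convex_on Omega u"
  unfolding convex_on_def
proof (intro conjI convex_Omega ballI allI impI)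
  fix x y and a b :: real assume xy: "x \<in> Omega" "y \<in> Omega" and ab: "0 \<le> a" "0 \<le> b" "a + b = 1"
  define p where "p s = x + s *\<^sub>R (y - x)" for s
  have p: "p s \<in> Omega" if "s \<in> {0..1}" for s
  proof -
    have "p s = (1 - s) *\<^sub>R x + s *\<^sub>R y" by (simp add: p_def algebra_simps)
    thus ?thesis using that xy convex_Omega by (auto simp: convex_def)
  qed
  have "convex_on {0..1} (\<lambda>s. u (p s))"
  proof (rule f''_ge0_imp_convex[where f' = "\<lambda>s. \<Sum>i\<in>UNIV. (y - x) $ i * partial_D i u (p s)"
        and f'' = "\<lambda>s. \<Sum>i\<in>UNIV. (y - x) $ i * (\<Sum>j\<in>UNIV. (y - x) $ j * iter_D [j, i] u (p s))"])
    fix s :: real assume s: "s \<in> {0..1}"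
    show "((\<lambda>s. u (p s)) has_real_derivative (\<Sum>i\<in>UNIV. (y - x) $ i * partial_D i u (p s))) (at s)"
      unfolding p_def by (rule line_derivative) (use u p[OF s] in \<open>auto simp: twice_def p_def\<close>)
    have "((\<lambda>s. partial_D i u (p s)) has_real_derivative (\<Sum>j\<in>UNIV. (y - x) $ j * iter_D [j, i] u (p s))) (at s)" for i
      unfolding p_def iter_D.simps by (rule line_derivative) (use u p[OF s] in \<open>auto simp: twice_def p_def\<close>)
    thus "((\<lambda>s. \<Sum>i\<in>UNIV. (y - x) $ i * partial_D i u (p s)) has_real_derivative
        (\<Sum>i\<in>UNIV. (y - x) $ i * (\<Sum>j\<in>UNIV. (y - x) $ j * iter_D [j, i] u (p s)))) (at s)"
      by (intro DERIV_sum DERIV_cmult)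
    show "0 \<le> (\<Sum>i\<in>UNIV. (y - x) $ i * (\<Sum>j\<in>UNIV. (y - x) $ j * iter_D [j, i] u (p s)))"
      by (rule quadratic_form_nonneg) (rule H[OF p[OF s]])
  qed simp
  from convex_onD[OF this, of b 0 1] have "u (p b) \<le> (1 - b) * u (p 0) + b * u (p 1)"
    using ab by simp
  moreover have a: "a = 1 - b" using ab by simp
  moreover have "p b = a *\<^sub>R x + b *\<^sub>R y" by (simp add: p_def a algebra_simps)
  ultimately show "u (a *\<^sub>R x + b *\<^sub>R y) \<le> a * u x + b * u y" by (simp add: p_def)
qed

lemma convex_on_closure_Omega:
  assumes u: "convex_on Omega u" and c: "continuous_on tetra u"
  shows "convex_on tetra u"
  unfolding convex_on_def
proof (intro conjI ballI allI impI)
  show tc: "convex tetra" using convex_closure[OF convex_Omega] by (simp add: closure_Omega)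
  fix x y and a b :: real assume xy: "x \<in> tetra" "y \<in> tetra" and ab: "0 \<le> a" "0 \<le> b" "a + b = 1"
  obtain X where X: "\<And>n. X n \<in> Omega" "X \<longlonglongrightarrow> x" using xy closure_Omega closure_sequential by metis
  obtain Y where Y: "\<And>n. Y n \<in> Omega" "Y \<longlonglongrightarrow> y" using xy closure_Omega closure_sequential by metis
  have lim: "(\<lambda>n. u (Z n)) \<longlonglongrightarrow> u z" if "\<And>n. Z n \<in> Omega" "Z \<longlonglongrightarrow> z" "z \<in> tetra" for Z z
    by (rule continuous_on_tendsto_compose[OF c that(2,3)])
      (intro always_eventually allI, use that(1) Omega_subset_tetra in blast)
  have Z: "a *\<^sub>R X n + b *\<^sub>R Y n \<in> Omega" for n
    using X(1) Y(1) ab convex_Omega by (auto simp: convex_def)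
  have z: "a *\<^sub>R x + b *\<^sub>R y \<in> tetra" using xy ab tc by (auto simp: convex_def)
  have "(\<lambda>n. a * u (X n) + b * u (Y n)) \<longlonglongrightarrow> a * u x + b * u y"
    by (intro tendsto_intros lim X Y xy)
  moreover have "(\<lambda>n. u (a *\<^sub>R X n + b *\<^sub>R Y n)) \<longlonglongrightarrow> u (a *\<^sub>R x + b *\<^sub>R y)"
    by (rule lim[OF Z _ z]) (intro tendsto_intros X Y)
  moreover have "u (a *\<^sub>R X n + b *\<^sub>R Y n) \<le> a * u (X n) + b * u (Y n)" for n
    using u X(1) Y(1) ab unfolding convex_on_def by blast
  ultimately show "u (a *\<^sub>R x + b *\<^sub>R y) \<le> a * u x + b * u y"
    using LIMSEQ_le by blast
qed

section \<open>Assembling the solution\<close>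

lemma uniformly_continuous_limit:
  fixes g :: "'a::metric_space \<Rightarrow> real"
  assumes "\<And>\<epsilon>. 0 < \<epsilon> \<Longrightarrow> \<exists>h. uniformly_continuous_on S h \<and> (\<forall>x\<in>S. \<bar>g x - h x\<bar> \<le> \<epsilon>)"
  shows "uniformly_continuous_on S g"
  unfolding uniformly_continuous_on_def
proof (intro allI impI)
  fix \<epsilon> :: real assume e: "0 < \<epsilon>"
  then obtain h where h: "uniformly_continuous_on S h" "\<forall>x\<in>S. \<bar>g x - h x\<bar> \<le> \<epsilon> / 4"
    using assms[of "\<epsilon> / 4"] by auto
  then obtain d where d: "0 < d" "\<forall>x\<in>S. \<forall>x'\<in>S. dist x' x < d \<longrightarrow> dist (h x') (h x) < \<epsilon> / 4"
    using e unfolding uniformly_continuous_on_def by (metis divide_pos_pos zero_less_numeral)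
  have "dist (g x') (g x) < \<epsilon>" if "x \<in> S" "x' \<in> S" "dist x' x < d" for x x'
  proof -
    have "\<bar>h x' - h x\<bar> < \<epsilon> / 4" using d that by (auto simp: dist_real_def)
    moreover have "\<bar>g x - h x\<bar> \<le> \<epsilon> / 4" "\<bar>g x' - h x'\<bar> \<le> \<epsilon> / 4" using h that by auto
    ultimately show ?thesis using e unfolding dist_real_def by linarith
  qed
  thus "\<exists>d>0. \<forall>x\<in>S. \<forall>x'\<in>S. dist x' x < d \<longrightarrow> dist (g x') (g x) < \<epsilon>" using d(1) by blast
qed

lemma iter_D_add:
  assumes "open S" "\<And>is y. length is < n \<Longrightarrow> y \<in> S \<Longrightarrow> iter_D is f differentiable at y"
    "\<And>is y. length is < n \<Longrightarrow> y \<in> S \<Longrightarrow> iter_D is g differentiable at y" "length is \<le> n" "x \<in> S"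
  shows "iter_D is (\<lambda>x. f x + g x) x = iter_D is f x + iter_D is g x"
  using assms(4,5)
proof (induction "is" arbitrary: x)
  case (Cons i "is")
  have "partial_D i (iter_D is (\<lambda>x. f x + g x)) x = partial_D i (\<lambda>x. iter_D is f x + iter_D is g x) x"
    by (rule partial_D_cong[OF assms(1) Cons.prems(2)]) (use Cons in auto)
  also have "\<dots> = partial_D i (iter_D is f) x + partial_D i (iter_D is g) x"
    by (rule partial_D_add) (use assms Cons.prems in auto)
  finally show ?case by simp
qed simp

text \<open>The windows are open, cover the half line, and meet one slab each.\<close>

definition window :: "nat \<Rightarrow> real set" where
  "window k = {t. 0 < t \<and> 2 * real k * pi < inverse t \<and> inverse t < (2 * real k + 3) * pi}"

lemma window_cover: assumes "0 < t" shows "\<exists>k. t \<in> window k"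
proof -
  define r where "r = inverse t"
  define n where "n = nat \<lfloor>r / (2 * pi)\<rfloor>"
  have p: "0 \<le> r / (2 * pi)" using assms by (simp add: r_def)
  have n: "real n \<le> r / (2 * pi)" "r / (2 * pi) < real n + 1"
    using p by (simp_all add: n_def)
  have "2 * real n * pi \<le> r" "r < (2 * real n + 2) * pi"
    using n by (simp_all add: pos_le_divide_eq pos_divide_less_eq algebra_simps)
  hence n': "2 * real n * pi \<le> inverse t" "inverse t < (2 * real n + 2) * pi"
    by (simp_all add: r_def)
  show ?thesis
  proof (cases "2 * real n * pi = inverse t")
    case False
    have "inverse t < (2 * real n + 3) * pi" by (rule less_trans[OF n'(2)]) simp
    hence "t \<in> window n" using n' False assms by (auto simp: window_def)
    thus ?thesis by blast
  next
    \<comment> \<open>At the excluded left end in 1/t, the value 2 n pi equals (2 m + 2) pi with m =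
      n - 1, which lies inside the preceding window.\<close>
    case True
    have "n \<noteq> 0"
    proof
      assume "n = 0"
      hence "inverse t = 0" using True by simp
      thus False using assms by simp
    qed
    then obtain m where m: "n = Suc m" using not0_implies_Suc by blast
    have e: "inverse t = (2 * real m + 2) * pi" using True m by (simp add: add.commute)
    have "2 * real m * pi < inverse t" "inverse t < (2 * real m + 3) * pi" unfolding e by simp_all
    hence "t \<in> window m" using assms by (simp add: window_def)
    thus ?thesis by blast
  qed
qed

lemma window_slab: assumes "t \<in> window k" "t \<in> slab l" shows "k = l"
proof -
  have 1: "2 * real k * pi < inverse t" "inverse t < (2 * real k + 3) * pi"
    using assms(1) by (simp_all add: window_def)
  have 2: "(2 * real l + 1) * pi < inverse t" "inverse t < (2 * real l + 2) * pi"
    using assms(2) by (simp_all add: slab_def)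
  note * = less_trans[OF 1(1) 2(2)] less_trans[OF 2(1) 1(2)]
  have "2 * real k < 2 * real l + 2" "2 * real l + 1 < 2 * real k + 3"
    by (rule mult_right_less_imp_less[OF *(1) pi_ge_zero] mult_right_less_imp_less[OF *(2) pi_ge_zero])+
  thus ?thesis by linarith
qed

lemma open_window: "open {x :: real^3. x $ 3 \<in> window k}"
proof -
  have "{x :: real^3. x $ 3 \<in> window k} = {x. 0 < x $ 3} \<inter> {x. 2 * real k * pi * x $ 3 < 1} \<inter> {x. 1 < (2 * real k + 3) * pi * x $ 3}"
    by (auto simp: window_def field_simps)
  moreover have "open \<dots>" by (intro open_Int open_Collect_less continuous_intros)
  ultimately show ?thesis by simp
qed

lemma det3_bounded_sy:
  assumes "\<And>i j. bx.symb n 0 0 (\<lambda>_. f i j)"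
  shows "bx.symb n 0 0 (\<lambda>_ x. det3 (\<lambda>i j. f i j x))"
  unfolding det3_def by (intro bx.sy_add bx.sy_diff sy_mult1 assms)

lemma bounded_sy_shift: "bx.symb n 0 a f \<Longrightarrow> bx.symb n 0 b f"
proof (induction n arbitrary: a b f)
  case 0
  thus ?case by (simp add: wbound_def)
next
  case (Suc n)
  have "bx.symb n 0 (b - 1) (\<lambda>k. partial_D i (f k))" for i
    by (rule Suc.IH[OF sy_partial[OF Suc.prems]])
  thus ?case using Suc.prems by (auto simp: wbound_def)
qed

lemma bounded_gradient:
  assumes "bx.symb 1 0 a (\<lambda>_. g)"
  shows "\<exists>L. \<forall>x\<in>box3. \<forall>i. \<bar>partial_D i g x\<bar> \<le> L"
proof -
  have "\<exists>L. \<forall>x\<in>box3. \<bar>partial_D i g x\<bar> \<le> L" for i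
  proof -
    have w: "wbound box3 (\<lambda>_. 1) 0 (a - 1) (\<lambda>_. partial_D i g)"
      using sy_wbound[OF sy_partial[OF assms[unfolded One_nat_def]]] .
    obtain C where C: "C > 0" "\<And>k x. 0 < (k::real) \<Longrightarrow> k \<le> 1 \<Longrightarrow> x \<in> box3 \<Longrightarrow> \<bar>partial_D i g x\<bar> \<le> C * k ^ 0 * 1 powr (a - 1)"
      using wboundE[OF w] by metis
    show ?thesis using C(2)[of 1] by (intro exI[of _ C]) simp
  qed
  then obtain L where L: "\<And>i x. x \<in> box3 \<Longrightarrow> \<bar>partial_D i g x\<bar> \<le> L i" by metis
  have "\<bar>partial_D i g x\<bar> \<le> max (L 1) (max (L 2) (L 3))" if "x \<in> box3" for i x
  proof -
    have "\<forall>i. \<bar>partial_D i g x\<bar> \<le> max (L 1) (max (L 2) (L 3))"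
      unfolding forall_3 using L[OF that] by (auto simp: le_max_iff_disj)
    thus ?thesis by blast
  qed
  thus ?thesis by blast
qed

lemma lipschitz_uniformly_continuous:
  fixes g :: "'a::real_normed_vector \<Rightarrow> real"
  assumes "\<And>x y. x \<in> S \<Longrightarrow> y \<in> S \<Longrightarrow> \<bar>g x - g y\<bar> \<le> L * norm (x - y)"
  shows "uniformly_continuous_on S g"
proof -
  have "\<bar>L\<bar>-lipschitz_on S g"
  proof (rule lipschitz_onI)
    fix x y assume xy: "x \<in> S" "y \<in> S"
    have "\<bar>g x - g y\<bar> \<le> L * norm (x - y)" by (rule assms[OF xy])
    also have "\<dots> \<le> \<bar>L\<bar> * norm (x - y)" by (intro mult_right_mono) auto
    finally show "dist (g x) (g y) \<le> \<bar>L\<bar> * dist x y" by (simp add: dist_norm)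
  qed simp
  thus ?thesis by (rule lipschitz_on_uniformly_continuous)
qed

text \<open>The origin is the only point of the closed polytope outside \<open>box3\<close>; there
  weight 3 in the squared height gives a bound of order x3^6.\<close>

lemma Vb_continuous: "continuous_on tetra Vb"
  unfolding continuous_on_eq_continuous_within
proof
  fix x assume x: "x \<in> tetra"
  show "continuous (at x within tetra) Vb"
  proof (cases "0 < x $ 3")
    case True
    have "Vb differentiable at x"
      using twice_box[OF Vb_bounded] tetra_box3[OF x True] by (auto simp: twice_def)
    thus ?thesis using differentiable_imp_continuous_within continuous_at_imp_continuous_at_within by blast
  next
    case False
    have x0: "x $ 1 = 0" "x $ 2 = 0" "x $ 3 = 0"
      using x False by (auto simp: tetra_def face4_def)
    obtain C where C: "C > 0" "\<And>k y. 0 < (k::real) \<Longrightarrow> k \<le> 1 \<Longrightarrow> y \<in> box3 \<Longrightarrow> \<bar>Vb y\<bar> \<le> C * k ^ 0 * (y $ 3 * y $ 3) powr 3"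
      using wboundE[OF sy_wbound[OF Vb_sy]] by metis
    have "(Vb \<longlongrightarrow> 0) (at x within tetra)"
    proof (rule Lim_null_comparison[where g = "\<lambda>y. C * (y $ 3) ^ 6"])
      have "norm (Vb y) \<le> C * (y $ 3) ^ 6" if y: "y \<in> tetra" for y
      proof (cases "0 < y $ 3")
        case True
        have "(y $ 3 * y $ 3) powr 3 = (y $ 3) ^ 6"
          using square_powr[OF True, of 3] True by (simp add: powr_numeral)
        thus ?thesis using C(2)[of 1 y] tetra_box3[OF y True] by simp
      next
        case False
        hence "y $ 1 = 0" using y by (auto simp: tetra_def face4_def)
        thus ?thesis using C(1) by (simp add: Vb_def)
      qed
      thus "\<forall>\<^sub>F y in at x within tetra. norm (Vb y) \<le> C * (y $ 3) ^ 6" by (auto simp: eventually_at_filter)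
      have "((\<lambda>y. C * (y $ 3) ^ 6) \<longlongrightarrow> C * (x $ 3) ^ 6) (at x within tetra)" by (intro tendsto_intros)
      thus "((\<lambda>y. C * (y $ 3) ^ 6) \<longlongrightarrow> 0) (at x within tetra)" using x0 by simp
    qed
    thus ?thesis by (simp add: continuous_within Vb_def x0)
  qed
qed

text \<open>These are the heights at which the polytope can meet the support of the cut-off.\<close>

lemma qfun_lower_bound: "\<exists>q0>0. \<forall>t. 9 \<le> t \<longrightarrow> t \<le> 10 \<longrightarrow> q0 \<le> qfun t"
proof -
  have "continuous_on {9..10} qfun"
    unfolding qfun_def[abs_def]
  proof -
    have "continuous_on {9..10} cfun" by (rule continuous_on_subset[OF continuous_cfun]) auto
    moreover have "10 - x + max 0 (x - 1) ^ 4 \<noteq> 0" if "x \<in> {9..10}" for x :: real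
      using denominator_ge[of x] that by simp
    ultimately show "continuous_on {9..10} (\<lambda>t. cfun t * inverse t * inverse (10 - t + max 0 (t - 1) ^ 4))"
      by (intro continuous_on_mult continuous_on_inverse continuous_on_add continuous_on_diff
          continuous_on_power continuous_on_max continuous_on_const continuous_on_id) auto
  qed
  then obtain t where t: "t \<in> {9..10}" "\<forall>s\<in>{9..10}. qfun t \<le> qfun s"
    using continuous_attains_inf[of "{9..10::real}" qfun] by auto
  thus ?thesis using qfun_pos[of t] by (intro exI[of _ "qfun t"]) auto
qed

section \<open>Superposition of the slab perturbations\<close>

locale slab_family =
  fixes ub :: "real^3 \<Rightarrow> real" and \<epsilon> :: real and V :: "nat \<Rightarrow> real^3 \<Rightarrow> real"
  assumes V: "\<And>k. slab_perturbation ub \<epsilon> k ((1/2) ^ k / 12) (V k)"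
begin

text \<open>On the closed polytope this is the sum of all \<open>V k\<close>; at most one term is
  nonzero because the slabs are disjoint. The factor (1/2)^k makes the series converge uniformly,
  and 1/12 is its share of the convexity budget.\<close>

definition w :: "real^3 \<Rightarrow> real" where
  "w x = (if \<exists>k. x $ 3 \<in> slab k then V (SOME k. x $ 3 \<in> slab k) x else 0)"

lemma w_slab: "x $ 3 \<in> slab k \<Longrightarrow> w x = V k x"
proof -
  assume a: "x $ 3 \<in> slab k"
  hence "(SOME k. x $ 3 \<in> slab k) = k" using slab_disjoint by (intro some_equality) blast+
  thus ?thesis using a by (auto simp: w_def)
qed

lemma V_off: "x \<in> tetra \<Longrightarrow> x $ 3 \<notin> slab k \<Longrightarrow> V k x = 0"
  using V[of k] by (simp add: slab_perturbation_def)

lemma w_frontier: "x \<in> tetra - Omega \<Longrightarrow> w x = 0"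
  using V by (simp add: w_def slab_perturbation_def)

text \<open>Slab k alone meets window k, and windows are open. Near every interior point, even at
  the boundary of a slab, \<open>w\<close> is therefore a single \<open>V k\<close>, and local
  properties transfer.\<close>

lemma local_single:
  assumes "x \<in> Omega"
  obtains k U where "open U" "x \<in> U" "U \<subseteq> Omega" "\<And>y. y \<in> U \<Longrightarrow> w y = V k y" "\<And>y l. y \<in> U \<Longrightarrow> l \<noteq> k \<Longrightarrow> V l y = 0"
proof -
  obtain k where k: "x $ 3 \<in> window k" using window_cover Omega_bounds(4)[OF assms] by blast
  show ?thesis
  proof (rule that[of "Omega \<inter> {x. x $ 3 \<in> window k}" k])
    show "open (Omega \<inter> {x. x $ 3 \<in> window k})" using open_Omega open_window by blast
    fix y assume y: "y \<in> Omega \<inter> {x. x $ 3 \<in> window k}"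
    hence yt: "y \<in> tetra" using Omega_subset_tetra by auto
    show "V l y = 0" if "l \<noteq> k" for l
      using V_off[OF yt, of l] window_slab[of "y $ 3" k l] y that by auto
    show "w y = V k y"
    proof (cases "\<exists>l. y $ 3 \<in> slab l")
      case True
      then obtain l where l: "y $ 3 \<in> slab l" by blast
      hence "k = l" using window_slab y by blast
      thus ?thesis using w_slab l by blast
    next
      case False
      thus ?thesis using V_off[OF yt] by (simp add: w_def)
    qed
  qed (use assms k in auto)
qed

lemma small: "(1/2::real) ^ k / 12 \<le> 1/12"
  by (simp add: power_le_one)

lemma w_derivatives:
  assumes "x \<in> Omega" "length is \<le> 2"
  shows "iter_D is w differentiable at x" "\<bar>iter_D is w x\<bar> \<le> 1/12"
proof -
  obtain k U where U: "open U" "x \<in> U" "U \<subseteq> Omega" "\<And>y. y \<in> U \<Longrightarrow> w y = V k y"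
    using local_single[OF assms(1)] by metis
  have e: "iter_D is w y = iter_D is (V k) y" if "y \<in> U" for y by (rule iter_D_cong[OF U(1,4) that])
  have Vk: "iter_D is (V k) differentiable at x" "\<bar>iter_D is (V k) x\<bar> \<le> (1/2) ^ k / 12"
    using V[of k] assms by (auto simp: slab_perturbation_def)
  show "iter_D is w differentiable at x"
    by (rule differentiable_cong_open[OF U(1,2) _ Vk(1)]) (simp add: e)
  show "\<bar>iter_D is w x\<bar> \<le> 1/12" using Vk(2) e[OF U(2)] small[of k] by simp
qed

lemma power_half_small: "0 < e \<Longrightarrow> \<exists>n. \<forall>k\<ge>n. (1/2::real) ^ k / 12 \<le> e"
proof -
  assume "0 < e"
  then obtain n where n: "(1/2::real) ^ n < e" using real_arch_pow_inv[of e "1/2"] by auto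
  have "(1/2::real) ^ k / 12 \<le> e" if "n \<le> k" for k
  proof -
    have "(1/2::real) ^ k / 12 \<le> (1/2) ^ k" by simp
    also have "\<dots> \<le> (1/2) ^ n" using that by (intro power_decreasing) auto
    finally show ?thesis using n by simp
  qed
  thus ?thesis by blast
qed

lemma sum_single:
  fixes n k :: nat
  shows "(\<And>l. l \<noteq> k \<Longrightarrow> f l = (0::real)) \<Longrightarrow> (\<Sum>l<n. f l) = (if k < n then f k else 0)"
proof -
  assume a: "\<And>l. l \<noteq> k \<Longrightarrow> f l = 0"
  have "(\<Sum>l<n. f l) = (\<Sum>l<n. if l = k then f k else 0)" by (rule sum.cong) (use a in auto)
  also have "\<dots> = (if k < n then f k else 0)" by (subst sum.delta) auto
  finally show ?thesis .
qed

text \<open>The partial sums converge uniformly: what is missing at a point is at most one term, of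
  size (1/2)^k / 12 with k beyond the truncation.\<close>

lemma w_uniformly_continuous:
  assumes "length is \<le> 2"
  shows "uniformly_continuous_on Omega (iter_D is w)"
proof (rule uniformly_continuous_limit)
  fix e :: real assume "0 < e"
  then obtain n where n: "\<forall>k\<ge>n. (1/2::real) ^ k / 12 \<le> e" using power_half_small by blast
  have "\<bar>iter_D is w x - (\<Sum>l<n. iter_D is (V l) x)\<bar> \<le> e" if x: "x \<in> Omega" for x
  proof -
    obtain k U where U: "open U" "x \<in> U" "U \<subseteq> Omega" "\<And>y. y \<in> U \<Longrightarrow> w y = V k y" "\<And>y l. y \<in> U \<Longrightarrow> l \<noteq> k \<Longrightarrow> V l y = 0"
      using local_single[OF x] by metis
    have "iter_D is w x = iter_D is (V k) x" by (rule iter_D_cong[OF U(1,4,2)])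
    moreover have "(\<Sum>l<n. iter_D is (V l) x) = (if k < n then iter_D is (V k) x else 0)"
      by (rule sum_single, rule iter_D_zero_near(1)[OF U(1,2)]) (rule U(5))
    moreover have "\<bar>iter_D is (V k) x\<bar> \<le> (1/2) ^ k / 12"
      using V[of k] assms x by (auto simp: slab_perturbation_def)
    ultimately show ?thesis using n \<open>0 < e\<close> by (auto simp: not_less intro: order_trans)
  qed
  moreover have "uniformly_continuous_on Omega (\<lambda>x. \<Sum>l<n. iter_D is (V l) x)"
    by (rule uniformly_continuous_on_sum) (use V assms in \<open>auto simp: slab_perturbation_def\<close>)
  ultimately show "\<exists>h. uniformly_continuous_on Omega h \<and> (\<forall>x\<in>Omega. \<bar>iter_D is w x - h x\<bar> \<le> e)" by blast
qed

lemma w_continuous: "continuous_on tetra w"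
proof -
  have "uniformly_continuous_on tetra w"
  proof (rule uniformly_continuous_limit)
    fix e :: real assume "0 < e"
    then obtain n where n: "\<forall>k\<ge>n. (1/2::real) ^ k / 12 \<le> e" using power_half_small by blast
    have "\<bar>w x - (\<Sum>l<n. V l x)\<bar> \<le> e" if x: "x \<in> tetra" for x
    proof (cases "\<exists>k. x $ 3 \<in> slab k")
      case True
      then obtain k where k: "x $ 3 \<in> slab k" by blast
      have "(\<Sum>l<n. V l x) = (if k < n then V k x else 0)"
        by (rule sum_single, rule V_off[OF x]) (use k slab_disjoint in blast)
      moreover have "\<bar>V k x\<bar> \<le> (1/2) ^ k / 12" using V[of k] x by (auto simp: slab_perturbation_def)
      ultimately show ?thesis using n \<open>0 < e\<close> w_slab[of x k, OF k] by (auto simp: not_less intro: order_trans)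
    next
      case False
      thus ?thesis using V_off[OF x] \<open>0 < e\<close> by (simp add: w_def)
    qed
    moreover have "uniformly_continuous_on tetra (\<lambda>x. \<Sum>l<n. V l x)"
      by (rule uniformly_continuous_on_sum, rule compact_uniformly_continuous[OF _ compact_tetra])
        (use V in \<open>auto simp: slab_perturbation_def\<close>)
    ultimately show "\<exists>h. uniformly_continuous_on tetra h \<and> (\<forall>x\<in>tetra. \<bar>w x - h x\<bar> \<le> e)" by blast
  qed
  thus ?thesis by (rule uniformly_continuous_imp_continuous)
qed

lemma w_det_gap:
  assumes "x \<in> Omega"
  shows "\<bar>det_gap ub w x\<bar> \<le> rho x * (face3 x * face4 x)" "det_gap ub w differentiable at x"
    "\<bar>partial_D i (det_gap ub w) x\<bar> \<le> 1"
proof -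
  obtain k U where U: "open U" "x \<in> U" "U \<subseteq> Omega" "\<And>y. y \<in> U \<Longrightarrow> w y = V k y"
    using local_single[OF assms(1)] by metis
  have e: "det_gap ub w y = det_gap ub (V k) y" if "y \<in> U" for y
    using hessian_cong[OF U(1) that, of "\<lambda>x. ub x + w x" "\<lambda>x. ub x + V k x"] U(4) by (simp add: det_gap_def)
  have Vk: "\<bar>det_gap ub (V k) x\<bar> \<le> rho x * (face3 x * face4 x)" "det_gap ub (V k) differentiable at x"
    "\<bar>partial_D i (det_gap ub (V k)) x\<bar> \<le> 1" using V[of k] assms by (auto simp: slab_perturbation_def)
  show "\<bar>det_gap ub w x\<bar> \<le> rho x * (face3 x * face4 x)" using Vk(1) e[OF U(2)] by simp
  show "det_gap ub w differentiable at x"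
    by (rule differentiable_cong_open[OF U(1,2) _ Vk(2)]) (simp add: e)
  show "\<bar>partial_D i (det_gap ub w) x\<bar> \<le> 1"
    using Vk(3) partial_D_cong[OF U(1,2) e] by simp
qed

lemma w_not_hoelder:
  assumes "edge_gap \<epsilon> k < \<alpha>"
  shows "\<not> hoelder_on \<alpha> Omega (iter_D [1, 1] (\<lambda>x. ub x + w x))"
proof
  assume "hoelder_on \<alpha> Omega (iter_D [1, 1] (\<lambda>x. ub x + w x))"
  hence h: "hoelder_on \<alpha> (Omega \<inter> {x. x $ 3 \<in> slab k}) (iter_D [1, 1] (\<lambda>x. ub x + w x))"
    by (rule hoelder_on_subset) auto
  have op: "open {x :: real^3. x $ 3 \<in> slab k}"
    unfolding slab_interval by (simp add: open_Int open_Collect_conj open_Collect_less continuous_intros)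
  have "iter_D [1, 1] (\<lambda>x. ub x + w x) x = iter_D [1, 1] (\<lambda>x. ub x + V k x) x" if "x \<in> Omega \<inter> {x. x $ 3 \<in> slab k}" for x
    by (rule iter_D_cong[OF op]) (use that w_slab in auto)
  with h have "hoelder_on \<alpha> (Omega \<inter> {x. x $ 3 \<in> slab k}) (iter_D [1, 1] (\<lambda>x. ub x + V k x))"
    unfolding hoelder_on_def by (simp del: iter_D.simps)
  thus False using V[of k] assms unfolding slab_perturbation_def by blast
qed

end

text \<open>On the boundary \<open>f\<close> is known only as a limit from inside. Along such a
  sequence the gap bound tends to 0, while the determinant of the base function is continuous up to
  the edge.\<close>

lemma edge_det_base:
  fixes f :: "real^3 \<Rightarrow> real"
  assumes f: "continuous_on tetra f"
    and fD: "\<And>y. y \<in> Omega \<Longrightarrow> \<bar>f y - det (hessian ub y)\<bar> \<le> rho y * (face3 y * face4 y)"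
    and D: "isCont (\<lambda>x. det (hessian ub x)) x"
    and x: "x \<in> tetra" "rho x * (face3 x * face4 x) = 0"
  shows "f x = det (hessian ub x)"
proof -
  obtain p where p: "\<And>n. p n \<in> Omega" "p \<longlonglongrightarrow> x" using x closure_Omega closure_sequential by metis
  have "(\<lambda>n. f (p n)) \<longlonglongrightarrow> f x"
    by (rule continuous_on_tendsto_compose[OF f p(2) x(1)])
      (intro always_eventually allI, use p(1) Omega_subset_tetra in blast)
  moreover have "(\<lambda>n. det (hessian ub (p n))) \<longlonglongrightarrow> det (hessian ub x)"
    using isCont_tendsto_compose[OF D p(2)] .
  ultimately have "(\<lambda>n. f (p n) - det (hessian ub (p n))) \<longlonglongrightarrow> f x - det (hessian ub x)" by (rule tendsto_diff)
  moreover have "(\<lambda>n. f (p n) - det (hessian ub (p n))) \<longlonglongrightarrow> 0"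
  proof (rule Lim_null_comparison)
    show "\<forall>\<^sub>F n in sequentially. norm (f (p n) - det (hessian ub (p n))) \<le> rho (p n) * (face3 (p n) * face4 (p n))"
      using fD p(1) by simp
    have "(\<lambda>n. rho (p n) * (face3 (p n) * face4 (p n))) \<longlonglongrightarrow> rho x * (face3 x * face4 x)"
      unfolding face3_def face4_def by (intro tendsto_intros p)
    thus "(\<lambda>n. rho (p n) * (face3 (p n) * face4 (p n))) \<longlonglongrightarrow> 0" using x(2) by simp
  qed
  ultimately have "f x - det (hessian ub x) = 0" by (rule LIMSEQ_unique)
  thus ?thesis by simp
qed

lemma edge_faces_zero:
  assumes "x \<in> Gamma1 Omega - Gamma0 Omega"
  shows "0 < x $ 3" "rho x * (face3 x * face4 x) = 0"
proof -
  show "0 < x $ 3" using assms by (cases rule: open_edge_cases) auto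
  show "rho x * (face3 x * face4 x) = 0"
    using assms by (cases rule: open_edge_cases) (auto simp: face3_def face4_def)
qed

lemma base_eq_phi: "base lam \<zeta> \<epsilon> x = phi lam \<zeta> x + \<epsilon> * Vb x"
  by (simp add: base_def phi_eq)

lemma base_slab:
  assumes "cutoff_at_apex \<zeta>" "x $ 3 \<in> slab k"
  shows "base lam \<zeta> \<epsilon> x = quad 0 x + \<epsilon> * Vb x"
proof -
  have "1 \<le> \<bar>(x - apex) $ 3\<bar>" using slab_bounds[OF assms(2)] by (simp add: apex_nth)
  also have "\<dots> \<le> dist x apex" unfolding dist_norm by (rule component_le_norm_cart)
  finally have "\<zeta> x = 0" using assms(1) by (auto simp: cutoff_at_apex_def dist_commute)
  thus ?thesis by (simp add: base_def psi_def)
qed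

lemma base_continuous:
  assumes "smooth \<zeta>"
  shows "continuous_on tetra (base lam \<zeta> \<epsilon>)"
proof -
  have "continuous_on tetra \<zeta>"
    using smooth_differentiable[OF assms] differentiable_imp_continuous_within continuous_at_imp_continuous_at_within
    by (auto simp: continuous_on_eq_continuous_within) blast
  thus ?thesis unfolding base_def[abs_def] quad_def psi_def
    by (intro continuous_intros Vb_continuous) auto
qed

theorem lemma6p2:
  fixes cutoff :: "real^3 \<Rightarrow> real"
  assumes "smooth cutoff"
    and "\<forall>x\<in>ball apex (1/2). cutoff x = 1"
    and "\<forall>x. x \<notin> ball apex 1 \<longrightarrow> cutoff x = 0"
  shows "\<exists>lam>0. \<forall>lam0. 0 < lam0 \<and> lam0 < lam \<longrightarrow>
    (\<exists>f. f \<in> Ck_alpha_closure 0 1 Omega \<and>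
         (\<forall>x\<in>Gamma1 Omega - Gamma0 Omega. det (hessian (phi lam0 cutoff) x) > f x) \<and>
         (\<exists>u. (\<forall>x\<in>Omega. det (hessian u x) = f x) \<and>
              (\<forall>x\<in>frontier Omega. u x = phi lam0 cutoff x) \<and>
              convex_on (closure Omega) u \<and>
              u \<in> Ck_closure 2 Omega \<and>
              (\<forall>\<alpha>. 0 < \<alpha> \<and> \<alpha> < 1 \<longrightarrow> u \<notin> Ck_alpha_closure 2 \<alpha> Omega)))"
proof -
  have \<zeta>: "cutoff_at_apex cutoff" using assms by (simp add: cutoff_at_apex_def)
  have "continuous_on UNIV cutoff"
    using smooth_differentiable[OF assms(1)] differentiable_imp_continuous_within
    by (auto simp: continuous_on_eq_continuous_within)
  then obtain B1 where B1: "\<And>x. x \<in> box3 \<Longrightarrow> \<bar>cutoff x\<bar> \<le> B1"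
    using continuous_bounded_box3 by blast
  obtain B2 where B2: "\<And>x i. x \<in> box3 \<Longrightarrow> \<bar>partial_D i cutoff x\<bar> \<le> B2"
    using bounded_gradient[OF smooth_sy[OF assms(1)]] by blast
  define B where "B = max (max B1 B2) 0"
  have B: "0 \<le> B" "\<And>x. x \<in> box3 \<Longrightarrow> \<bar>cutoff x\<bar> \<le> B" "\<And>x i. x \<in> box3 \<Longrightarrow> \<bar>partial_D i cutoff x\<bar> \<le> B"
    using B1 B2 by (auto simp: B_def le_max_iff_disj)
  obtain Bp where Bp: "0 < Bp" "\<And>x i j. x \<in> box3 \<Longrightarrow> \<bar>iter_D [i, j] (psi cutoff) x\<bar> \<le> Bp"
    using bounded_hessian[OF psi_sy[OF assms(1)]] by blast
  obtain Bv where Bv: "0 < Bv" "\<And>x i j. x \<in> box3 \<Longrightarrow> \<bar>iter_D [i, j] Vb x\<bar> \<le> Bv"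
    using bounded_hessian[OF Vb_bounded] by blast
  obtain q0 where q0: "0 < q0" "\<And>t. 9 \<le> t \<Longrightarrow> t \<le> 10 \<Longrightarrow> q0 \<le> qfun t" using qfun_lower_bound by blast
  \<comment> \<open>Cut-off term, \<open>Vb\<close> and \<open>w\<close> may each contribute 1/12 to
    the entries of the Hessian minus the identity, which adds up to the 1/4 that convexity
    tolerates. The bound 1/2 keeps the exponent gaps below 1.\<close>
  define \<epsilon> where "\<epsilon> = min (1/2) (1 / (12 * Bv))"
  have \<epsilon>: "0 < \<epsilon>" "\<epsilon> \<le> 1/2" "\<epsilon> \<le> 1 / (12 * Bv)" using Bv by (auto simp: \<epsilon>_def)
  have \<epsilon>Bv: "\<epsilon> * Bv \<le> 1/12" using \<epsilon>(3) Bv(1) by (simp add: field_simps)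
  \<comment> \<open>The second bound yields \<open>lam0 * B < \<epsilon> * q0\<close>, as
    \<open>edge_det_less\<close> requires; \<open>B + 1\<close> avoids a zero denominator.\<close>
  define lam where "lam = min (1 / (12 * Bp)) (\<epsilon> * q0 / (B + 1))"
  have lam: "0 < lam" using Bp \<epsilon> q0 B(1) by (auto simp: lam_def)
  show ?thesis
  proof (intro exI[of _ lam] conjI lam allI impI)
    fix lam0 assume "0 < lam0 \<and> lam0 < lam"
    hence l0: "0 < lam0" "lam0 < 1 / (12 * Bp)" "lam0 < \<epsilon> * q0 / (B + 1)" by (auto simp: lam_def)
    have l1: "lam0 * Bp \<le> 1/12" using l0(2) Bp(1) by (simp add: field_simps)
    have l2: "lam0 * B < \<epsilon> * q0"
    proof -
      have "lam0 * B \<le> lam0 * (B + 1)" using l0 by simp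
      also have "\<dots> < \<epsilon> * q0" using l0(3) B(1) by (simp add: pos_less_divide_eq)
      finally show ?thesis .
    qed
    define ub where "ub = base lam0 cutoff \<epsilon>"
    have "\<exists>V. slab_perturbation ub \<epsilon> k ((1/2) ^ k / 12) V" for k
      by (rule slab_perturbation_exists[OF \<epsilon>(1,2)]) (auto simp: ub_def base_slab[OF \<zeta>])
    then obtain V where V: "\<And>k. slab_perturbation ub \<epsilon> k ((1/2) ^ k / 12) (V k)" by metis
    interpret F: slab_family ub \<epsilon> V by unfold_locales (rule V)
    define u where "u x = ub x + F.w x" for x
    have ubs: "bx.symb 3 0 0 (\<lambda>_. ub)" unfolding ub_def by (rule base_sy[OF assms(1)])
    have ub_iter: "bx.symb 1 0 0 (\<lambda>_. iter_D is ub)" if "length is \<le> 2" for "is"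
    proof -
      have "bx.symb (3 - length is) 0 (0 - real (length is)) (\<lambda>_. iter_D is ub)"
        by (rule sy_iter[OF ubs]) (use that in simp)
      hence "bx.symb 1 0 (0 - real (length is)) (\<lambda>_. iter_D is ub)"
        by (rule sy_le[rotated]) (use that in simp)
      thus ?thesis by (rule bounded_sy_shift)
    qed
    have ub_diff: "iter_D is ub differentiable at x" if "length is \<le> 2" "x \<in> box3" for "is" x
      using sy_differentiable[OF ub_iter[OF that(1), unfolded One_nat_def], of 1 x] that by simp
    have u_iter: "iter_D is u x = iter_D is ub x + iter_D is F.w x" if "length is \<le> 2" "x \<in> Omega" for "is" x
      unfolding u_def
      by (rule iter_D_add[OF open_Omega, of 2])
        (use that Omega_box3 in \<open>auto intro!: ub_diff F.w_derivatives\<close>)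
    have u_diff: "iter_D is u differentiable at x" if "length is \<le> 2" "x \<in> Omega" for "is" x
    proof (rule differentiable_cong_open[OF open_Omega that(2), of "\<lambda>x. iter_D is ub x + iter_D is F.w x"])
      show "(\<lambda>x. iter_D is ub x + iter_D is F.w x) differentiable at x"
        using that Omega_box3 by (auto intro!: differentiable_add ub_diff F.w_derivatives)
    qed (use that u_iter in simp)
    have u_uc: "uniformly_continuous_on Omega (iter_D is u)" if len: "length is \<le> 2" for "is"
    proof -
      obtain L where L: "\<forall>x\<in>box3. \<forall>i. \<bar>partial_D i (iter_D is ub) x\<bar> \<le> L"
        using bounded_gradient[OF ub_iter[OF len]] by blast
      have "uniformly_continuous_on Omega (iter_D is ub)"
        by (rule lipschitz_uniformly_continuous, rule bounded_partials_imp_lipschitz[OF convex_Omega])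
          (use ub_diff[OF len] L Omega_box3 in auto)
      hence "uniformly_continuous_on Omega (\<lambda>x. iter_D is ub x + iter_D is F.w x)"
        by (intro uniformly_continuous_on_add F.w_uniformly_continuous len)
      thus ?thesis using u_iter[OF len]
        by (simp add: uniformly_continuous_on_def)
    qed
    have ext: "\<exists>g'. continuous_on (closure Omega) g' \<and> (\<forall>x\<in>Omega. g' x = g x)"
      if "uniformly_continuous_on Omega g" for g :: "real^3 \<Rightarrow> real"
      using uniformly_continuous_on_extension_on_closure[OF that] uniformly_continuous_imp_continuous by metis
    define D where "D x = det (hessian ub x)" for x
    have Ds: "bx.symb 1 0 0 (\<lambda>_. D)"
      unfolding D_def[abs_def] det_hessian by (rule det3_bounded_sy, rule ub_iter) simp
    have D_diff: "D differentiable at x" if "x \<in> box3" for x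
      using sy_differentiable[OF Ds[unfolded One_nat_def], of 1 x] that by simp
    obtain L where L: "\<And>x i. x \<in> box3 \<Longrightarrow> \<bar>partial_D i D x\<bar> \<le> L"
      using bounded_gradient[OF Ds] by blast
    define g where "g x = det (hessian u x)" for x
    have g: "g x = D x + det_gap ub F.w x" for x
      by (simp add: g_def D_def det_gap_def u_def[abs_def])
    have g_lip: "\<bar>g x - g y\<bar> \<le> real CARD(3) * (L + 1) * norm (x - y)" if "x \<in> Omega" "y \<in> Omega" for x y
    proof (rule bounded_partials_imp_lipschitz[OF convex_Omega _ _ that])
      fix z i assume z: "z \<in> Omega"
      have d: "D differentiable at z" "det_gap ub F.w differentiable at z"
        using D_diff F.w_det_gap z Omega_box3 by auto
      have e: "g = (\<lambda>x. D x + det_gap ub F.w x)" using g by blast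
      show "g differentiable at z" unfolding e using d by (rule differentiable_add)
      have "\<bar>partial_D i D z\<bar> \<le> L" "\<bar>partial_D i (det_gap ub F.w) z\<bar> \<le> 1"
        using L F.w_det_gap z Omega_box3 by auto
      thus "\<bar>partial_D i g z\<bar> \<le> L + 1" unfolding e partial_D_add[OF d] by linarith
    qed
    \<comment> \<open>The Hessian of \<open>u\<close> is not controlled at boundary points, so
      \<open>f\<close> is the continuous extension of its determinant from the interior.\<close>
    have "uniformly_continuous_on Omega g" by (rule lipschitz_uniformly_continuous) (rule g_lip)
    then obtain f where f: "continuous_on (closure Omega) f" "\<And>x. x \<in> Omega \<Longrightarrow> f x = g x" using ext by blast
    have ft: "continuous_on tetra f" using f(1) by (simp add: closure_Omega)
    have "f \<in> Ck_alpha_closure 0 1 Omega"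
    proof -
      have "\<bar>f x - f y\<bar> \<le> real CARD(3) * (L + 1) * dist x y powr 1" if "x \<in> Omega" "y \<in> Omega" for x y
        using g_lip[OF that] f(2) that by (simp add: dist_norm)
      hence "hoelder_on 1 Omega f" unfolding hoelder_on_def by blast
      thus ?thesis using f(1) by (auto simp: Ck_alpha_closure_def Ck_closure_def)
    qed
    moreover have "det (hessian (phi lam0 cutoff) x) > f x" if x: "x \<in> Gamma1 Omega - Gamma0 Omega" for x
    proof -
      note z = edge_faces_zero[OF x]
      have xt: "x \<in> tetra" using x Gamma1_tetra by auto
      have xb: "x \<in> box3" by (rule tetra_box3[OF xt z(1)])
      have "isCont D x" using D_diff[OF xb] differentiable_imp_continuous_within by blast
      moreover have "\<bar>f y - det (hessian ub y)\<bar> \<le> rho y * (face3 y * face4 y)" if "y \<in> Omega" for y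
        using F.w_det_gap(1)[OF that] f(2)[OF that] g[of y] by (simp add: D_def)
      ultimately have "f x = det (hessian ub x)"
        by (intro edge_det_base[OF ft _ _ xt z(2)]) (auto simp: D_def[abs_def])
      also have "\<dots> < det (hessian (phi lam0 cutoff) x)"
        unfolding ub_def by (rule edge_det_less[OF \<zeta> x B(3) B(2) q0 l0(1) l2 \<epsilon>(1)])
      finally show ?thesis .
    qed
    moreover have "det (hessian u x) = f x" if "x \<in> Omega" for x using f(2)[OF that] by (simp add: g_def)
    moreover have "u x = phi lam0 cutoff x" if x: "x \<in> frontier Omega" for x
    proof -
      have xf: "x \<in> tetra - Omega" using x by (simp add: frontier_Omega)
      hence "Vb x = 0" by (intro Vb_zero) (auto simp: tetra_def Omega_iff less_le)
      thus ?thesis using F.w_frontier[OF xf] by (simp add: u_def ub_def base_eq_phi)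
    qed
    moreover have uc: "continuous_on tetra u"
      unfolding u_def[abs_def] ub_def by (intro continuous_on_add base_continuous assms F.w_continuous)
    moreover have "convex_on (closure Omega) u"
      unfolding closure_Omega
    proof (rule convex_on_closure_Omega[OF convex_from_hessian uc])
      show "twice Omega u" unfolding twice_def
        using u_diff[of "[]"] u_diff[of "[j]" for j] by simp
      fix x i j assume x: "x \<in> Omega"
      have xb: "x \<in> box3" using x Omega_box3 by auto
      have e: "iter_D [i, j] u x - (if i = j then 1 else 0) =
          lam0 * iter_D [i, j] (psi cutoff) x + \<epsilon> * iter_D [i, j] Vb x + iter_D [i, j] F.w x"
        using u_iter[of "[i, j]" x] x base_hessian(2)[OF assms(1) xb, of i j lam0 \<epsilon>]
        by (simp add: ub_def del: iter_D.simps)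
      have "\<bar>lam0 * iter_D [i, j] (psi cutoff) x\<bar> \<le> lam0 * Bp"
        unfolding abs_mult using Bp(2)[OF xb] l0(1) by (simp add: mult_left_mono del: iter_D.simps)
      moreover have "\<bar>\<epsilon> * iter_D [i, j] Vb x\<bar> \<le> \<epsilon> * Bv"
        unfolding abs_mult using Bv(2)[OF xb] \<epsilon>(1) by (simp add: mult_left_mono del: iter_D.simps)
      moreover have "\<bar>iter_D [i, j] F.w x\<bar> \<le> 1/12" by (rule F.w_derivatives(2)[OF x]) simp
      ultimately show "\<bar>iter_D [i, j] u x - (if i = j then 1 else 0)\<bar> \<le> 1/4"
        unfolding e using l1 \<epsilon>Bv by linarith
    qed
    moreover have "u \<in> Ck_closure 2 Omega"
      unfolding Ck_closure_def using u_diff ext[OF u_uc] uc by (auto simp: closure_Omega)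
    moreover have "u \<notin> Ck_alpha_closure 2 \<alpha> Omega" if \<alpha>: "0 < \<alpha> \<and> \<alpha> < 1" for \<alpha>
    proof
      assume "u \<in> Ck_alpha_closure 2 \<alpha> Omega"
      hence h: "hoelder_on \<alpha> Omega (iter_D [1, 1] u)"
        unfolding Ck_alpha_closure_def by (simp del: iter_D.simps)
      obtain k where "edge_gap \<epsilon> k < \<alpha>"
        using order_tendstoD(2)[OF edge_gap_tendsto[OF \<epsilon>(1,2)], of \<alpha>] \<alpha> eventually_happens' sequentially_bot by blast
      from F.w_not_hoelder[OF this] h show False by (simp only: u_def[abs_def])
    qed
    ultimately show "\<exists>f. f \<in> Ck_alpha_closure 0 1 Omega \<and>
         (\<forall>x\<in>Gamma1 Omega - Gamma0 Omega. det (hessian (phi lam0 cutoff) x) > f x) \<and>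
         (\<exists>u. (\<forall>x\<in>Omega. det (hessian u x) = f x) \<and>
              (\<forall>x\<in>frontier Omega. u x = phi lam0 cutoff x) \<and>
              convex_on (closure Omega) u \<and>
              u \<in> Ck_closure 2 Omega \<and>
              (\<forall>\<alpha>. 0 < \<alpha> \<and> \<alpha> < 1 \<longrightarrow> u \<notin> Ck_alpha_closure 2 \<alpha> Omega))"
      by (intro exI[of _ f] conjI ballI exI[of _ u] allI impI) simp_all
  qed
qed

end
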